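(* Let $f:U\to\mathbf{R}^3$ be a front with unit normal vector field $\nu$, let $f$ at $p\in S(f)$ be a cuspidal edge, and let $f^*$ be the dual surface of $f$ (with respect to a constant vector $\mathbf{c}\in\mathbf{R}^3\setminus\{\mathbf 0\}$ satisfying $\langle\nu(p),\mathbf{c}\rangle\neq0$). Then $f^*$ has a cuspidal edge at $p$ if and only if $\hat\kappa_2(p)=0$ and $p$ is not a ridge point of $f$.
   Context: All maps are $C^\infty$. A map $f:U\to\mathbf{R}^3$ ($U\subset\mathbf{R}^2$ a domain) is a front if there is a unit vector field $\nu$ along $f$ with $\langle df(X),\nu\rangle=0$ for all tangent vectors $X$ and such that $(f,\nu):U\to\mathbf{R}^3\times S^2$ is an immersion. $S(f)$ is the set of points where $f$ is not an immersion. A map is a cuspidal edge at $p$ (has a cuspidal edge at $p$) if its germ at $p$ is, up to diffeomorphism-germs of source and target, $(u,v)\mapsto(u,v^2,v^3)$ at $0$. Dual surface: put $\bar f=f+\mathbf{c}$, $\rho=\langle\bar f,\nu\rangle$, and $f^*(u,v)=\rho(u,v)\,\nu(u,v)$. Adapted coordinates $(u,v)$ centered at $p$: the $u$-axis is the singular set of $f$, $f_v(u,0)=0$, and there are no other singular points. Then $f_v=v\psi$ with $\psi$ smooth and nowhere zero, $f_u,\psi$ are linearly independent, and $\nu=f_u\times\psi/\|f_u\times\psi\|$. Set $\hat E=\langle f_u,f_u\rangle$, $\hat F=\langle f_u,\psi\rangle$, $\hat G=\langle\psi,\psi\rangle$, $\hat L=-\langle f_u,\nu_u\rangle$, $\hat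 M=-\langle\psi,\nu_u\rangle$, $\hat N=-\langle\psi,\nu_v\rangle$, $\hat A=\hat E\hat N-2v\hat F\hat M+v\hat G\hat L$, $\hat B=\sqrt{\hat A^2-4v(\hat E\hat G-\hat F^2)(\hat L\hat N-v\hat M^2)}$ and $$\hat\kappa_2=\frac{\hat A-\hat B}{2v(\hat E\hat G-\hat F^2)}\quad(v\neq0).$$ Standing assumption: $\hat N>0$ on the $u$-axis; then $\hat\kappa_2$ extends smoothly across the $u$-axis near $p$, and the extension is denoted by the same symbol. The principal direction is $\hat{\boldsymbol v}=\xi\partial_u+\zeta\partial_v$ with $(\xi,\zeta)=(\hat N-v\hat\kappa_2\hat G,\,-\hat M+\hat\kappa_2\hat F)$. The point $p$ is a ridge point of $f$ if the directional derivative $\hat{\boldsymbol v}\hat\kappa_2$ vanishes at $p$.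
   Formalization: The formal theorem additionally assumes ⟨f(p)+c, ν(p)⟩ ≠ 0 (automatic if f(p)=0); without it the claim fails, e.g. if f(p) = −c then df*(p) = 0 and f* is not a cuspidal edge even when κ̂₂(p)=0 and p is not a ridge point. *)

theory Defs
  imports "HOL-Analysis.Analysis"
begin

text \<open>Smooth maps on open sets.  \<open>Ck_on k f S\<close> says that all iterated directional derivatives of
  \<open>f\<close> up to order \<open>k\<close> exist and are continuous on \<open>S\<close>; it is only meant for open \<open>S\<close>.\<close>

primrec Ck_on :: "nat \<Rightarrow> ('a::real_normed_vector \<Rightarrow> 'b::real_normed_vector) \<Rightarrow> 'a set \<Rightarrow> bool" where
  "Ck_on 0 f S \<longleftrightarrow> continuous_on S f"
| "Ck_on (Suc k) f S \<longleftrightarrow>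
     (\<forall>x\<in>S. f differentiable (at x)) \<and> (\<forall>w. Ck_on k (\<lambda>x. frechet_derivative f (at x) w) S)"

definition smooth_on :: "('a::real_normed_vector \<Rightarrow> 'b::real_normed_vector) \<Rightarrow> 'a set \<Rightarrow> bool" where
  "smooth_on f S \<longleftrightarrow> (\<forall>k. Ck_on k f S)"

definition diffeo_on ::
    "('a::real_normed_vector \<Rightarrow> 'b::real_normed_vector) \<Rightarrow> 'a set \<Rightarrow> 'b set \<Rightarrow> bool" where
  "diffeo_on \<phi> V W \<longleftrightarrow> open V \<and> open W \<and> smooth_on \<phi> V \<and> \<phi> ` V = W \<and>
     (\<exists>\<theta>. smooth_on \<theta> W \<and> (\<forall>z\<in>V. \<theta> (\<phi> z) = z) \<and> (\<forall>y\<in>W. \<phi> (\<theta> y) = y))"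

definition immersion_at :: "('a::real_normed_vector \<Rightarrow> 'b::real_normed_vector) \<Rightarrow> 'a \<Rightarrow> bool" where
  "immersion_at f z \<longleftrightarrow> f differentiable (at z) \<and> inj (frechet_derivative f (at z))"

text \<open>As \<open>\<nu>\<close> takes values in the unit sphere, \<open>(f, \<nu>)\<close> is an immersion into \<open>R\<^sup>3 \<times> S\<^sup>2\<close> iff it is one
  into \<open>R\<^sup>3 \<times> R\<^sup>3\<close>.\<close>

definition front_with :: "(real^2 \<Rightarrow> real^3) \<Rightarrow> (real^2 \<Rightarrow> real^3) \<Rightarrow> (real^2) set \<Rightarrow> bool" where
  "front_with f \<nu> U \<longleftrightarrow> open U \<and> connected U \<and> U \<noteq> {} \<and> smooth_on f U \<and> smooth_on \<nu> U \<and>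
     (\<forall>z\<in>U. norm (\<nu> z) = 1) \<and>
     (\<forall>z\<in>U. \<forall>X. frechet_derivative f (at z) X \<bullet> \<nu> z = 0) \<and>
     (\<forall>z\<in>U. immersion_at (\<lambda>z. (f z, \<nu> z)) z)"

definition singular_set :: "(real^2 \<Rightarrow> real^3) \<Rightarrow> (real^2) set \<Rightarrow> (real^2) set" where
  "singular_set f U = {z\<in>U. \<not> immersion_at f z}"

text \<open>A condition on the germ of \<open>f\<close> at \<open>p\<close>: the neighbourhoods \<open>V\<close>, \<open>W\<close> of \<open>0\<close>, \<open>p\<close> in the source and
  \<open>A\<close>, \<open>B\<close> of \<open>f p\<close>, \<open>0\<close> in the target may be arbitrarily small.\<close>

definition cuspidal_edge_at :: "(real^2 \<Rightarrow> real^3) \<Rightarrow> real^2 \<Rightarrow> bool" where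
  "cuspidal_edge_at f p \<longleftrightarrow>
     (\<exists>(\<phi> :: real^2 \<Rightarrow> real^2) V W (\<Phi> :: real^3 \<Rightarrow> real^3) A B.
        diffeo_on \<phi> V W \<and> 0 \<in> V \<and> \<phi> 0 = p \<and>
        diffeo_on \<Phi> A B \<and> f p \<in> A \<and> \<Phi> (f p) = 0 \<and> f ` W \<subseteq> A \<and>
        (\<forall>z\<in>V. \<Phi> (f (\<phi> z)) = vector [z $ 1, (z $ 2)\<^sup>2, (z $ 2) ^ 3]))"

definition dual_surface :: "(real^2 \<Rightarrow> real^3) \<Rightarrow> (real^2 \<Rightarrow> real^3) \<Rightarrow> real^3 \<Rightarrow> real^2 \<Rightarrow> real^3" where
  "dual_surface f \<nu> c z = ((f z + c) \<bullet> \<nu> z) *\<^sub>R \<nu> z"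

definition pd_u :: "(real^2 \<Rightarrow> real^3) \<Rightarrow> real^2 \<Rightarrow> real^3" where
  "pd_u g z = frechet_derivative g (at z) (axis 1 1)"

definition pd_v :: "(real^2 \<Rightarrow> real^3) \<Rightarrow> real^2 \<Rightarrow> real^3" where
  "pd_v g z = frechet_derivative g (at z) (axis 2 1)"

text \<open>\<open>\<phi>\<close> parametrizes a neighbourhood of \<open>p\<close> by coordinates \<open>(u, v) \<in> V\<close>; in these coordinates
  \<open>f\<close> becomes \<open>f \<circ> \<phi>\<close>.  The function \<open>\<psi>\<close> is uniquely determined by \<open>f\<close> and \<open>\<phi>\<close>, being continuous
  with \<open>f\<^sub>v = v \<psi>\<close>.  The last clause fixes the orientation of the coordinates relative to the given
  normal; since \<open>\<nu>\<close> has norm one, it also forces \<open>f\<^sub>u\<close> and \<open>\<psi>\<close> to be linearly independent on \<open>V\<close>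
  (division by zero gives zero).\<close>

definition adapted_coords ::
    "(real^2 \<Rightarrow> real^3) \<Rightarrow> (real^2 \<Rightarrow> real^3) \<Rightarrow> (real^2) set \<Rightarrow> real^2 \<Rightarrow>
     (real^2 \<Rightarrow> real^2) \<Rightarrow> (real^2) set \<Rightarrow> (real^2 \<Rightarrow> real^3) \<Rightarrow> bool" where
  "adapted_coords f \<nu> U p \<phi> V \<psi> \<longleftrightarrow>
     diffeo_on \<phi> V (\<phi> ` V) \<and> \<phi> ` V \<subseteq> U \<and> 0 \<in> V \<and> \<phi> 0 = p \<and>
     singular_set (f \<circ> \<phi>) V = {z\<in>V. z $ 2 = 0} \<and>
     (\<forall>z\<in>V. z $ 2 = 0 \<longrightarrow> pd_v (f \<circ> \<phi>) z = 0) \<and>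
     smooth_on \<psi> V \<and> (\<forall>z\<in>V. pd_v (f \<circ> \<phi>) z = (z $ 2) *\<^sub>R \<psi> z) \<and>
     (\<forall>z\<in>V. \<nu> (\<phi> z) =
        cross3 (pd_u (f \<circ> \<phi>) z) (\<psi> z) /\<^sub>R norm (cross3 (pd_u (f \<circ> \<phi>) z) (\<psi> z)))"

text \<open>Below, \<open>g\<close> is the map and \<open>n\<close> its unit normal, both expressed in adapted coordinates.\<close>

definition hatE :: "(real^2 \<Rightarrow> real^3) \<Rightarrow> real^2 \<Rightarrow> real" where
  "hatE g z = pd_u g z \<bullet> pd_u g z"

definition hatF :: "(real^2 \<Rightarrow> real^3) \<Rightarrow> (real^2 \<Rightarrow> real^3) \<Rightarrow> real^2 \<Rightarrow> real" where
  "hatF g \<psi> z = pd_u g z \<bullet> \<psi> z"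

definition hatG :: "(real^2 \<Rightarrow> real^3) \<Rightarrow> real^2 \<Rightarrow> real" where
  "hatG \<psi> z = \<psi> z \<bullet> \<psi> z"

definition hatL :: "(real^2 \<Rightarrow> real^3) \<Rightarrow> (real^2 \<Rightarrow> real^3) \<Rightarrow> real^2 \<Rightarrow> real" where
  "hatL g n z = - (pd_u g z \<bullet> pd_u n z)"

definition hatM :: "(real^2 \<Rightarrow> real^3) \<Rightarrow> (real^2 \<Rightarrow> real^3) \<Rightarrow> real^2 \<Rightarrow> real" where
  "hatM \<psi> n z = - (\<psi> z \<bullet> pd_u n z)"

definition hatN :: "(real^2 \<Rightarrow> real^3) \<Rightarrow> (real^2 \<Rightarrow> real^3) \<Rightarrow> real^2 \<Rightarrow> real" where
  "hatN \<psi> n z = - (\<psi> z \<bullet> pd_v n z)"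

definition hatA ::
    "(real^2 \<Rightarrow> real^3) \<Rightarrow> (real^2 \<Rightarrow> real^3) \<Rightarrow> (real^2 \<Rightarrow> real^3) \<Rightarrow> real^2 \<Rightarrow> real" where
  "hatA g \<psi> n z = hatE g z * hatN \<psi> n z - 2 * (z $ 2) * hatF g \<psi> z * hatM \<psi> n z
                  + (z $ 2) * hatG \<psi> z * hatL g n z"

definition hatB ::
    "(real^2 \<Rightarrow> real^3) \<Rightarrow> (real^2 \<Rightarrow> real^3) \<Rightarrow> (real^2 \<Rightarrow> real^3) \<Rightarrow> real^2 \<Rightarrow> real" where
  "hatB g \<psi> n z = sqrt ((hatA g \<psi> n z)\<^sup>2
     - 4 * (z $ 2) * (hatE g z * hatG \<psi> z - (hatF g \<psi> z)\<^sup>2)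
       * (hatL g n z * hatN \<psi> n z - (z $ 2) * (hatM \<psi> n z)\<^sup>2))"

definition kappa2_off ::
    "(real^2 \<Rightarrow> real^3) \<Rightarrow> (real^2 \<Rightarrow> real^3) \<Rightarrow> (real^2 \<Rightarrow> real^3) \<Rightarrow> real^2 \<Rightarrow> real" where
  "kappa2_off g \<psi> n z = (hatA g \<psi> n z - hatB g \<psi> n z) /
     (2 * (z $ 2) * (hatE g z * hatG \<psi> z - (hatF g \<psi> z)\<^sup>2))"

text \<open>The extension across the \<open>u\<close>-axis: a continuous extension is unique, its values on the axis being
  the limits from off the axis (which exist near the axis where \<open>hatN\<close> is positive).\<close>

definition kappa2 ::
    "(real^2 \<Rightarrow> real^3) \<Rightarrow> (real^2 \<Rightarrow> real^3) \<Rightarrow> (real^2 \<Rightarrow> real^3) \<Rightarrow> real^2 \<Rightarrow> real" where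
  "kappa2 g \<psi> n z = (if z $ 2 \<noteq> 0 then kappa2_off g \<psi> n z
     else Lim (at z within {w. w $ 2 \<noteq> 0}) (kappa2_off g \<psi> n))"

definition principal_direction ::
    "(real^2 \<Rightarrow> real^3) \<Rightarrow> (real^2 \<Rightarrow> real^3) \<Rightarrow> (real^2 \<Rightarrow> real^3) \<Rightarrow> real^2 \<Rightarrow> real^2" where
  "principal_direction g \<psi> n z =
     vector [hatN \<psi> n z - (z $ 2) * kappa2 g \<psi> n z * hatG \<psi> z,
             - hatM \<psi> n z + kappa2 g \<psi> n z * hatF g \<psi> z]"

definition ridge_point ::
    "(real^2 \<Rightarrow> real^3) \<Rightarrow> (real^2 \<Rightarrow> real^3) \<Rightarrow> (real^2 \<Rightarrow> real^3) \<Rightarrow> real^2 \<Rightarrow> bool" where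
  "ridge_point g \<psi> n z \<longleftrightarrow>
     frechet_derivative (kappa2 g \<psi> n) (at z) (principal_direction g \<psi> n z) = 0"

end

theory Submission
  imports Defs
begin

text \<open>In adapted coordinates let \<open>g\<close> be the front, \<open>n\<close> its unit normal and \<open>h = \<rho> n\<close> with
  \<open>\<rho> = \<langle>g + c, n\<rangle>\<close> its dual.  Since \<open>dg\<close> is orthogonal to \<open>n\<close>, one has \<open>dh = T \<circ> dn\<close> with
  \<open>T w = \<langle>g + c, w\<rangle> n + \<rho> w\<close>, and \<open>T\<close> is injective where \<open>\<rho> \<noteq> 0\<close>.  So \<open>h\<close> and the Gauss map \<open>n\<close> have the
  same null directions, and along a null direction \<open>\<eta>\<close> also \<open>D\<^sup>2h(\<eta>, \<eta>) = T (D\<^sup>2n(\<eta>, \<eta>))\<close>.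

  A cuspidal edge has a null direction \<open>\<eta>\<close> for which \<open>D\<^sup>2h(\<eta>, \<eta>)\<close> lies outside the image of \<open>dh\<close>
  (\<open>cuspidal_edge_imp_fold\<close>).  Conversely, this property implies a cuspidal edge if \<open>dh \<noteq> 0\<close> and \<open>h\<close>
  has a smooth nonzero normal field whose derivative along \<open>\<eta>\<close> is not orthogonal to \<open>D\<^sup>2h(\<eta>, \<eta>)\<close>
  (\<open>cuspidal_edge_criterion\<close>); the dual surface has the normal field \<open>2 h - (g + c)\<close>, whose derivative along
  \<open>\<eta>\<close> is \<open>- g\<^sub>\<eta>\<close>.  Hence the dual has a cuspidal edge exactly where the Gauss map has a fold: its
  Jacobian, which is \<open>K = L N - v M\<^sup>2\<close> up to a nonzero factor, vanishes and has a nonzero derivative in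
  the null direction (\<open>second_derivative_dot_g_u\<close>).  Rationalizing the square root gives
  \<open>\<kappa>\<^sub>2 = 2 K / (A + B)\<close> (\<open>kappa2_near_origin\<close>), and where \<open>\<kappa>\<^sub>2 = 0\<close> the principal direction is that null
  direction, so these two conditions say that \<open>\<kappa>\<^sub>2 = 0\<close> and that the point is not a ridge point.

  The analysis is in the criterion.  In the source, the inverse function theorem provides coordinates
  in which two components of \<open>h\<close> become \<open>u\<close> and \<open>y(u) + v\<^sup>2\<close> (\<open>fold_coordinates\<close>).  The third component is
  then brought to \<open>v\<^sup>3\<close> by a diffeomorphism of the target (\<open>cuspidal_edge_normal_form\<close>), for which it has
  to be written as \<open>a(u, v\<^sup>2) + v\<^sup>3 b(u, v\<^sup>2)\<close> with \<open>a\<close>, \<open>b\<close> smooth in a full neighbourhood of the origin,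
  although \<open>v\<^sup>2\<close> takes no negative values.  This is Whitney's theorem on even functions
  (\<open>Whitney_decomposition\<close>); the extension to negative arguments is Seeley's.\<close>

section \<open>Calculus of smooth maps\<close>

abbreviation fderiv :: "('a::real_normed_vector \<Rightarrow> 'b::real_normed_vector) \<Rightarrow> 'a \<Rightarrow> 'a \<Rightarrow> 'b" where
  "fderiv f z \<equiv> frechet_derivative f (at z)"

lemma Ck_on_cong:
  assumes "open S" "Ck_on k f S" "\<And>x. x \<in> S \<Longrightarrow> f x = g x"
  shows "Ck_on k g S"
  using assms(2,3)
proof (induction k arbitrary: f g)
  case 0
  then show ?case using continuous_on_cong[of S S f g] by simp
next
  case (Suc k)
  have d: "(g has_derivative fderiv f x) (at x)" if "x \<in> S" for x
  proof (rule has_derivative_transform_within_open[OF _ \<open>open S\<close> that])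
    show "(f has_derivative fderiv f x) (at x)"
      using Suc.prems(1) that frechet_derivative_works by auto
  qed (use Suc.prems in auto)
  then have e: "fderiv f x = fderiv g x" if "x \<in> S" for x
    using that frechet_derivative_at by blast
  show ?case
    unfolding Ck_on.simps
  proof (intro conjI ballI allI)
    show "g differentiable at x" if "x \<in> S" for x using d[OF that] differentiableI by blast
    show "Ck_on k (\<lambda>x. fderiv g x w) S" for w
      by (rule Suc.IH[of "\<lambda>x. fderiv f x w"]) (use Suc.prems e in auto)
  qed
qed

lemma Ck_on_SucI:
  assumes "\<And>x. x \<in> S \<Longrightarrow> (f has_derivative f' x) (at x)"
    and "open S" and "\<And>w. Ck_on k (\<lambda>x. f' x w) S"
  shows "Ck_on (Suc k) f S"
proof -
  have e: "f' x = fderiv f x" if "x \<in> S" for x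
    using assms(1)[OF that] frechet_derivative_at by blast
  have "Ck_on k (\<lambda>x. fderiv f x w) S" for w
    by (rule Ck_on_cong[OF assms(2,3)]) (use e in auto)
  moreover have "f differentiable at x" if "x \<in> S" for x
    using assms(1)[OF that] differentiableI by blast
  ultimately show ?thesis by simp
qed

lemma Ck_on_subset: "Ck_on k f S \<Longrightarrow> T \<subseteq> S \<Longrightarrow> Ck_on k f T"
  by (induction k arbitrary: f) (auto intro: continuous_on_subset)

lemma Ck_on_SucD: "Ck_on (Suc k) f S \<Longrightarrow> Ck_on k f S"
proof (induction k arbitrary: f)
  case 0
  then show ?case
    by (auto intro!: continuous_at_imp_continuous_on differentiable_imp_continuous_within)
next
  case (Suc k)
  from Suc.prems have 1: "\<forall>x\<in>S. f differentiable at x"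
    and 2: "\<And>w. Ck_on (Suc k) (\<lambda>x. fderiv f x w) S"
    by simp_all
  show ?case using 1 Suc.IH[OF 2] by simp
qed

lemma Ck_on_has_derivative:
  "Ck_on (Suc k) f S \<Longrightarrow> x \<in> S \<Longrightarrow> (f has_derivative fderiv f x) (at x)"
  by (simp add: frechet_derivative_works[symmetric])

lemma Ck_on_const: "open S \<Longrightarrow> Ck_on k (\<lambda>x. c) S"
  by (induction k arbitrary: c) (auto simp: frechet_derivative_const)

lemma Ck_on_bounded_linear:
  assumes "bounded_linear L" "open S"
  shows "Ck_on k L S"
proof (cases k)
  case 0
  then show ?thesis using assms by (simp add: linear_continuous_on)
next
  case (Suc m)
  show ?thesis unfolding Suc
    by (rule Ck_on_SucI[where f'="\<lambda>_. L"])
      (use assms in \<open>simp_all add: bounded_linear_imp_has_derivative Ck_on_const\<close>)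
qed

lemma Ck_on_add:
  assumes "open S" "Ck_on k f S" "Ck_on k g S"
  shows "Ck_on k (\<lambda>x. f x + g x) S"
  using assms(2,3)
proof (induction k arbitrary: f g)
  case (Suc k)
  show ?case
  proof (rule Ck_on_SucI)
    show "((\<lambda>x. f x + g x) has_derivative
        (\<lambda>w. fderiv f x w + fderiv g x w)) (at x)" if "x \<in> S" for x
      by (intro has_derivative_add Ck_on_has_derivative[OF Suc.prems(1) that]
          Ck_on_has_derivative[OF Suc.prems(2) that])
    show "Ck_on k (\<lambda>x. fderiv f x w + fderiv g x w) S" for w
      by (rule Suc.IH) (use Suc.prems in simp_all)
  qed (rule \<open>open S\<close>)
qed (auto intro: continuous_on_add)

lemma (in bounded_bilinear) Ck_on:
  assumes "open S" "Ck_on k f S" "Ck_on k g S"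
  shows "Ck_on k (\<lambda>x. prod (f x) (g x)) S"
  using assms(2,3)
proof (induction k arbitrary: f g)
  case (Suc k)
  show ?case
  proof (rule Ck_on_SucI)
    show "((\<lambda>x. prod (f x) (g x)) has_derivative
        (\<lambda>w. prod (f x) (fderiv g x w) + prod (fderiv f x w) (g x)))
        (at x)" if "x \<in> S" for x
      by (intro FDERIV Ck_on_has_derivative[OF Suc.prems(1) that]
          Ck_on_has_derivative[OF Suc.prems(2) that])
    show "Ck_on k (\<lambda>x. prod (f x) (fderiv g x w)
            + prod (fderiv f x w) (g x)) S" for w
      using Suc.prems by (intro Ck_on_add Suc.IH \<open>open S\<close> Ck_on_SucD[OF Suc.prems(1)]
          Ck_on_SucD[OF Suc.prems(2)]) simp_all
  qed (rule \<open>open S\<close>)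
qed (auto intro: continuous_on)

lemma Ck_on_sum:
  assumes "open S" "\<And>i. i \<in> I \<Longrightarrow> Ck_on k (f i) S"
  shows "Ck_on k (\<lambda>x. \<Sum>i\<in>I. f i x) S"
  using assms(2)
  by (induction I rule: infinite_finite_induct) (simp_all add: Ck_on_const Ck_on_add assms(1))

text \<open>The definition only speaks of derivatives in fixed directions, so the value of the inner derivative,
  which varies, is expanded in the basis.\<close>

lemma Ck_on_compose:
  fixes g :: "'a::real_normed_vector \<Rightarrow> 'b::euclidean_space"
  assumes "open S" "Ck_on k f T" "Ck_on k g S" "g ` S \<subseteq> T"
  shows "Ck_on k (\<lambda>x. f (g x)) S"
  using assms(2,3)
proof (induction k arbitrary: f)
  case 0
  then show ?case using assms(4) by (auto intro: continuous_on_compose2)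
next
  case (Suc k)
  let ?D = "\<lambda>x w. \<Sum>b\<in>Basis. (fderiv g x w \<bullet> b) *\<^sub>R fderiv f (g x) b"
  show ?case
  proof (rule Ck_on_SucI)
    fix x assume x: "x \<in> S"
    then have gx: "g x \<in> T" using assms(4) by auto
    have f': "(f has_derivative fderiv f (g x)) (at (g x))"
      by (rule Ck_on_has_derivative[OF Suc.prems(1) gx])
    then have l: "linear (fderiv f (g x))"
      by (rule has_derivative_linear)
    have "?D x = (\<lambda>w. fderiv f (g x) (fderiv g x w))"
      by (rule ext, subst euclidean_representation[symmetric, of "fderiv g x _"])
        (simp add: linear_sum[OF l] linear_cmul[OF l])
    then show "((\<lambda>x. f (g x)) has_derivative ?D x) (at x)"
      using diff_chain_at[OF Ck_on_has_derivative[OF Suc.prems(2) x] f'] by (simp add: o_def)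
  next
    fix w
    show "Ck_on k (\<lambda>x. ?D x w) S"
    proof (rule Ck_on_sum[OF assms(1)])
      fix b :: 'b
      have "Ck_on k (\<lambda>x. fderiv g x w) S"
        "Ck_on k (\<lambda>y. fderiv f y b) T"
        using Suc.prems by simp_all
      then show "Ck_on k (\<lambda>x. (fderiv g x w \<bullet> b) *\<^sub>R fderiv f (g x) b) S"
        by (intro bounded_bilinear.Ck_on[OF bounded_bilinear_scaleR assms(1)] Suc.IH[of "\<lambda>y. fderiv f y b"]
            bounded_bilinear.Ck_on[OF bounded_bilinear_inner assms(1)] Ck_on_const assms(1)
            Ck_on_SucD[OF Suc.prems(2)])
    qed
  qed (rule assms(1))
qed

text \<open>Integrals and series depending on parameters form families that are stable under directional
  derivatives, so this rule replaces the computation of their higher derivatives.\<close>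

lemma smooth_onI_family:
  assumes oS: "open S" and i: "i \<in> I"
    and cont: "\<And>i. i \<in> I \<Longrightarrow> continuous_on S (g i)"
    and der: "\<And>i x. i \<in> I \<Longrightarrow> x \<in> S \<Longrightarrow> (g i has_derivative D i x) (at x)"
    and comb: "\<And>i w. i \<in> I \<Longrightarrow> \<exists>a j b k. j \<in> I \<and> k \<in> I \<and>
                 (\<forall>x\<in>S. D i x w = a *\<^sub>R g j x + b *\<^sub>R g k x)"
  shows "smooth_on (g i) S"
proof -
  have "Ck_on n (g i) S" if "i \<in> I" for n i
    using that
  proof (induction n arbitrary: i)
    case (Suc n)
    show ?case
    proof (rule Ck_on_SucI[OF der[OF Suc.prems]])
      fix w
      obtain a j b k where *: "j \<in> I" "k \<in> I" "\<forall>x\<in>S. D i x w = a *\<^sub>R g j x + b *\<^sub>R g k x"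
        using comb[OF Suc.prems, of w] by (elim exE conjE) (rule that)
      have "Ck_on n (\<lambda>x. a *\<^sub>R g j x + b *\<^sub>R g k x) S"
        by (rule Ck_on_add[OF oS bounded_bilinear.Ck_on[OF bounded_bilinear_scaleR oS Ck_on_const[OF oS]]
              bounded_bilinear.Ck_on[OF bounded_bilinear_scaleR oS Ck_on_const[OF oS]]])
          (simp_all add: Suc.IH *)
      then show "Ck_on n (\<lambda>x. D i x w) S"
        by (rule Ck_on_cong[OF oS]) (simp add: *)
    qed (simp_all add: oS)
  qed (simp add: cont)
  then show ?thesis using i by (simp add: smooth_on_def)
qed

lemma smooth_on_subset: "smooth_on f S \<Longrightarrow> T \<subseteq> S \<Longrightarrow> smooth_on f T"
  unfolding smooth_on_def by (intro allI Ck_on_subset[of _ f S T]) simp_all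

lemma smooth_on_continuous: "smooth_on f S \<Longrightarrow> continuous_on S f"
  unfolding smooth_on_def by (drule spec[of _ 0]) simp

lemma smooth_on_has_derivative:
  "smooth_on f S \<Longrightarrow> x \<in> S \<Longrightarrow> (f has_derivative fderiv f x) (at x)"
  unfolding smooth_on_def by (rule Ck_on_has_derivative) simp_all

lemma smooth_on_frechet: "smooth_on f S \<Longrightarrow> smooth_on (\<lambda>x. fderiv f x w) S"
  unfolding smooth_on_def
proof
  show "Ck_on k (\<lambda>x. fderiv f x w) S" if "\<forall>k. Ck_on k f S" for k
    using spec[OF that, of "Suc k"] by simp
qed

named_theorems smooth_intros

lemma smooth_on_const [smooth_intros]: "open S \<Longrightarrow> smooth_on (\<lambda>x. c) S"
  unfolding smooth_on_def by (intro allI Ck_on_const)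

lemma smooth_on_bounded_linear: "bounded_linear L \<Longrightarrow> open S \<Longrightarrow> smooth_on L S"
  unfolding smooth_on_def by (intro allI Ck_on_bounded_linear)

lemma smooth_on_compose:
  fixes g :: "'a::real_normed_vector \<Rightarrow> 'b::euclidean_space"
  shows "open S \<Longrightarrow> smooth_on f T \<Longrightarrow> smooth_on g S \<Longrightarrow> (\<And>x. x \<in> S \<Longrightarrow> g x \<in> T) \<Longrightarrow>
    smooth_on (\<lambda>x. f (g x)) S"
  unfolding smooth_on_def by (rule allI, rule Ck_on_compose[where T=T]) auto

lemma smooth_on_id [smooth_intros]: "open S \<Longrightarrow> smooth_on (\<lambda>x. x) S"
  by (rule smooth_on_bounded_linear) simp_all

lemma smooth_on_bilinear:
  "bounded_bilinear B \<Longrightarrow> open S \<Longrightarrow> smooth_on f S \<Longrightarrow> smooth_on g S \<Longrightarrow> smooth_on (\<lambda>x. B (f x) (g x)) S"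
  unfolding smooth_on_def by (rule allI, rule bounded_bilinear.Ck_on) simp_all

lemma smooth_on_linear:
  assumes L: "bounded_linear L" and "open S" "smooth_on f S"
  shows "smooth_on (\<lambda>x. L (f x)) S"
proof -
  have "Ck_on k (\<lambda>x. L (f x)) S" if "Ck_on k f S" for k
    using that
  proof (induction k arbitrary: f)
    case 0
    then show ?case using bounded_linear.continuous_on[OF L] by auto
  next
    case (Suc k)
    show ?case
    proof (rule Ck_on_SucI)
      show "((\<lambda>x. L (f x)) has_derivative (\<lambda>w. L (fderiv f x w))) (at x)"
        if "x \<in> S" for x
        by (rule bounded_linear.has_derivative[OF L Ck_on_has_derivative[OF Suc.prems that]])
      show "Ck_on k (\<lambda>x. L (fderiv f x w)) S" for w
        by (rule Suc.IH) (use Suc.prems in simp)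
    qed (rule \<open>open S\<close>)
  qed
  then show ?thesis using assms(3) by (simp add: smooth_on_def)
qed

lemma smooth_on_add [smooth_intros]:
  "open S \<Longrightarrow> smooth_on f S \<Longrightarrow> smooth_on g S \<Longrightarrow> smooth_on (\<lambda>x. f x + g x) S"
  unfolding smooth_on_def by (intro allI Ck_on_add) blast+

lemma smooth_on_sum [smooth_intros]:
  "open S \<Longrightarrow> (\<And>i. i \<in> I \<Longrightarrow> smooth_on (f i) S) \<Longrightarrow> smooth_on (\<lambda>x. \<Sum>i\<in>I. f i x) S"
  unfolding smooth_on_def by (intro allI Ck_on_sum) blast+

lemmas smooth_on_scaleR [smooth_intros] = smooth_on_bilinear[OF bounded_bilinear_scaleR]
lemmas smooth_on_inner [smooth_intros] = smooth_on_bilinear[OF bounded_bilinear_inner]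
lemmas smooth_on_mult [smooth_intros] = smooth_on_bilinear[OF bounded_bilinear_mult]

lemma smooth_on_minus [smooth_intros]: "open S \<Longrightarrow> smooth_on f S \<Longrightarrow> smooth_on (\<lambda>x. - f x) S"
  using smooth_on_linear[OF bounded_linear_minus[OF bounded_linear_ident]] .

lemma smooth_on_diff [smooth_intros]:
  "open S \<Longrightarrow> smooth_on f S \<Longrightarrow> smooth_on g S \<Longrightarrow> smooth_on (\<lambda>x. f x - g x) S"
  using smooth_on_add[of S f "\<lambda>x. - g x"] smooth_on_minus[of S g] by simp

lemma smooth_on_power [smooth_intros]:
  fixes f :: "'a::real_normed_vector \<Rightarrow> real"
  shows "open S \<Longrightarrow> smooth_on f S \<Longrightarrow> smooth_on (\<lambda>x. f x ^ n) S"
  by (induction n) (simp_all add: smooth_on_const smooth_on_mult)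

lemma smooth_on_prod [smooth_intros]:
  fixes f :: "'i \<Rightarrow> 'a::real_normed_vector \<Rightarrow> real"
  assumes "open S" "\<And>i. i \<in> I \<Longrightarrow> smooth_on (f i) S"
  shows "smooth_on (\<lambda>x. \<Prod>i\<in>I. f i x) S"
  using assms(2)
  by (induction I rule: infinite_finite_induct) (simp_all add: smooth_on_const smooth_on_mult assms(1))

lemma smooth_on_nth [smooth_intros]:
  "open S \<Longrightarrow> smooth_on f S \<Longrightarrow> smooth_on (\<lambda>x. f x $ i :: real) S"
  by (rule smooth_on_linear[OF bounded_linear_vec_nth])

lemma smooth_on_vec_lambda [smooth_intros]:
  fixes f :: "'i::finite \<Rightarrow> 'a::real_normed_vector \<Rightarrow> real"
  assumes "open S" "\<And>i. smooth_on (f i) S"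
  shows "smooth_on (\<lambda>x. \<chi> i. f i x) S"
proof -
  have "smooth_on (\<lambda>x. \<Sum>i\<in>UNIV. f i x *\<^sub>R axis i (1::real)) S"
    by (intro smooth_intros assms)
  moreover have "(\<Sum>i\<in>UNIV. f i x *\<^sub>R axis i (1::real)) = (\<chi> i. f i x)" for x
    by (simp add: vec_eq_iff axis_def if_distrib cong: if_cong)
  ultimately show ?thesis by simp
qed

lemma vector2_eq: "(vector [a, b] :: real^2) = (\<chi> i. if i = 1 then a else b)"
  by (simp add: vec_eq_iff forall_2)

lemma vector3_eq: "(vector [a, b, c] :: real^3) = (\<chi> i. if i = 1 then a else if i = 2 then b else c)"
  by (simp add: vec_eq_iff forall_3)

lemma smooth_on_vector2 [smooth_intros]:
  assumes "open S" "smooth_on f S" "smooth_on g S"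
  shows "smooth_on (\<lambda>x. vector [f x, g x] :: real^2) S"
proof -
  have "smooth_on (\<lambda>x. if i = 1 then f x else g x) S" for i :: 2
    by (cases "i = 1") (simp_all add: assms)
  then show ?thesis unfolding vector2_eq by (rule smooth_on_vec_lambda[OF \<open>open S\<close>])
qed

lemma smooth_on_vector3 [smooth_intros]:
  assumes "open S" "smooth_on f S" "smooth_on g S" "smooth_on h S"
  shows "smooth_on (\<lambda>x. vector [f x, g x, h x] :: real^3) S"
proof -
  have "smooth_on (\<lambda>x. if i = 1 then f x else if i = 2 then g x else h x) S" for i :: 3
    by (cases "i = 1"; cases "i = 2") (simp_all add: assms)
  then show ?thesis unfolding vector3_eq by (rule smooth_on_vec_lambda[OF \<open>open S\<close>])
qed

lemma smooth_on_inverse_fun: "smooth_on (inverse :: real \<Rightarrow> real) {x. x \<noteq> 0}"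
proof -
  have o: "open {x::real. x \<noteq> 0}" by (simp add: open_Collect_neq)
  have "Ck_on k (inverse :: real \<Rightarrow> real) {x. x \<noteq> 0}" for k
  proof (induction k)
    case (Suc k)
    show ?case
    proof (rule Ck_on_SucI[where f'="\<lambda>x w. - (inverse x * w * inverse x)"])
      show "Ck_on k (\<lambda>x. - (inverse x * w * inverse x)) {x. x \<noteq> 0}" for w :: real
        using bounded_bilinear.Ck_on[OF bounded_bilinear_mult o
            bounded_bilinear.Ck_on[OF bounded_bilinear_mult o Suc Ck_on_const[OF o, of k "-w"]] Suc]
        by simp
      show "(inverse has_derivative (\<lambda>w. - (inverse x * w * inverse x))) (at x)"
        if "x \<in> {x. x \<noteq> 0}" for x :: real
        using has_derivative_inverse' that by blast
    qed (rule o)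
  qed (simp add: continuous_on_inverse)
  then show ?thesis by (simp add: smooth_on_def)
qed

lemma smooth_on_inverse [smooth_intros]:
  fixes f :: "'a::real_normed_vector \<Rightarrow> real"
  shows "open S \<Longrightarrow> smooth_on f S \<Longrightarrow> (\<And>x. x \<in> S \<Longrightarrow> f x \<noteq> 0) \<Longrightarrow> smooth_on (\<lambda>x. inverse (f x)) S"
  by (rule smooth_on_compose[OF _ smooth_on_inverse_fun]) auto

lemma smooth_on_divide [smooth_intros]:
  fixes f :: "'a::real_normed_vector \<Rightarrow> real"
  shows "open S \<Longrightarrow> smooth_on f S \<Longrightarrow> smooth_on g S \<Longrightarrow> (\<And>x. x \<in> S \<Longrightarrow> g x \<noteq> 0) \<Longrightarrow>
    smooth_on (\<lambda>x. f x / g x) S"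
  unfolding divide_inverse by (intro smooth_intros)

lemma smooth_on_sqrt_fun: "smooth_on sqrt {0<..}"
proof -
  have o: "open {0::real<..}" by simp
  have inv: "Ck_on k (\<lambda>x. inverse (g x)) {0<..}" if "Ck_on k g {0<..}" "g ` {0<..} \<subseteq> {x. x \<noteq> 0}"
    for k and g :: "real \<Rightarrow> real"
    by (rule Ck_on_compose[OF o _ that(1) that(2)]) (use smooth_on_inverse_fun in \<open>auto simp: smooth_on_def\<close>)
  have "Ck_on k sqrt {0<..}" for k
  proof (induction k)
    case (Suc k)
    show ?case
    proof (rule Ck_on_SucI[where f'="\<lambda>x w. inverse (sqrt x) * (w / 2)"])
      show "Ck_on k (\<lambda>x. inverse (sqrt x) * (w / 2)) {0<..}" for w :: real
        by (intro bounded_bilinear.Ck_on[OF bounded_bilinear_mult o] inv Suc Ck_on_const o) auto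
      show "(sqrt has_derivative (\<lambda>w. inverse (sqrt x) * (w / 2))) (at x)" if "x \<in> {0<..}" for x
        by (rule has_derivative_eq_rhs[OF DERIV_real_sqrt[of x, unfolded has_field_derivative_def]])
          (use that in \<open>auto simp: fun_eq_iff field_simps\<close>)
    qed (rule o)
  qed (simp add: continuous_on_real_sqrt)
  then show ?thesis by (simp add: smooth_on_def)
qed

lemma smooth_on_sqrt [smooth_intros]:
  fixes f :: "'a::real_normed_vector \<Rightarrow> real"
  shows "open S \<Longrightarrow> smooth_on f S \<Longrightarrow> (\<And>x. x \<in> S \<Longrightarrow> f x > 0) \<Longrightarrow> smooth_on (\<lambda>x. sqrt (f x)) S"
  by (rule smooth_on_compose[OF _ smooth_on_sqrt_fun]) auto

section \<open>Diffeomorphisms\<close>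

lemma smooth_on_det:
  fixes A :: "'a::real_normed_vector \<Rightarrow> real^'n^'n"
  assumes "open S" "\<And>i j. smooth_on (\<lambda>x. A x $ i $ j) S"
  shows "smooth_on (\<lambda>x. det (A x)) S"
  unfolding det_def by (intro smooth_intros assms)

text \<open>The derivative of the inverse \<open>g\<close> at \<open>y\<close> is the inverse of \<open>F'(g y)\<close>, by Cramer's rule a smooth
  function of \<open>g y\<close>; so \<open>g\<close> has one more derivative than is already known.\<close>

lemma smooth_on_local_inverse:
  fixes F :: "real^'n \<Rightarrow> real^'n"
  assumes oS: "open S" and F: "smooth_on F S" and x0: "x0 \<in> S"
    and inj: "inj (fderiv F x0)"
  obtains V W where "diffeo_on F V W" "x0 \<in> V" "V \<subseteq> S"
proof -
  define F' where "F' = (\<lambda>x. Blinfun (fderiv F x))"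
  have F': "blinfun_apply (F' x) = fderiv F x" if "x \<in> S" for x
    unfolding F'_def
    by (rule bounded_linear_Blinfun_apply)
      (rule has_derivative_bounded_linear[OF smooth_on_has_derivative[OF F that]])
  have lin: "linear (fderiv F x)" if "x \<in> S" for x
    by (rule has_derivative_linear[OF smooth_on_has_derivative[OF F that]])
  obtain h where h: "linear h" "h \<circ> fderiv F x0 = id"
    using linear_injective_left_inverse[OF lin[OF x0] inj] by (elim exE conjE) (rule that)
  have hb: "bounded_linear h" using h(1) linear_conv_bounded_linear by blast
  have inv: "Blinfun h o\<^sub>L F' x0 = id_blinfun"
    by (rule blinfun_eqI)
      (simp add: bounded_linear_Blinfun_apply[OF hb] F'[OF x0] fun_cong[OF h(2), simplified])
  have cont: "continuous_on S F'"
  proof (rule continuous_on_blinfun_componentwise)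
    fix i :: "real^'n"
    have "continuous_on S (\<lambda>x. fderiv F x i)"
      by (intro smooth_on_continuous smooth_on_frechet F)
    then show "continuous_on S (\<lambda>x. blinfun_apply (F' x) i)"
      using F' continuous_on_cong[OF refl, of S "\<lambda>x. blinfun_apply (F' x) i"] by auto
  qed
  have der: "(F has_derivative blinfun_apply (F' x)) (at x)" if "x \<in> S" for x
    using smooth_on_has_derivative[OF F that] F'[OF that] by simp
  obtain V W g g' where V: "open V" "V \<subseteq> S" "x0 \<in> V" "open W" "F x0 \<in> W"
    and hom: "homeomorphism V W F g"
    and g: "\<And>y. y \<in> W \<Longrightarrow> (g has_derivative (g' y)) (at y)"
      "\<And>y. y \<in> W \<Longrightarrow> g' y = inv (blinfun_apply (F' (g y)))"
      "\<And>y. y \<in> W \<Longrightarrow> bij (blinfun_apply (F' (g y)))"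
    by (rule inverse_function_theorem[OF oS _ cont x0 inv], erule der, rule that)
  have gW: "g ` W = V" and gV: "\<And>y. y \<in> W \<Longrightarrow> g y \<in> V"
    and gF: "\<And>x. x \<in> V \<Longrightarrow> g (F x) = x" and Fg: "\<And>y. y \<in> W \<Longrightarrow> F (g y) = y"
    and FV: "F ` V = W" and gc: "continuous_on W g"
    using hom by (auto simp: homeomorphism_def)
  have oW: "open W" by fact
  define M where "M = (\<lambda>x. matrix (fderiv F x))"
  define C where "C = (\<lambda>(w::real^'n) x. \<chi> k. det (\<chi> i j. if j = k then w $ i else M x $ i $ j) / det (M x))"
  have detM: "det (M x) \<noteq> 0" if x: "x \<in> V" for x
  proof -
    have "F x \<in> W" using FV x by blast
    from g(3)[OF this] have "inj (fderiv F x)"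
      using gF[OF x] F' V(2) x by (auto simp: bij_def)
    then show ?thesis
      using det_nz_iff_inj[OF lin, of x] V(2) x by (auto simp: M_def)
  qed
  have g'_eq: "g' y w = C w (g y)" if y: "y \<in> W" for y w
  proof -
    have gy: "g y \<in> S" "g y \<in> V" using gV y V(2) by auto
    have "fderiv F (g y) (g' y w) = w"
      using g(2,3)[OF y] F'[OF gy(1)] by (simp add: bij_is_surj surj_f_inv_f)
    then have "M (g y) *v g' y w = w"
      by (simp add: M_def fun_cong[OF matrix_vector_mul(2)[OF lin[OF gy(1)]]])
    then show ?thesis
      by (simp add: cramer[OF detM[OF gy(2)]] C_def)
  qed
  have smM: "smooth_on (\<lambda>x. M x $ i $ j) V" for i j
    unfolding M_def matrix_def
    by (simp, intro smooth_intros V(1) smooth_on_frechet smooth_on_subset[OF F V(2)])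
  have smC: "smooth_on (C w) V" for w
    unfolding C_def
  proof (intro smooth_on_vec_lambda smooth_on_divide smooth_on_det V(1) smM detM)
    fix k i j
    show "smooth_on (\<lambda>x. (\<chi> i j. if j = k then w $ i else M x $ i $ j) $ i $ j) V"
      by (cases "j = k") (simp_all add: smM smooth_on_const V(1))
  qed
  have "Ck_on k g W" for k
  proof (induction k)
    case 0
    then show ?case using gc by simp
  next
    case (Suc k)
    show ?case
    proof (rule Ck_on_SucI[OF g(1) \<open>open W\<close>])
      show "Ck_on k (\<lambda>y. g' y w) W" for w
      proof (rule Ck_on_cong[OF \<open>open W\<close>])
        show "Ck_on k (\<lambda>y. C w (g y)) W"
          by (rule Ck_on_compose[OF \<open>open W\<close> _ Suc, of _ V]) (use smC gW in \<open>auto simp: smooth_on_def\<close>)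
      qed (simp add: g'_eq)
    qed
  qed
  then have "diffeo_on F V W"
    unfolding diffeo_on_def
    using V oW FV gF Fg smooth_on_subset[OF F V(2)] by (auto simp: smooth_on_def intro!: exI[of _ g])
  then show ?thesis using that V by blast
qed

lemma diffeo_on_inverse:
  assumes "diffeo_on \<phi> V W"
  obtains \<theta> where "diffeo_on \<theta> W V" "\<And>z. z \<in> V \<Longrightarrow> \<theta> (\<phi> z) = z" "\<And>y. y \<in> W \<Longrightarrow> \<phi> (\<theta> y) = y"
proof -
  from assms obtain \<theta> where o: "open V" "open W" and im: "\<phi> ` V = W" and s: "smooth_on \<phi> V" "smooth_on \<theta> W"
    and i: "\<forall>z\<in>V. \<theta> (\<phi> z) = z" "\<forall>y\<in>W. \<phi> (\<theta> y) = y"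
    unfolding diffeo_on_def by (elim exE conjE) (rule that)
  have "\<theta> ` W = V" using im i(1) by force
  then have "diffeo_on \<theta> W V"
    unfolding diffeo_on_def using o s i by (intro conjI exI[of _ \<phi>]) simp_all
  then show ?thesis by (rule that) (simp_all add: i)
qed

lemma diffeo_on_restrict:
  assumes d: "diffeo_on \<phi> V W" and o: "open V'" "V' \<subseteq> V"
  shows "diffeo_on \<phi> V' (\<phi> ` V')"
proof -
  obtain \<theta> where \<theta>: "diffeo_on \<theta> W V" "\<And>z. z \<in> V \<Longrightarrow> \<theta> (\<phi> z) = z" "\<And>y. y \<in> W \<Longrightarrow> \<phi> (\<theta> y) = y"
    by (rule diffeo_on_inverse[OF d], rule that)
  have W: "\<phi> ` V = W" "open W" "smooth_on \<phi> V" using d by (auto simp: diffeo_on_def)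
  have s: "smooth_on \<theta> W" using \<theta>(1) by (simp add: diffeo_on_def)
  have "\<theta> ` W = V" using \<theta>(1) by (simp add: diffeo_on_def)
  then have "\<phi> ` V' = W \<inter> \<theta> -` V'"
    using o(2) W(1) \<theta>(2,3) by force
  moreover have "open (W \<inter> \<theta> -` V')"
    by (rule continuous_open_preimage[OF smooth_on_continuous[OF s] W(2) o(1)])
  ultimately have "open (\<phi> ` V')" by simp
  moreover have "\<phi> ` V' \<subseteq> W" using W(1) o(2) by blast
  ultimately show ?thesis
    unfolding diffeo_on_def
    using o \<theta>(2,3) smooth_on_subset[OF W(3) o(2)] smooth_on_subset[OF s]
    by (intro conjI exI[of _ \<theta>]) auto
qed

lemma diffeo_on_compose:
  fixes \<phi> :: "'a::euclidean_space \<Rightarrow> 'b::euclidean_space" and \<tau> :: "'b \<Rightarrow> 'c::euclidean_space"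
  assumes "diffeo_on \<phi> V W" "diffeo_on \<tau> W X"
  shows "diffeo_on (\<lambda>z. \<tau> (\<phi> z)) V X"
proof -
  obtain \<theta> where \<theta>: "diffeo_on \<theta> W V" "\<And>z. z \<in> V \<Longrightarrow> \<theta> (\<phi> z) = z" "\<And>y. y \<in> W \<Longrightarrow> \<phi> (\<theta> y) = y"
    by (rule diffeo_on_inverse[OF assms(1)], rule that)
  obtain \<eta> where \<eta>: "diffeo_on \<eta> X W" "\<And>z. z \<in> W \<Longrightarrow> \<eta> (\<tau> z) = z" "\<And>y. y \<in> X \<Longrightarrow> \<tau> (\<eta> y) = y"
    by (rule diffeo_on_inverse[OF assms(2)], rule that)
  have *: "open V" "open X" "\<phi> ` V = W" "\<tau> ` W = X" "smooth_on \<phi> V" "smooth_on \<tau> W"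
      "\<eta> ` X = W" "smooth_on \<eta> X" "smooth_on \<theta> W"
    using assms \<theta>(1) \<eta>(1) by (auto simp: diffeo_on_def)
  have "smooth_on (\<lambda>z. \<tau> (\<phi> z)) V"
    by (rule smooth_on_compose[OF *(1,6,5)]) (use *(3) in auto)
  moreover have "smooth_on (\<lambda>y. \<theta> (\<eta> y)) X"
    by (rule smooth_on_compose[OF *(2,9,8)]) (use *(7) in auto)
  moreover have "(\<lambda>z. \<tau> (\<phi> z)) ` V = X" using *(3,4) by auto
  moreover have "\<forall>z\<in>V. \<theta> (\<eta> (\<tau> (\<phi> z))) = z" using *(3) \<theta>(2) \<eta>(2) by auto
  moreover have "\<forall>y\<in>X. \<tau> (\<phi> (\<theta> (\<eta> y))) = y" using *(7) \<theta>(3) \<eta>(3) by auto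
  ultimately show ?thesis
    unfolding diffeo_on_def using *(1,2) by (intro conjI exI[of _ "\<lambda>y. \<theta> (\<eta> y)"]) simp_all
qed

text \<open>For \<open>\<tau>\<close> an adapted coordinate system or its inverse, this moves the question about the dual surface
  to the origin of the coordinates and back.\<close>

lemma cuspidal_edge_at_transfer:
  assumes \<tau>: "diffeo_on \<tau> V W" "q \<in> V" and h: "\<And>z. z \<in> V \<Longrightarrow> h (\<tau> z) = k z"
    and k: "cuspidal_edge_at k q"
  shows "cuspidal_edge_at h (\<tau> q)"
proof -
  from k obtain \<phi> :: "real^2 \<Rightarrow> real^2" and V' W' and \<Phi> :: "real^3 \<Rightarrow> real^3" and A B
    where \<phi>: "diffeo_on \<phi> V' W'" "0 \<in> V'" "\<phi> 0 = q"
    and \<Phi>: "diffeo_on \<Phi> A B" "k q \<in> A" "\<Phi> (k q) = 0" "k ` W' \<subseteq> A"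
    and eq: "\<forall>z\<in>V'. \<Phi> (k (\<phi> z)) = vector [z $ 1, (z $ 2)\<^sup>2, (z $ 2) ^ 3]"
    unfolding cuspidal_edge_at_def by (elim exE conjE) (rule that)
  have oV: "open V" using \<tau>(1) by (simp add: diffeo_on_def)
  have \<phi>': "open V'" "smooth_on \<phi> V'" "\<phi> ` V' = W'" using \<phi>(1) by (auto simp: diffeo_on_def)
  define V'' where "V'' = V' \<inter> \<phi> -` V"
  have V'': "open V''" "V'' \<subseteq> V'"
    unfolding V''_def
    using continuous_open_preimage[OF smooth_on_continuous[OF \<phi>'(2)] \<phi>'(1) oV] by simp_all
  have 1: "diffeo_on \<phi> V'' (\<phi> ` V'')" by (rule diffeo_on_restrict[OF \<phi>(1) V''])
  moreover have 2: "\<phi> ` V'' \<subseteq> V" "\<phi> ` V'' \<subseteq> W'" using \<phi>'(3) by (auto simp: V''_def)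
  moreover have "open (\<phi> ` V'')" using 1 by (simp add: diffeo_on_def)
  ultimately have "diffeo_on (\<lambda>z. \<tau> (\<phi> z)) V'' (\<tau> ` \<phi> ` V'')"
    using diffeo_on_compose[OF 1 diffeo_on_restrict[OF \<tau>(1)]] by simp
  moreover have "0 \<in> V''" "\<tau> (\<phi> 0) = \<tau> q" using \<phi> \<tau>(2) by (auto simp: V''_def)
  moreover have "h (\<tau> q) \<in> A" "\<Phi> (h (\<tau> q)) = 0" using \<Phi> h[OF \<tau>(2)] by auto
  moreover have "h ` \<tau> ` \<phi> ` V'' \<subseteq> A"
  proof clarify
    fix z assume "z \<in> V''"
    then have "\<phi> z \<in> V" "\<phi> z \<in> W'" using 2 by auto
    then show "h (\<tau> (\<phi> z)) \<in> A" using h \<Phi>(4) by auto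
  qed
  moreover have "\<forall>z\<in>V''. \<Phi> (h (\<tau> (\<phi> z))) = vector [z $ 1, (z $ 2)\<^sup>2, (z $ 2) ^ 3]"
  proof
    fix z assume z: "z \<in> V''"
    then have "\<phi> z \<in> V" "z \<in> V'" using 2(1) V''(2) by auto
    then show "\<Phi> (h (\<tau> (\<phi> z))) = vector [z $ 1, (z $ 2)\<^sup>2, (z $ 2) ^ 3]"
      using eq h by simp
  qed
  ultimately show ?thesis
    unfolding cuspidal_edge_at_def using \<Phi>(1)
    by (intro exI[of _ "\<lambda>z. \<tau> (\<phi> z)"] exI[of _ "V''"] exI[of _ "\<tau> ` \<phi> ` V''"]
        exI[of _ \<Phi>] exI[of _ A] exI[of _ B]) simp
qed

section \<open>Division by a coordinate\<close>

definition D1 :: "(real^2 \<Rightarrow> 'a::real_normed_vector) \<Rightarrow> real^2 \<Rightarrow> 'a" where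
  "D1 F z = fderiv F z (axis 1 1)"

definition D2 :: "(real^2 \<Rightarrow> 'a::real_normed_vector) \<Rightarrow> real^2 \<Rightarrow> 'a" where
  "D2 F z = fderiv F z (axis 2 1)"

lemma vec2_expand: "(w::real^2) = w $ 1 *\<^sub>R axis 1 1 + w $ 2 *\<^sub>R axis 2 1"
  by (simp add: vec_eq_iff forall_2 axis_def)

lemma linear_vec2: "linear L \<Longrightarrow> L (w::real^2) = w $ 1 *\<^sub>R L (axis 1 1) + w $ 2 *\<^sub>R L (axis 2 1)"
  by (subst vec2_expand) (simp only: linear_add linear_cmul)

lemma frechet_derivative_D1_D2:
  assumes "smooth_on F S" "z \<in> S"
  shows "fderiv F z w = w $ 1 *\<^sub>R D1 F z + w $ 2 *\<^sub>R D2 F z"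
  unfolding D1_def D2_def
  by (rule linear_vec2[OF has_derivative_linear[OF smooth_on_has_derivative[OF assms]]])

lemma has_derivative_D1_D2:
  assumes "smooth_on F S" "z \<in> S"
  shows "(F has_derivative (\<lambda>w. w $ 1 *\<^sub>R D1 F z + w $ 2 *\<^sub>R D2 F z)) (at z)"
  by (rule has_derivative_eq_rhs[OF smooth_on_has_derivative[OF assms]])
    (simp add: fun_eq_iff frechet_derivative_D1_D2[OF assms])

lemma has_derivative_compose_D1_D2:
  assumes "smooth_on F S" "f x \<in> S" "(f has_derivative f') (at x)"
  shows "((\<lambda>x. F (f x)) has_derivative (\<lambda>h. f' h $ 1 *\<^sub>R D1 F (f x) + f' h $ 2 *\<^sub>R D2 F (f x))) (at x)"
  using diff_chain_at[OF assms(3) has_derivative_D1_D2[OF assms(1,2)]] by (simp add: o_def)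

lemma D1_D2_unique:
  assumes "(F has_derivative (\<lambda>w. w $ 1 *\<^sub>R a + w $ 2 *\<^sub>R b)) (at z)"
  shows "D1 F z = a" "D2 F z = b"
  using frechet_derivative_at[OF assms, symmetric] by (simp_all add: D1_def D2_def axis_def)

lemma smooth_on_D1: "smooth_on F S \<Longrightarrow> smooth_on (D1 F) S"
  and smooth_on_D2: "smooth_on F S \<Longrightarrow> smooth_on (D2 F) S"
  unfolding D1_def D2_def using smooth_on_frechet by auto

text \<open>Squares are used as neighbourhoods because they contain with a point \<open>(u, v)\<close> the whole segment from
  \<open>(u, 0)\<close> to it.\<close>

definition open_square :: "real \<Rightarrow> (real^2) set" where
  "open_square r = {z. \<bar>z $ 1\<bar> < r \<and> \<bar>z $ 2\<bar> < r}"

lemma open_open_square [simp]: "open (open_square r)"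
  unfolding open_square_def by (intro open_Collect_conj open_Collect_less continuous_intros)

lemma zero_in_open_square [simp]: "0 \<in> open_square r \<longleftrightarrow> r > 0"
  by (auto simp: open_square_def)

lemma convex_open_square: "convex (open_square r)"
proof -
  have "open_square r = (\<lambda>z. z $ 1) -` {-r<..<r} \<inter> (\<lambda>z. z $ 2) -` {-r<..<r}"
    by (auto simp: open_square_def)
  then show ?thesis
    by (simp only:) (intro convex_Int convex_linear_vimage convex_real_interval bounded_linear.linear bounded_linear_vec_nth)
qed

lemma open_square_shrink:
  "z \<in> open_square r \<Longrightarrow> 0 \<le> s \<Longrightarrow> s \<le> 1 \<Longrightarrow> vector [z $ 1, s * z $ 2] \<in> open_square r"
  using mult_left_le_one_le[of "\<bar>z $ 2\<bar>" s] by (auto simp: open_square_def abs_mult)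

lemma open_contains_open_square:
  assumes "open S" "0 \<in> S"
  obtains r where "r > 0" "open_square r \<subseteq> S"
proof -
  obtain e where e: "e > 0" "ball 0 e \<subseteq> S" using assms open_contains_ball by blast
  have "norm z < e" if "z \<in> open_square (e / 2)" for z
  proof -
    have "norm z \<le> \<bar>z $ 1\<bar> + \<bar>z $ 2\<bar>" using norm_le_l1_cart[of z] by (simp add: sum_2)
    then show ?thesis using that by (simp add: open_square_def)
  qed
  then have "open_square (e / 2) \<subseteq> S" using e(2) by (auto simp: subset_iff)
  then show ?thesis using that[of "e / 2"] e(1) by simp
qed

text \<open>For \<open>q = 1\<close> this averages \<open>F\<close>, with weight \<open>t\<^sup>m\<close>, over the segment from the axis to \<open>z\<close>.  The case \<open>q = 2\<close>
  arises from the averages of \<open>F(u, v\<^sup>2)\<close>, as functions of \<open>(u, v\<^sup>2)\<close>.\<close>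

definition ray_integral :: "nat \<Rightarrow> nat \<Rightarrow> (real^2 \<Rightarrow> real) \<Rightarrow> real^2 \<Rightarrow> real" where
  "ray_integral q m F z = integral {0..1} (\<lambda>t. t ^ m * F (vector [z $ 1, t ^ q * z $ 2]))"

lemma continuous_on_vector2 [continuous_intros]:
  assumes "continuous_on S f" "continuous_on S g"
  shows "continuous_on S (\<lambda>x. vector [f x, g x] :: real^2)"
proof -
  have "continuous_on S (\<lambda>x. if i = 1 then f x else g x)" for i :: 2
    by (cases "i = 1") (simp_all add: assms)
  then show ?thesis unfolding vector2_eq by (rule continuous_on_vec_lambda)
qed

lemma has_derivative_vector2 [derivative_intros]:
  assumes "(f has_derivative f') F" "(g has_derivative g') F"
  shows "((\<lambda>x. vector [f x, g x] :: real^2) has_derivative (\<lambda>h. vector [f' h, g' h])) F"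
proof -
  have e: "(vector [a, b] :: real^2) = a *\<^sub>R axis 1 1 + b *\<^sub>R axis 2 1" for a b
    using vec2_expand[of "vector [a, b]"] by simp
  show ?thesis unfolding e by (intro derivative_intros assms)
qed

text \<open>Differentiation acts on \<open>F\<close> and raises the exponent of the weight, so smoothness follows from
  \<open>smooth_onI_family\<close>.\<close>

lemma has_derivative_ray_integral:
  assumes F: "smooth_on F (open_square r)" and z: "z \<in> open_square r"
  shows "(ray_integral q m F has_derivative
     (\<lambda>w. w $ 1 *\<^sub>R ray_integral q m (D1 F) z + w $ 2 *\<^sub>R ray_integral q (m + q) (D2 F) z)) (at z)"
proof -
  let ?S = "open_square r"
  let ?p = "\<lambda>z t. vector [z $ 1, t ^ q * z $ 2] :: real^2"
  let ?P = "\<lambda>i. Blinfun (\<lambda>w::real^2. w $ i)"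
  have P: "blinfun_apply (?P i) = (\<lambda>w. w $ i)" for i
    by (rule bounded_linear_Blinfun_apply) (rule bounded_linear_vec_nth)
  have pS: "?p x t \<in> ?S" if "x \<in> ?S" "t \<in> {0..1}" for x t
    using open_square_shrink[OF that(1), of "t ^ q"] that(2) by (simp add: power_le_one)
  let ?fx = "\<lambda>x t. (t ^ m * D1 F (?p x t)) *\<^sub>R ?P 1 + (t ^ (m + q) * D2 F (?p x t)) *\<^sub>R ?P 2"
  have contc: "continuous_on (?S \<times> {0..1}) (\<lambda>x. G (?p (fst x) (snd x)))"
    if "smooth_on G ?S" for G :: "real^2 \<Rightarrow> real"
    by (rule continuous_on_compose2[OF smooth_on_continuous[OF that]])
      (use pS in \<open>auto intro!: continuous_intros\<close>)
  have int: "(\<lambda>t. t ^ k * G (?p x t)) integrable_on {0..1}"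
    if "smooth_on G ?S" "x \<in> ?S" for G :: "real^2 \<Rightarrow> real" and x k
  proof (rule integrable_continuous_interval, rule continuous_on_mult)
    show "continuous_on {0..1} (\<lambda>t. G (?p x t))"
      by (rule continuous_on_compose2[OF smooth_on_continuous[OF that(1)]])
        (use pS that(2) in \<open>auto intro!: continuous_intros\<close>)
  qed (intro continuous_intros)
  have "((\<lambda>x. integral (cbox 0 1) (\<lambda>t. t ^ m * F (?p x t))) has_derivative integral (cbox 0 1) (?fx z))
      (at z within ?S)"
  proof (rule leibniz_rule[OF _ _ _ z convex_open_square])
    fix x :: "real^2" and t :: real assume x: "x \<in> ?S" and t: "t \<in> cbox 0 1"
    have t': "t \<in> {0..1}" using t by simp
    have "((\<lambda>x. F (?p x t)) has_derivative
        (\<lambda>w. (?p w t) $ 1 *\<^sub>R D1 F (?p x t) + (?p w t) $ 2 *\<^sub>R D2 F (?p x t))) (at x)"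
      by (rule has_derivative_compose_D1_D2[OF F], rule pS[OF x t'])
        (intro has_derivative_vector2 has_derivative_mult_right bounded_linear_imp_has_derivative
          bounded_linear_vec_nth)
    then have "((\<lambda>x. t ^ m * F (?p x t)) has_derivative
        (\<lambda>w. t ^ m * (w $ 1 *\<^sub>R D1 F (?p x t) + (t ^ q * w $ 2) *\<^sub>R D2 F (?p x t)))) (at x)"
      by (intro has_derivative_mult_right) simp
    then show "((\<lambda>x. t ^ m * F (?p x t)) has_derivative blinfun_apply (?fx x t)) (at x within ?S)"
      by (rule has_derivative_at_withinI[THEN has_derivative_eq_rhs])
        (simp add: P fun_eq_iff blinfun.add_left blinfun.scaleR_left power_add algebra_simps)
  next
    show "(\<lambda>t. t ^ m * F (?p x t)) integrable_on cbox 0 1" if "x \<in> ?S" for x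
      using int[OF F that] by simp
    show "continuous_on (?S \<times> cbox 0 1) (\<lambda>(x, t). ?fx x t)"
      unfolding split_beta interval_cbox[symmetric]
      by (intro continuous_on_add continuous_on_scaleR continuous_on_mult contc
          smooth_on_D1 smooth_on_D2 F continuous_intros)
  qed
  moreover have "blinfun_apply (integral (cbox 0 1) (?fx z)) =
      (\<lambda>w. w $ 1 *\<^sub>R ray_integral q m (D1 F) z + w $ 2 *\<^sub>R ray_integral q (m + q) (D2 F) z)"
  proof
    fix w :: "real^2"
    have i1: "(\<lambda>t. t ^ m * D1 F (?p z t)) integrable_on {0..1}"
      and i2: "(\<lambda>t. t ^ (m + q) * D2 F (?p z t)) integrable_on {0..1}"
      by (intro int smooth_on_D1 smooth_on_D2 F z)+
    have "?fx z integrable_on cbox 0 1"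
      using i1 i2 by (intro integrable_add integrable_on_scaleR_left) simp_all
    then have "blinfun_apply (integral (cbox 0 1) (?fx z)) w =
        integral (cbox 0 1) (\<lambda>t. (t ^ m * D1 F (?p z t)) * w $ 1 + (t ^ (m + q) * D2 F (?p z t)) * w $ 2)"
      by (subst blinfun_apply_integral) (simp_all add: P blinfun.add_left blinfun.scaleR_left)
    also have "\<dots> = w $ 1 *\<^sub>R ray_integral q m (D1 F) z + w $ 2 *\<^sub>R ray_integral q (m + q) (D2 F) z"
      unfolding ray_integral_def interval_cbox[symmetric]
      by (subst integral_add) (use i1 i2 in \<open>auto intro!: integrable_on_mult_left\<close>)
    finally show "blinfun_apply (integral (cbox 0 1) (?fx z)) w =
      w $ 1 *\<^sub>R ray_integral q m (D1 F) z + w $ 2 *\<^sub>R ray_integral q (m + q) (D2 F) z" .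
  qed
  ultimately show ?thesis
    unfolding ray_integral_def[abs_def] using at_within_open[OF z open_open_square] by simp
qed

lemma smooth_on_ray_integral:
  assumes "smooth_on F (open_square r)"
  shows "smooth_on (ray_integral q m F) (open_square r)"
proof -
  define I where "I = {i::nat \<times> (real^2 \<Rightarrow> real). smooth_on (snd i) (open_square r)}"
  let ?g = "\<lambda>i. ray_integral q (fst i) (snd i)"
  let ?D = "\<lambda>i z w::real^2. w $ 1 *\<^sub>R ?g (fst i, D1 (snd i)) z + w $ 2 *\<^sub>R ?g (fst i + q, D2 (snd i)) z"
  have der: "(?g i has_derivative ?D i z) (at z)" if "i \<in> I" "z \<in> open_square r" for i z
    using has_derivative_ray_integral[of "snd i" r z q "fst i"] that by (simp add: I_def)
  have "smooth_on (?g (m, F)) (open_square r)"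
  proof (rule smooth_onI_family[where I=I and g="?g" and D="?D"])
    show "continuous_on (open_square r) (?g i)" if "i \<in> I" for i
      by (rule has_derivative_continuous_on[OF has_derivative_at_withinI[OF der[OF that]]])
    show "\<exists>a j b k. j \<in> I \<and> k \<in> I \<and> (\<forall>z\<in>open_square r. ?D i z w = a *\<^sub>R ?g j z + b *\<^sub>R ?g k z)"
      if "i \<in> I" for i w
      using that
      by (intro exI[of _ "w $ 1"] exI[of _ "w $ 2"] exI[of _ "(fst i, D1 (snd i))"]
          exI[of _ "(fst i + q, D2 (snd i))"]) (simp add: I_def smooth_on_D1 smooth_on_D2)
  qed (use assms der in \<open>simp_all add: I_def\<close>)
  then show ?thesis by simp
qed

lemma ray_integral_axis:
  "z $ 2 = 0 \<Longrightarrow> ray_integral q m F z = F z / real (m + 1)"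
proof -
  assume "z $ 2 = 0"
  then have "vector [z $ 1, t ^ q * z $ 2] = z" for t by (simp add: vec_eq_iff forall_2)
  then have "ray_integral q m F z = integral {0..1} (\<lambda>t. t ^ m) * F z"
    by (simp add: ray_integral_def)
  also have "integral {0..1} (\<lambda>t::real. t ^ m) = 1 / real (m + 1)"
  proof (rule integral_unique)
    have "((\<lambda>t. t ^ Suc m / real (Suc m)) has_real_derivative t ^ m) (at t within {0..1})" for t :: real
      using DERIV_cdivide[OF DERIV_pow[of "Suc m" t "{0..1}"], of "real (Suc m)"]
      by (simp del: of_nat_Suc power_Suc)
    then have "((\<lambda>t::real. t ^ m) has_integral 1 ^ Suc m / real (Suc m) - 0 ^ Suc m / real (Suc m)) {0..1}"
      by (intro fundamental_theorem_of_calculus)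
        (simp_all flip: has_real_derivative_iff_has_vector_derivative)
    then show "((\<lambda>t::real. t ^ m) has_integral 1 / real (m + 1)) {0..1}" by simp
  qed
  finally show ?thesis by simp
qed

text \<open>The fundamental theorem of calculus on the segment from \<open>(u, 0)\<close> to \<open>(u, v)\<close>: the quotient of
  \<open>F - F(u, 0)\<close> by \<open>v\<^bsup>m+1\<^esup>\<close> is an average of \<open>F\<^sub>v / v\<^sup>m\<close>.\<close>

lemma Hadamard_division:
  assumes F: "smooth_on F (open_square r)" and G: "continuous_on (open_square r) G"
    and eq: "\<And>z. z \<in> open_square r \<Longrightarrow> D2 F z = (z $ 2) ^ m * G z" and z: "z \<in> open_square r"
  shows "F z = F (vector [z $ 1, 0]) + (z $ 2) ^ (m + 1) * ray_integral 1 m G z"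
proof -
  let ?p = "\<lambda>t. vector [z $ 1, t * z $ 2] :: real^2"
  have p: "?p t \<in> open_square r" if "t \<in> {0..1}" for t
    using open_square_shrink[OF z] that by auto
  have "((\<lambda>t. z $ 2 * D2 F (?p t)) has_integral F (?p 1) - F (?p 0)) {0..1}"
  proof (rule fundamental_theorem_of_calculus)
    fix t :: real assume t: "t \<in> {0..1}"
    have "((\<lambda>t. F (?p t)) has_derivative
        (\<lambda>h. (vector [0, h * z $ 2]::real^2) $ 1 *\<^sub>R D1 F (?p t) + (vector [0, h * z $ 2]::real^2) $ 2 *\<^sub>R D2 F (?p t))) (at t)"
      by (rule has_derivative_compose_D1_D2[OF F], rule p[OF t])
        (auto intro!: derivative_eq_intros)
    then show "((\<lambda>t. F (?p t)) has_vector_derivative z $ 2 * D2 F (?p t)) (at t within {0..1})"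
      unfolding has_vector_derivative_def
      by (rule has_derivative_at_withinI[THEN has_derivative_eq_rhs]) (simp add: fun_eq_iff)
  qed simp
  then have "F (?p 1) - F (?p 0) = integral {0..1} (\<lambda>t. z $ 2 * D2 F (?p t))"
    by (rule integral_unique[symmetric])
  also have "\<dots> = integral {0..1} (\<lambda>t. (z $ 2) ^ (m + 1) * (t ^ m * G (?p t)))"
    by (rule integral_cong) (use p eq in \<open>auto simp: power_mult_distrib\<close>)
  also have "\<dots> = (z $ 2) ^ (m + 1) * ray_integral 1 m G z"
    by (simp add: ray_integral_def)
  finally show ?thesis
    using vec2_expand[of z] vec2_expand[of "?p 1"] by (simp add: algebra_simps)
qed

section \<open>Even functions are functions of the square\<close>

text \<open>The Taylor coefficients at \<open>0\<close> of the product of the factors \<open>1 - x / 2\<^sup>j\<close> over all \<open>j \<ge> 0\<close>.\<close>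

primrec geometric_zero_coeff :: "nat \<Rightarrow> real" where
  "geometric_zero_coeff 0 = 1"
| "geometric_zero_coeff (Suc k) = geometric_zero_coeff k * (- 2 / (2 ^ Suc k - 1))"

lemma summable_geometric_zero_coeff: "summable (\<lambda>k. \<bar>geometric_zero_coeff k\<bar> * x ^ k)" if "x > 0" for x :: real
proof -
  obtain N where N: "4 * x + 1 < 2 ^ N"
    using real_arch_pow[of 2 "4 * x + 1"] by auto
  show ?thesis
  proof (rule summable_ratio_test[where c="1/2" and N=N])
    fix k assume k: "k \<ge> N"
    have "(2::real) ^ N \<le> 2 ^ Suc k" using k by (intro power_increasing) auto
    then have "4 * x \<le> 2 ^ Suc k - 1" using N by linarith
    then have r: "2 / (2 ^ Suc k - 1) * x \<le> 1 / 2" using \<open>x > 0\<close> by (simp add: field_simps)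
    have p: "(2::real) ^ Suc k - 1 > 0" using \<open>4 * x \<le> 2 ^ Suc k - 1\<close> \<open>x > 0\<close> by linarith
    have "norm (\<bar>geometric_zero_coeff (Suc k)\<bar> * x ^ Suc k) =
        (2 / (2 ^ Suc k - 1) * x) * norm (\<bar>geometric_zero_coeff k\<bar> * x ^ k)"
      using p \<open>x > 0\<close> by (simp add: abs_mult abs_divide del: power_Suc) (simp add: field_simps)
    also have "\<dots> \<le> 1 / 2 * norm (\<bar>geometric_zero_coeff k\<bar> * x ^ k)"
      by (rule mult_right_mono[OF r]) simp
    finally show "norm (\<bar>geometric_zero_coeff (Suc k)\<bar> * x ^ Suc k) \<le>
        1 / 2 * norm (\<bar>geometric_zero_coeff k\<bar> * x ^ k)" .
  qed simp
qed

text \<open>The entire function \<open>W(x) = \<Sum>\<^sub>k w\<^sub>k x\<^sup>k\<close> with these coefficients satisfies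
  \<open>W(2x) = (1 - 2x) W(x)\<close>, hence vanishes at all \<open>2\<^sup>n\<close>.  Dividing its coefficients by \<open>1 + 2\<^sup>k\<close> gives
  an entire \<open>C\<close> with \<open>C(2x) + C(x) = W(x)\<close>, so \<open>C(2\<^sup>n) = (-1)\<^sup>n C(1)\<close>, and the coefficients of
  \<open>C / C(1)\<close> are those of Seeley's extension operator.\<close>

lemma Seeley_coefficients:
  obtains a :: "nat \<Rightarrow> real" where
    "\<And>n. summable (\<lambda>k. \<bar>a k * (- (2 ^ k)) ^ n\<bar>)" "\<And>n. (\<lambda>k. a k * (- (2 ^ k)) ^ n) sums 1"
proof -
  let ?w = geometric_zero_coeff
  define c where "c = (\<lambda>k. ?w k / (1 + 2 ^ k))"
  have sw: "summable (\<lambda>k. ?w k * x ^ k)" if "x > 0" for x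
    using summable_geometric_zero_coeff[OF that] that
    by (intro summable_rabs_cancel[of "\<lambda>k. ?w k * x ^ k"]) (simp add: abs_mult power_abs)
  have le: "\<bar>c k\<bar> \<le> \<bar>?w k\<bar>" for k
  proof -
    have "\<bar>?w k\<bar> / (1 + 2 ^ k) \<le> \<bar>?w k\<bar> / 1" by (rule frac_le) auto
    then show ?thesis by (simp add: c_def abs_divide)
  qed
  have absc: "summable (\<lambda>k. \<bar>c k\<bar> * x ^ k)" if "x > 0" for x
    by (rule summable_comparison_test'[OF summable_geometric_zero_coeff[OF that], of 0])
      (use that le in \<open>auto simp: abs_mult intro!: mult_right_mono\<close>)
  have sc: "summable (\<lambda>k. c k * x ^ k)" if "x > 0" for x
    using absc[OF that] that
    by (intro summable_rabs_cancel[of "\<lambda>k. c k * x ^ k"]) (simp add: abs_mult power_abs)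
  define W where "W = (\<lambda>x. \<Sum>k. ?w k * x ^ k)"
  define C where "C = (\<lambda>x. \<Sum>k. c k * x ^ k)"
  have W: "W (2 * x) = (1 - 2 * x) * W x" if x: "x > 0" for x
  proof -
    let ?h = "\<lambda>k. ?w k * (2 * x) ^ k - ?w k * x ^ k"
    have sh: "summable ?h" using sw[of x] sw[of "2 * x"] x by (intro summable_diff) auto
    have "W (2 * x) - W x = (\<Sum>k. ?h k)"
      unfolding W_def by (rule suminf_diff) (use sw[of x] sw[of "2 * x"] x in auto)
    also have "\<dots> = (\<Sum>k. ?h (Suc k))" using suminf_split_head[OF sh] by simp
    also have "(\<lambda>k. ?h (Suc k)) = (\<lambda>k. (- 2 * x) * (?w k * x ^ k))"
    proof
      fix k
      have "(2::real) ^ Suc k - 1 > 0" using one_less_power[of "2::real" "Suc k"] by simp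
      then have "?w (Suc k) * (2 ^ Suc k - 1) = - 2 * ?w k" by simp
      then have "?w (Suc k) * (2 ^ Suc k - 1) * x ^ Suc k = - 2 * ?w k * x ^ Suc k" by simp
      then show "?h (Suc k) = (- 2 * x) * (?w k * x ^ k)"
        by (simp add: power_mult_distrib algebra_simps del: geometric_zero_coeff.simps)
    qed
    also have "(\<Sum>k. (- 2 * x) * (?w k * x ^ k)) = - 2 * x * W x"
      unfolding W_def by (rule suminf_mult[OF sw[OF x]])
    finally show ?thesis by (simp add: algebra_simps)
  qed
  have W0: "W (2 ^ n) = 0" for n
  proof (induction n)
    case 0 show ?case using W[of "1/2"] by simp
  next
    case (Suc n) then show ?case using W[of "2 ^ n"] by simp
  qed
  have CW: "C (2 * x) + C x = W x" if x: "x > 0" for x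
  proof -
    have "C (2 * x) + C x = (\<Sum>k. c k * (2 * x) ^ k + c k * x ^ k)"
      unfolding C_def by (rule suminf_add) (use sc[of x] sc[of "2 * x"] x in auto)
    also have "(\<lambda>k. c k * (2 * x) ^ k + c k * x ^ k) = (\<lambda>k. ?w k * x ^ k)"
    proof
      fix k
      have "(1::real) + 2 ^ k \<noteq> 0" using zero_less_power[of "2::real" k] by linarith
      then have "c k * (1 + 2 ^ k) = ?w k" by (simp add: c_def)
      then have "c k * (1 + 2 ^ k) * x ^ k = ?w k * x ^ k" by simp
      then show "c k * (2 * x) ^ k + c k * x ^ k = ?w k * x ^ k"
        by (simp add: power_mult_distrib algebra_simps)
    qed
    finally show ?thesis by (simp add: W_def)
  qed
  have C: "C (2 ^ n) = (- 1) ^ n * C 1" for n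
  proof (induction n)
    case (Suc n) then show ?case using CW[of "2 ^ n"] W0[of n] by simp
  qed simp
  \<comment> \<open>The first four terms of \<open>C(1)\<close> add up to more than \<open>1/20\<close>; the others decay geometrically.\<close>
  have "C 1 \<noteq> 0"
  proof -
    have s1: "summable c" using sc[of 1] by simp
    have tail: "\<bar>c (k + 4)\<bar> \<le> 16 / 5355 * (1 / 2) ^ k" for k
    proof (induction k)
      case 0
      show ?case by (simp add: c_def numeral_eq_Suc)
    next
      case (Suc k)
      have p: "(2::real) ^ (k + 4) \<ge> 16" using power_increasing[of 4 "k + 4" "2::real"] by simp
      then have q: "(2::real) ^ Suc (k + 4) - 1 > 0" by simp
      have "4 \<le> (2::real) ^ Suc (k + 4) - 1" unfolding power_Suc using p by linarith
      then have "2 / ((2::real) ^ Suc (k + 4) - 1) \<le> 2 / 4" by (intro frac_le) simp_all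
      then have "\<bar>?w (k + 4)\<bar> * (2 / (2 ^ Suc (k + 4) - 1)) \<le> \<bar>?w (k + 4)\<bar> * (2 / 4)"
        by (rule mult_left_mono) simp
      moreover have "\<bar>?w (Suc (k + 4))\<bar> = \<bar>?w (k + 4)\<bar> * (2 / (2 ^ Suc (k + 4) - 1))"
        unfolding geometric_zero_coeff.simps abs_mult abs_divide abs_of_pos[OF q] by simp
      ultimately have w: "\<bar>?w (Suc (k + 4))\<bar> \<le> \<bar>?w (k + 4)\<bar> * (1 / 2)" by simp
      have "\<bar>c (Suc (k + 4))\<bar> = \<bar>?w (Suc (k + 4))\<bar> / (1 + 2 ^ Suc (k + 4))"
        using p by (simp add: c_def abs_divide del: geometric_zero_coeff.simps)
      also have "\<dots> \<le> (\<bar>?w (k + 4)\<bar> * (1 / 2)) / (1 + 2 ^ (k + 4))"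
        using p w by (intro frac_le) (auto simp del: geometric_zero_coeff.simps)
      also have "\<dots> = \<bar>c (k + 4)\<bar> * (1 / 2)" using p by (simp add: c_def abs_divide)
      finally show ?case using Suc.IH by simp
    qed
    have "C 1 = (\<Sum>k. c (k + 4)) + sum c {..<4}"
      using suminf_split_initial_segment[OF s1, of 4] by (simp add: C_def)
    moreover have "sum c {..<4} > 1 / 20" by (simp add: c_def numeral_eq_Suc)
    moreover have "\<bar>\<Sum>k. c (k + 4)\<bar> \<le> (\<Sum>k. 16 / 5355 * (1 / 2) ^ k)"
    proof -
      have g: "summable (\<lambda>k. 16 / 5355 * (1 / 2::real) ^ k)"
        by (intro summable_mult summable_geometric) simp
      have "summable (\<lambda>k. \<bar>c (k + 4)\<bar>)"
        by (rule summable_comparison_test'[OF g, of 0]) (use tail in auto)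
      then show ?thesis
        using summable_rabs suminf_le[OF tail _ g] by (meson order_trans)
    qed
    moreover have "(\<Sum>k. 16 / 5355 * (1 / 2::real) ^ k) = 32 / 5355"
      by (subst suminf_mult) (auto simp: suminf_geometric)
    ultimately show ?thesis by linarith
  qed
  define a where "a = (\<lambda>k. c k / C 1)"
  have "summable (\<lambda>k. \<bar>a k * (- (2 ^ k)) ^ n\<bar>)" for n
  proof -
    have "summable (\<lambda>k. (\<bar>c k\<bar> * (2 ^ n) ^ k) / \<bar>C 1\<bar>)"
      by (intro summable_divide absc) simp
    then show ?thesis
      by (simp add: a_def abs_mult abs_divide power_abs power_mult[symmetric] mult.commute)
  qed
  moreover have "(\<lambda>k. a k * (- (2 ^ k)) ^ n) sums 1" for n
  proof -
    have "(\<lambda>k. c k * (2 ^ n) ^ k) sums ((- 1) ^ n * C 1)"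
      using summable_sums[OF sc[of "2 ^ n"]] C[of n] by (simp add: C_def)
    then have "(\<lambda>k. ((- 1) ^ n / C 1) * (c k * (2 ^ n) ^ k)) sums (((- 1) ^ n / C 1) * ((- 1) ^ n * C 1))"
      by (rule sums_mult)
    moreover have "((- 1) ^ n / C 1) * ((- 1) ^ n * C 1) = 1"
      using \<open>C 1 \<noteq> 0\<close> by (simp add: field_simps flip: power_mult_distrib)
    moreover have "((- 1) ^ n / C 1) * (c k * (2 ^ n) ^ k) = a k * (- (2 ^ k)) ^ n" for k
    proof -
      have "(- (2 ^ k)) ^ n = (- 1) ^ n * ((2::real) ^ n) ^ k"
        by (subst power_minus) (simp add: power_mult[symmetric] mult.commute)
      then show ?thesis by (simp add: a_def)
    qed
    ultimately show ?thesis by simp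
  qed
  ultimately show ?thesis by (rule that)
qed

text \<open>On a segment that starts on the axis, the mean value theorem needs derivatives only in the interior,
  which lies off the axis.  This yields the smoothness of Seeley's extension where its two halves meet.\<close>

lemma has_derivative_across_axis:
  fixes F A B :: "real^2 \<Rightarrow> real"
  assumes S: "open S" "z0 \<in> S" and F: "continuous_on S F"
    and A: "continuous_on S A" and B: "continuous_on S B"
    and der: "\<And>z. z \<in> S \<Longrightarrow> z $ 2 \<noteq> 0 \<Longrightarrow> (F has_derivative (\<lambda>w. w $ 1 * A z + w $ 2 * B z)) (at z)"
  shows "(F has_derivative (\<lambda>w. w $ 1 * A z0 + w $ 2 * B z0)) (at z0)"
proof (cases "z0 $ 2 = 0")
  case False
  then show ?thesis using der S(2) by blast
next
  case True
  let ?L = "\<lambda>w. w $ 1 * A z0 + w $ 2 * B z0"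
  have L: "bounded_linear ?L"
    by (intro bounded_linear_add bounded_linear_mult_const bounded_linear_vec_nth)
  have "\<exists>d>0. \<forall>y. norm (y - z0) < d \<longrightarrow> norm (F y - F z0 - ?L (y - z0)) \<le> e * norm (y - z0)"
    if e: "e > 0" for e
  proof -
    have cA: "isCont A z0" and cB: "isCont B z0"
      using A B S continuous_on_eq_continuous_at by blast+
    obtain d0 where d0: "d0 > 0" "ball z0 d0 \<subseteq> S" using S open_contains_ball by blast
    obtain d1 where d1: "d1 > 0" "\<And>y. dist y z0 < d1 \<Longrightarrow> dist (A y) (A z0) < e / 2"
      using cA e unfolding continuous_at_eps_delta by (meson half_gt_zero)
    obtain d2 where d2: "d2 > 0" "\<And>y. dist y z0 < d2 \<Longrightarrow> dist (B y) (B z0) < e / 2"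
      using cB e unfolding continuous_at_eps_delta by (meson half_gt_zero)
    define d where "d = min d0 (min d1 d2)"
    have d: "d > 0" "ball z0 d \<subseteq> S" using d0 d1(1) d2(1) by (auto simp: d_def)
    have off: "\<bar>F y - F z0 - ?L (y - z0)\<bar> \<le> e * norm (y - z0)" if y: "norm (y - z0) < d" "y $ 2 \<noteq> 0" for y
    proof -
      define w where "w = y - z0"
      have w2: "w $ 2 \<noteq> 0" using y(2) True by (simp add: w_def)
      have inS: "z0 + t *\<^sub>R w \<in> ball z0 d" if "t \<in> {0..1}" for t
      proof -
        have "\<bar>t\<bar> * norm w \<le> norm w" using that by (simp add: mult_left_le_one_le)
        then show ?thesis using y(1) by (simp add: dist_norm w_def)
      qed
      define h where "h = (\<lambda>t. F (z0 + t *\<^sub>R w) - t * ?L w)"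
      have "\<exists>t\<in>{0<..<1}. h 1 - h 0 =
          (\<lambda>s. s * (w $ 1 * (A (z0 + t *\<^sub>R w) - A z0) + w $ 2 * (B (z0 + t *\<^sub>R w) - B z0))) (1 - 0)"
      proof (rule mvt)
        show "continuous_on {0..1} h"
          unfolding h_def
          by (intro continuous_on_diff continuous_on_compose2[OF F] continuous_intros)
            (use inS d(2) in blast)
        fix t :: real assume t: "0 < t" "t < 1"
        have zt: "z0 + t *\<^sub>R w \<in> S" "(z0 + t *\<^sub>R w) $ 2 \<noteq> 0"
          using inS[of t] d(2) t w2 True by auto
        have "((\<lambda>t. z0 + t *\<^sub>R w) has_derivative (\<lambda>s. s *\<^sub>R w)) (at t)"
          by (auto intro!: derivative_eq_intros)
        from diff_chain_at[OF this der[OF zt]]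
        have "((\<lambda>t. F (z0 + t *\<^sub>R w)) has_derivative
            (\<lambda>s. (s *\<^sub>R w) $ 1 * A (z0 + t *\<^sub>R w) + (s *\<^sub>R w) $ 2 * B (z0 + t *\<^sub>R w))) (at t)"
          by (simp add: o_def)
        then have "(h has_derivative (\<lambda>s. (s *\<^sub>R w) $ 1 * A (z0 + t *\<^sub>R w) + (s *\<^sub>R w) $ 2 * B (z0 + t *\<^sub>R w) - s * ?L w)) (at t)"
          unfolding h_def by (intro derivative_intros)
        then show "(h has_derivative (\<lambda>s. s * (w $ 1 * (A (z0 + t *\<^sub>R w) - A z0) + w $ 2 * (B (z0 + t *\<^sub>R w) - B z0)))) (at t)"
          by (rule has_derivative_eq_rhs) (simp add: fun_eq_iff algebra_simps)
      next
        fix t :: real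
        assume "0 < t" "t < 1" "h 1 - h 0 =
          (1 - 0) * (w $ 1 * (A (z0 + t *\<^sub>R w) - A z0) + w $ 2 * (B (z0 + t *\<^sub>R w) - B z0))"
        then show "\<exists>t\<in>{0<..<1}. h 1 - h 0 =
          (1 - 0) * (w $ 1 * (A (z0 + t *\<^sub>R w) - A z0) + w $ 2 * (B (z0 + t *\<^sub>R w) - B z0))"
          by (intro bexI[of _ t]) auto
      qed simp
      then obtain t where t: "0 < t" "t < 1"
        and ht: "h 1 - h 0 = w $ 1 * (A (z0 + t *\<^sub>R w) - A z0) + w $ 2 * (B (z0 + t *\<^sub>R w) - B z0)"
        by auto
      have near: "dist (z0 + t *\<^sub>R w) z0 < d" using inS[of t] t by (simp add: dist_commute)
      have a: "\<bar>A (z0 + t *\<^sub>R w) - A z0\<bar> \<le> e / 2" and b: "\<bar>B (z0 + t *\<^sub>R w) - B z0\<bar> \<le> e / 2"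
        using d1(2)[of "z0 + t *\<^sub>R w"] d2(2)[of "z0 + t *\<^sub>R w"] near by (auto simp: d_def dist_real_def)
      have "F y - F z0 - ?L (y - z0) = h 1 - h 0" by (simp add: h_def w_def)
      also have "\<bar>\<dots>\<bar> \<le> \<bar>w $ 1\<bar> * (e / 2) + \<bar>w $ 2\<bar> * (e / 2)"
        unfolding ht
        by (intro order_trans[OF abs_triangle_ineq] add_mono; unfold abs_mult)
          (intro mult_left_mono a b abs_ge_zero)+
      also have "\<dots> \<le> norm w * (e / 2) + norm w * (e / 2)"
        using e component_le_norm_cart[of w] by (intro add_mono mult_right_mono) auto
      also have "\<dots> = e * norm (y - z0)" by (simp add: w_def)
      finally show ?thesis .
    qed
    have "\<bar>F y - F z0 - ?L (y - z0)\<bar> \<le> e * norm (y - z0)" if y: "norm (y - z0) < d" for y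
    proof (cases "y $ 2 = 0")
      case False
      then show ?thesis using off y by blast
    next
      case y2: True
      \<comment> \<open>A point on the axis is approached from off the axis.\<close>
      let ?y = "\<lambda>s. y + s *\<^sub>R axis 2 1 :: real^2"
      have yt: "(?y \<longlongrightarrow> y) (at_right 0)"
        by (rule tendsto_eq_intros | simp)+
      have "isCont F y"
        using F S(1) d(2) y continuous_on_eq_continuous_at
        by (metis (no_types, lifting) dist_norm mem_ball norm_minus_commute subset_iff)
      then have Ft: "((\<lambda>s. F (?y s)) \<longlongrightarrow> F y) (at_right 0)"
        using yt by (rule isCont_tendsto_compose)
      have Lt: "((\<lambda>s. ?L (?y s - z0)) \<longlongrightarrow> ?L (y - z0)) (at_right 0)"
        by (intro bounded_linear.tendsto[OF L] tendsto_intros yt)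
      have nt: "((\<lambda>s. norm (?y s - z0)) \<longlongrightarrow> norm (y - z0)) (at_right 0)"
        by (intro tendsto_intros yt)
      have ev: "eventually (\<lambda>s. \<bar>F (?y s) - F z0 - ?L (?y s - z0)\<bar> \<le> e * norm (?y s - z0)) (at_right 0)"
        using order_tendstoD(2)[OF nt y] eventually_at_right_less[of "0::real"]
      proof eventually_elim
        case (elim s)
        have "?y s $ 2 \<noteq> 0" using elim(2) y2 by (simp add: axis_def)
        then show ?case using off elim(1) by blast
      qed
      show ?thesis
        by (rule tendsto_le[OF _ _ _ ev])
          (use Ft Lt nt in \<open>auto intro!: tendsto_rabs tendsto_diff tendsto_mult_left\<close>)
    qed
    then show ?thesis using d(1) by auto
  qed
  then show ?thesis unfolding has_derivative_at_alt using L by blast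
qed

text \<open>The functions of interest live on \<open>\<bar>u\<bar> < 1\<close>, \<open>0 \<le> v \<le> 1\<close>.  The square is larger than that in order
  that they and all their derivatives be bounded there.\<close>

definition even_smooth :: "(real^2 \<Rightarrow> real) \<Rightarrow> bool" where
  "even_smooth f \<longleftrightarrow> smooth_on f (open_square 2) \<and>
     (\<forall>z\<in>open_square 2. f (vector [z $ 1, - z $ 2]) = f z)"

lemma reflect_open_square [simp]: "vector [z $ 1, - z $ 2] \<in> open_square r \<longleftrightarrow> z \<in> open_square r"
  by (simp add: open_square_def)

text \<open>For even and odd functions, that is, \<open>c = 1\<close> and \<open>c = -1\<close>.\<close>

lemma D1_D2_reflect:
  fixes f :: "real^2 \<Rightarrow> real"
  assumes f: "smooth_on f (open_square r)" and z: "z \<in> open_square r"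
    and eq: "\<And>z. z \<in> open_square r \<Longrightarrow> f (vector [z $ 1, - z $ 2]) = c * f z"
  shows "D1 f (vector [z $ 1, - z $ 2]) = c * D1 f z" "- D2 f (vector [z $ 1, - z $ 2]) = c * D2 f z"
proof -
  let ?R = "\<lambda>z. vector [z $ 1, - z $ 2] :: real^2"
  have R: "(?R has_derivative ?R) (at z)"
    by (intro has_derivative_vector2 has_derivative_minus bounded_linear_imp_has_derivative bounded_linear_vec_nth)
  have "((\<lambda>z. f (?R z)) has_derivative (\<lambda>h. (?R h) $ 1 *\<^sub>R D1 f (?R z) + (?R h) $ 2 *\<^sub>R D2 f (?R z))) (at z)"
    by (rule has_derivative_compose_D1_D2[OF f]) (use z R in simp_all)
  then have 1: "((\<lambda>z. c * f z) has_derivative (\<lambda>h. h $ 1 *\<^sub>R D1 f (?R z) + h $ 2 *\<^sub>R (- D2 f (?R z)))) (at z)"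
    by (rule has_derivative_transform_within_open[OF has_derivative_eq_rhs open_open_square z])
      (simp_all add: fun_eq_iff eq)
  have 2: "((\<lambda>z. c * f z) has_derivative (\<lambda>h. h $ 1 *\<^sub>R (c * D1 f z) + h $ 2 *\<^sub>R (c * D2 f z))) (at z)"
    by (rule has_derivative_eq_rhs[OF has_derivative_mult_right[OF has_derivative_D1_D2[OF f z]]])
      (simp add: fun_eq_iff algebra_simps)
  show "D1 f (?R z) = c * D1 f z" "- D2 f (?R z) = c * D2 f z"
    using D1_D2_unique[OF 1] D1_D2_unique[OF 2] by simp_all
qed

text \<open>For even \<open>f\<close> this is the smooth function \<open>f\<^sub>v / v\<close>.\<close>

definition D2_quotient :: "(real^2 \<Rightarrow> real) \<Rightarrow> real^2 \<Rightarrow> real" where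
  "D2_quotient f = ray_integral 1 0 (D2 (D2 f))"

text \<open>With \<open>v\<^sup>2 = s / (1 + s)\<close> this is twice the derivative of \<open>f(u, v)\<close> with respect to \<open>s\<close>: the factor
  \<open>(1 - v\<^sup>2)\<^sup>2 = 1 / (1 + s)\<^sup>2\<close> is the derivative of \<open>v\<^sup>2\<close>.  It is again even and smooth in \<open>(u, v)\<close>.\<close>

definition compressed_D2 :: "(real^2 \<Rightarrow> real) \<Rightarrow> real^2 \<Rightarrow> real" where
  "compressed_D2 f z = (1 - (z $ 2)\<^sup>2)\<^sup>2 * D2_quotient f z"

lemma ray_integral_reflect:
  assumes "\<And>z. z \<in> open_square r \<Longrightarrow> f (vector [z $ 1, - z $ 2]) = f z" "z \<in> open_square r"
  shows "ray_integral 1 m f (vector [z $ 1, - z $ 2]) = ray_integral 1 m f z"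
  unfolding ray_integral_def
proof (rule integral_cong)
  fix t :: real assume t: "t \<in> {0..1}"
  then have "vector [z $ 1, t * z $ 2] \<in> open_square r"
    using open_square_shrink[OF assms(2)] by auto
  then show "t ^ m * f (vector [(vector [z $ 1, - z $ 2] :: real^2) $ 1, t ^ 1 * (vector [z $ 1, - z $ 2] :: real^2) $ 2]) =
      t ^ m * f (vector [z $ 1, t ^ 1 * z $ 2])"
    using assms(1)[of "vector [z $ 1, t * z $ 2]"] by simp
qed

lemma even_smoothD:
  assumes "even_smooth f"
  shows "smooth_on f (open_square 2)" "\<And>z. z \<in> open_square 2 \<Longrightarrow> f (vector [z $ 1, - z $ 2]) = 1 * f z"
  using assms by (auto simp: even_smooth_def)

lemma even_smooth_D1:
  assumes "even_smooth f"
  shows "even_smooth (D1 f)"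
  unfolding even_smooth_def
proof (intro conjI ballI)
  show "smooth_on (D1 f) (open_square 2)" by (rule smooth_on_D1[OF even_smoothD(1)[OF assms]])
  show "D1 f (vector [z $ 1, - z $ 2]) = D1 f z" if "z \<in> open_square 2" for z
    using D1_D2_reflect(1)[where f=f and r=2 and c=1 and z=z] even_smoothD[OF assms] that by simp
qed

lemma odd_smooth_quotient:
  assumes f: "smooth_on f (open_square 2)"
    and odd: "\<And>z. z \<in> open_square 2 \<Longrightarrow> f (vector [z $ 1, - z $ 2]) = (-1) * f z"
  shows "even_smooth (ray_integral 1 0 (D2 f))"
    and "z \<in> open_square 2 \<Longrightarrow> f z = z $ 2 * ray_integral 1 0 (D2 f) z"
proof -
  have D: "D2 f (vector [x $ 1, - x $ 2]) = D2 f x" if x: "x \<in> open_square 2" for x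
  proof -
    have "- D2 f (vector [x $ 1, - x $ 2]) = (-1) * D2 f x"
      by (rule D1_D2_reflect(2)[where f=f and r=2 and c="-1" and z=x]) (rule f x odd; assumption?)+
    then show ?thesis by simp
  qed
  show "even_smooth (ray_integral 1 0 (D2 f))"
    unfolding even_smooth_def
  proof (intro conjI ballI)
    show "smooth_on (ray_integral 1 0 (D2 f)) (open_square 2)"
      by (rule smooth_on_ray_integral[OF smooth_on_D2[OF f]])
    show "ray_integral 1 0 (D2 f) (vector [x $ 1, - x $ 2]) = ray_integral 1 0 (D2 f) x"
      if "x \<in> open_square 2" for x
      using ray_integral_reflect[where f="D2 f" and r=2 and m=0 and z=x] D that by simp
  qed
  assume z: "z \<in> open_square 2"
  have "vector [z $ 1, 0 * z $ 2] \<in> open_square 2" by (rule open_square_shrink[OF z]) simp_all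
  then have "f (vector [z $ 1, 0]) = 0" using odd[of "vector [z $ 1, 0]"] by simp
  moreover have "f z = f (vector [z $ 1, 0]) + (z $ 2) ^ (0 + 1) * ray_integral 1 0 (D2 f) z"
    by (rule Hadamard_division[OF f smooth_on_continuous[OF smooth_on_D2[OF f]] _ z]) simp
  ultimately show "f z = z $ 2 * ray_integral 1 0 (D2 f) z" by simp
qed

lemma even_smooth_D2:
  assumes "even_smooth f"
  shows "even_smooth (D2_quotient f)" "z \<in> open_square 2 \<Longrightarrow> D2 f z = z $ 2 * D2_quotient f z"
proof -
  have D: "D2 f (vector [x $ 1, - x $ 2]) = (-1) * D2 f x" if x: "x \<in> open_square 2" for x
  proof -
    have "- D2 f (vector [x $ 1, - x $ 2]) = 1 * D2 f x"
      by (rule D1_D2_reflect(2)[where f=f and r=2 and c=1 and z=x])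
        (rule even_smoothD[OF assms] x; assumption?)+
    then show ?thesis by simp
  qed
  note Q = odd_smooth_quotient[where f="D2 f", OF smooth_on_D2[OF even_smoothD(1)[OF assms]]]
  show "even_smooth (D2_quotient f)"
    unfolding D2_quotient_def by (rule Q(1)) (rule D)
  show "D2 f z = z $ 2 * D2_quotient f z" if "z \<in> open_square 2"
    unfolding D2_quotient_def by (rule Q(2)[OF _ that]) (rule D)
qed

lemma even_smooth_compressed_D2:
  assumes "even_smooth f"
  shows "even_smooth (compressed_D2 f)"
proof -
  have "smooth_on (\<lambda>z. (1 - (z $ 2)\<^sup>2)\<^sup>2 * D2_quotient f z) (open_square 2)"
    by (intro smooth_intros even_smoothD(1)[OF even_smooth_D2(1)[OF assms]] open_open_square)
  then show ?thesis
    using even_smoothD(2)[OF even_smooth_D2(1)[OF assms]]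
    by (simp add: even_smooth_def compressed_D2_def[abs_def])
qed

text \<open>Seeley's series evaluates a function at \<open>2\<^sup>k s\<close> for all \<open>k\<close>.  To keep these arguments in the domain of
  a given function of \<open>v = \<surd>s\<close>, the half-line is first compressed to a bounded interval.\<close>

definition compress :: "real \<Rightarrow> real" where "compress s = sqrt (s / (1 + s))"

lemma compress_bounds: "0 \<le> s \<Longrightarrow> 0 \<le> compress s \<and> compress s \<le> 1"
  by (simp add: compress_def)

lemma compress_point:
  "\<bar>z $ 1\<bar> < 1 \<Longrightarrow> 0 \<le> s \<Longrightarrow> vector [z $ 1, compress s] \<in> open_square 2"
  using compress_bounds[of s] by (simp add: open_square_def)

lemma continuous_on_compress [continuous_intros]:
  "continuous_on S f \<Longrightarrow> (\<And>x. x \<in> S \<Longrightarrow> 0 \<le> f x) \<Longrightarrow> continuous_on S (\<lambda>x. compress (f x))"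
  unfolding compress_def by (intro continuous_intros) (auto simp: add_nonneg_eq_0_iff)

lemma has_derivative_compress:
  fixes z :: "real^2"
  assumes f: "even_smooth f" and z: "\<bar>z $ 1\<bar> < 1" and s: "l * z $ 2 > 0"
  shows "((\<lambda>z. f (vector [z $ 1, compress (l * z $ 2)])) has_derivative
     (\<lambda>w. w $ 1 * D1 f (vector [z $ 1, compress (l * z $ 2)]) +
          w $ 2 * (l / 2 * compressed_D2 f (vector [z $ 1, compress (l * z $ 2)])))) (at z)"
proof -
  let ?s = "l * z $ 2"
  let ?r = "compress ?s"
  let ?p = "vector [z $ 1, ?r] :: real^2"
  have p: "?p \<in> open_square 2" using compress_point[OF z] s by simp
  have r: "?r > 0" "?r\<^sup>2 = ?s / (1 + ?s)" using s by (simp_all add: compress_def)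
  have d1: "((\<lambda>s. s / (1 + s)) has_real_derivative 1 / (1 + ?s)\<^sup>2) (at ?s)"
    using s by (auto intro!: derivative_eq_intros simp: divide_simps power2_eq_square)
  have d2: "(sqrt has_real_derivative inverse ?r / 2) (at (?s / (1 + ?s)))"
    unfolding compress_def by (rule DERIV_real_sqrt) (use s in simp)
  have "(compress has_real_derivative inverse ?r / 2 * (1 / (1 + ?s)\<^sup>2)) (at ?s)"
    using DERIV_chain2[where f=sqrt and g="\<lambda>s. s / (1 + s)", OF d2 d1]
    by (simp add: compress_def[abs_def])
  then have d: "(compress has_derivative (*) (inverse ?r / 2 * (1 / (1 + ?s)\<^sup>2))) (at ?s)"
    by (simp add: has_field_derivative_def)
  have "((\<lambda>z::real^2. l * z $ 2) has_derivative (\<lambda>w. l * w $ 2)) (at z)"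
    by (intro has_derivative_mult_right bounded_linear_imp_has_derivative bounded_linear_vec_nth)
  from diff_chain_at[OF this d]
  have "((\<lambda>z::real^2. compress (l * z $ 2)) has_derivative (\<lambda>w. (inverse ?r / 2 * (1 / (1 + ?s)\<^sup>2)) * (l * w $ 2))) (at z)"
    by (simp add: o_def)
  then have v: "((\<lambda>z. vector [z $ 1, compress (l * z $ 2)] :: real^2) has_derivative
      (\<lambda>w. vector [w $ 1, (inverse ?r / 2 * (1 / (1 + ?s)\<^sup>2)) * (l * w $ 2)])) (at z)"
    by (intro has_derivative_vector2 bounded_linear_imp_has_derivative bounded_linear_vec_nth)
  have "1 - ?r\<^sup>2 = 1 / (1 + ?s)" using s by (simp add: r(2) field_simps)
  then have "(1 - ?r\<^sup>2)\<^sup>2 = 1 / (1 + ?s)\<^sup>2" by (simp add: power_one_over)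
  then have c: "compressed_D2 f ?p = 1 / (1 + ?s)\<^sup>2 * D2_quotient f ?p"
    by (simp add: compressed_D2_def)
  have "D2 f ?p = ?r * D2_quotient f ?p" using even_smooth_D2(2)[OF f p] by simp
  then have e: "(inverse ?r / 2 * (1 / (1 + ?s)\<^sup>2)) * (l * w $ 2) * D2 f ?p = w $ 2 * (l / 2 * compressed_D2 f ?p)"
    for w :: "real^2"
    unfolding c using r(1) by (simp add: field_simps)
  show ?thesis
    by (rule has_derivative_eq_rhs[OF has_derivative_compose_D1_D2[OF even_smoothD(1)[OF f] p v]])
      (use e in \<open>simp add: fun_eq_iff\<close>)
qed

lemma even_smooth_bounded:
  assumes "even_smooth f"
  obtains B where "\<And>(z::real^2) s. \<bar>z $ 1\<bar> < 1 \<Longrightarrow> 0 \<le> s \<Longrightarrow> \<bar>f (vector [z $ 1, compress s])\<bar> \<le> B"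
proof -
  let ?K = "cbox (vector [-1, 0]) (vector [1, 1]) :: (real^2) set"
  have K: "?K \<subseteq> open_square 2" by (auto simp: mem_box_cart open_square_def forall_2)
  have "compact (f ` ?K)"
    by (intro compact_continuous_image continuous_on_subset[OF smooth_on_continuous[OF even_smoothD(1)[OF assms]] K] compact_cbox)
  then obtain B where "\<And>z. z \<in> ?K \<Longrightarrow> \<bar>f z\<bar> \<le> B"
    using compact_imp_bounded bounded_iff by (metis imageI real_norm_def)
  moreover have "vector [z $ 1, compress s] \<in> ?K" if "\<bar>z $ 1\<bar> < 1" "0 \<le> s" for z :: "real^2" and s
    using that compress_bounds[of s] by (simp add: mem_box_cart forall_2) linarith
  ultimately show ?thesis by (intro that[of B]) simp
qed

text \<open>Seeley's extension of \<open>(u, s) \<mapsto> f(u, compress s)\<close> from \<open>s \<ge> 0\<close> to \<open>s < 0\<close>.  The index \<open>n\<close>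
  counts derivatives in \<open>s\<close>: each of them multiplies the coefficient \<open>a\<^sub>k\<close> by \<open>-2\<^sup>k\<close>.\<close>

definition Seeley_series :: "(nat \<Rightarrow> real) \<Rightarrow> nat \<Rightarrow> (real^2 \<Rightarrow> real) \<Rightarrow> real^2 \<Rightarrow> real" where
  "Seeley_series a n f z =
     (\<Sum>k. (a k * (- (2 ^ k)) ^ n) * f (vector [z $ 1, compress (- (2 ^ k) * z $ 2)]))"

definition Seeley_extension :: "(nat \<Rightarrow> real) \<Rightarrow> nat \<Rightarrow> (real^2 \<Rightarrow> real) \<Rightarrow> real^2 \<Rightarrow> real" where
  "Seeley_extension a n f z =
     (if z $ 2 \<le> 0 then Seeley_series a n f z else f (vector [z $ 1, compress (z $ 2)]))"

abbreviation strip :: "(real^2) set" where "strip \<equiv> {z. \<bar>z $ 1\<bar> < 1}"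

lemma open_strip: "open strip"
  by (intro open_Collect_less continuous_intros)

context
  fixes a :: "nat \<Rightarrow> real"
  assumes summ: "\<And>n. summable (\<lambda>k. \<bar>a k * (- (2 ^ k)) ^ n\<bar>)"
    and sums: "\<And>n. (\<lambda>k. a k * (- (2 ^ k)) ^ n) sums 1"
begin

lemma Seeley_series_uniform:
  assumes f: "even_smooth f"
  shows "uniform_limit (strip \<inter> {z. z $ 2 \<le> 0})
    (\<lambda>N z. \<Sum>k<N. (a k * (- (2 ^ k)) ^ n) * f (vector [z $ 1, compress (- (2 ^ k) * z $ 2)]))
    (Seeley_series a n f) sequentially"
proof -
  obtain B where B: "\<And>(z::real^2) s. \<bar>z $ 1\<bar> < 1 \<Longrightarrow> 0 \<le> s \<Longrightarrow> \<bar>f (vector [z $ 1, compress s])\<bar> \<le> B"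
    using even_smooth_bounded[OF f] by blast
  have "uniform_limit (strip \<inter> {z. z $ 2 \<le> 0})
    (\<lambda>N z. \<Sum>k<N. (a k * (- (2 ^ k)) ^ n) * f (vector [z $ 1, compress (- (2 ^ k) * z $ 2)]))
    (\<lambda>z. \<Sum>k. (a k * (- (2 ^ k)) ^ n) * f (vector [z $ 1, compress (- (2 ^ k) * z $ 2)])) sequentially"
  proof (rule Weierstrass_m_test)
    show "norm ((a k * (- (2 ^ k)) ^ n) * f (vector [z $ 1, compress (- (2 ^ k) * z $ 2)])) \<le>
        \<bar>a k * (- (2 ^ k)) ^ n\<bar> * B" if "z \<in> strip \<inter> {z. z $ 2 \<le> 0}" for k z
      unfolding real_norm_def abs_mult[of "a k * (- (2 ^ k)) ^ n"]
      by (intro mult_left_mono B) (use that in \<open>simp_all add: mult_le_0_iff\<close>)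
    show "summable (\<lambda>k. \<bar>a k * (- (2 ^ k)) ^ n\<bar> * B)"
      by (rule summable_mult2[OF summ])
  qed
  then show ?thesis unfolding Seeley_series_def[abs_def] .
qed

lemma Seeley_series_axis:
  assumes "z $ 2 = 0"
  shows "Seeley_series a n f z = f z"
proof -
  have "(\<lambda>k. (a k * (- (2 ^ k)) ^ n) * f z) sums (1 * f z)"
    by (rule sums_mult2[OF sums])
  moreover have "vector [z $ 1, 0] = z" using assms by (simp add: vec_eq_iff forall_2)
  ultimately show ?thesis
    using assms by (simp add: Seeley_series_def compress_def sums_iff)
qed

lemma continuous_on_Seeley_extension:
  assumes f: "even_smooth f"
  shows "continuous_on strip (Seeley_extension a n f)"
  unfolding Seeley_extension_def[abs_def]
proof (rule continuous_on_cases_le)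
  have c: "continuous_on S (\<lambda>z. f (vector [z $ 1, compress (l * z $ 2)]))"
    if "S \<subseteq> strip" "\<And>z. z \<in> S \<Longrightarrow> 0 \<le> l * z $ 2" for S l
    by (rule continuous_on_compose2[OF smooth_on_continuous[OF even_smoothD(1)[OF f]]])
      (use that in \<open>auto intro!: continuous_intros compress_point\<close>)
  have "{t \<in> strip. t $ 2 \<le> 0} = strip \<inter> {z. z $ 2 \<le> 0}" by auto
  moreover have "continuous_on (strip \<inter> {z. z $ 2 \<le> 0}) (Seeley_series a n f)"
  proof (rule uniform_limit_theorem[OF always_eventually Seeley_series_uniform[OF f]], intro allI continuous_on_sum continuous_on_mult continuous_on_const c)
    show "0 \<le> - (2 ^ k) * z $ 2" if "z \<in> strip \<inter> {z. z $ 2 \<le> 0}" for z :: "real^2" and k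
      using that by (simp add: mult_le_0_iff)
  qed simp_all
  ultimately show "continuous_on {t \<in> strip. t $ 2 \<le> 0} (Seeley_series a n f)" by simp
  show "continuous_on {t \<in> strip. 0 \<le> t $ 2} (\<lambda>z. f (vector [z $ 1, compress (z $ 2)]))"
    using c[of "{t \<in> strip. 0 \<le> t $ 2}" 1] by auto
  show "Seeley_series a n f t = f (vector [t $ 1, compress (t $ 2)])" if "t \<in> strip" "t $ 2 = 0" for t
  proof -
    have "vector [t $ 1, 0] = t" using that by (simp add: vec_eq_iff forall_2)
    then show ?thesis using Seeley_series_axis[OF that(2)] that(2) by (simp add: compress_def)
  qed
qed (intro continuous_intros)

lemma has_derivative_Seeley_series:
  assumes f: "even_smooth f" and z: "z \<in> strip" "z $ 2 < 0"
  shows "(Seeley_series a n f has_derivative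
    (\<lambda>w. w $ 1 * Seeley_series a n (D1 f) z + w $ 2 * (1 / 2 * Seeley_series a (Suc n) (compressed_D2 f) z))) (at z)"
proof -
  let ?S = "strip \<inter> {z. z $ 2 < 0}"
  let ?t = "\<lambda>n f k z. (a k * (- (2 ^ k)) ^ n) * f (vector [z $ 1, compress (- (2 ^ k) * z $ 2)])"
  let ?f' = "\<lambda>k x w::real^2. w $ 1 * ?t n (D1 f) k x + w $ 2 * (1 / 2 * ?t (Suc n) (compressed_D2 f) k x)"
  let ?g' = "\<lambda>x w::real^2. w $ 1 * Seeley_series a n (D1 f) x + w $ 2 * (1 / 2 * Seeley_series a (Suc n) (compressed_D2 f) x)"
  have oS: "open ?S"
    by (intro open_Int open_strip open_Collect_less continuous_intros)
  have zS: "z \<in> ?S" using z by simp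
  have sub: "?S \<subseteq> strip \<inter> {z. z $ 2 \<le> 0}" by auto
  note U = uniform_limit_on_subset[OF Seeley_series_uniform sub]
  have sums: "(\<lambda>k. ?t n f k x) sums Seeley_series a n f x" if "x \<in> ?S" for x
    using tendsto_uniform_limitI[OF U[OF f] that] by (simp add: sums_def)
  have "\<exists>g. \<forall>x\<in>?S. (\<lambda>k. ?t n f k x) sums g x \<and> (g has_derivative ?g' x) (at x within ?S)"
  proof (rule has_derivative_series)
    have "?S = (\<lambda>z. z $ 1) -` {-1<..<1} \<inter> (\<lambda>z. z $ 2) -` {..<0}"
      by auto
    then show "convex ?S"
      by (simp only:) (intro convex_Int convex_linear_vimage convex_real_interval bounded_linear.linear bounded_linear_vec_nth)
    show "(?t n f k has_derivative ?f' k x) (at x within ?S)" if x: "x \<in> ?S" for k x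
    proof (rule has_derivative_at_withinI)
      have "- (2 ^ k) * x $ 2 > 0" using x by (simp add: mult_pos_neg)
      moreover have "\<bar>x $ 1\<bar> < 1" using x by simp
      ultimately show "(?t n f k has_derivative ?f' k x) (at x)"
        by (intro has_derivative_eq_rhs[OF has_derivative_mult_right[OF has_derivative_compress[OF f]]])
          (simp_all add: fun_eq_iff algebra_simps)
    qed
    show "\<forall>\<^sub>F N in sequentially. \<forall>x\<in>?S. \<forall>w. norm ((\<Sum>i<N. ?f' i x w) - ?g' x w) \<le> e * norm w"
      if e: "e > 0" for e
    proof -
      have e2: "e / 2 > 0" using e by simp
      show ?thesis
        using uniform_limitD[OF U[OF even_smooth_D1[OF f], of n] e2]
          uniform_limitD[OF U[OF even_smooth_compressed_D2[OF f], of "Suc n"] e]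
      proof eventually_elim
        case (elim N)
        have "norm ((\<Sum>i<N. ?f' i x w) - ?g' x w) \<le> e * norm w" if x: "x \<in> ?S" for x w :: "real^2"
        proof -
          let ?A = "(\<Sum>i<N. ?t n (D1 f) i x) - Seeley_series a n (D1 f) x"
          let ?B = "(\<Sum>i<N. ?t (Suc n) (compressed_D2 f) i x) - Seeley_series a (Suc n) (compressed_D2 f) x"
          have AB: "\<bar>?A\<bar> \<le> e / 2" "\<bar>?B\<bar> \<le> e"
            using elim x by (auto simp: dist_real_def intro: less_imp_le)
          have alg: "p * S + q * (1 / 2 * T) - (p * S' + q * (1 / 2 * T')) =
              p * (S - S') + q * (1 / 2 * (T - T'))" for p q S T S' T' :: real
            by (simp add: right_diff_distrib diff_divide_distrib)
          have bound: "\<bar>p * S + q * (1 / 2 * T)\<bar> \<le> c * e"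
            if "\<bar>p\<bar> \<le> c" "\<bar>q\<bar> \<le> c" "\<bar>S\<bar> \<le> e / 2" "\<bar>T\<bar> \<le> e" for p q S T c :: real
          proof -
            have "\<bar>p * S + q * (1 / 2 * T)\<bar> \<le> \<bar>p\<bar> * \<bar>S\<bar> + \<bar>q\<bar> * (1 / 2 * \<bar>T\<bar>)"
              by (rule order_trans[OF abs_triangle_ineq]) (simp add: abs_mult)
            also have "\<dots> \<le> c * (e / 2) + c * (1 / 2 * e)"
              using that e by (intro add_mono mult_mono) auto
            finally show ?thesis by simp
          qed
          have "(\<Sum>i<N. ?f' i x w) = w $ 1 * (\<Sum>i<N. ?t n (D1 f) i x) +
              w $ 2 * (1 / 2 * (\<Sum>i<N. ?t (Suc n) (compressed_D2 f) i x))"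
            by (simp only: sum.distrib sum_distrib_left)
          then have "(\<Sum>i<N. ?f' i x w) - ?g' x w = w $ 1 * ?A + w $ 2 * (1 / 2 * ?B)"
            by (simp only: alg)
          moreover have "\<bar>w $ 1 * ?A + w $ 2 * (1 / 2 * ?B)\<bar> \<le> norm w * e"
            by (rule bound) (use AB component_le_norm_cart[of w] in simp_all)
          ultimately show ?thesis
            by (simp only: real_norm_def mult.commute)
        qed
        then show ?case by (intro ballI allI)
      qed
    qed
  qed (use zS sums[OF zS] in auto)
  then obtain g where g: "\<And>x. x \<in> ?S \<Longrightarrow> (\<lambda>k. ?t n f k x) sums g x"
      "\<And>x. x \<in> ?S \<Longrightarrow> (g has_derivative ?g' x) (at x within ?S)"
    by blast
  have "(g has_derivative ?g' z) (at z)" using g(2)[OF zS] at_within_open[OF zS oS] by simp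
  then show ?thesis
    by (rule has_derivative_transform_within_open[OF _ oS zS]) (rule sums_unique2[OF g(1) sums])
qed

lemma has_derivative_Seeley_extension:
  assumes f: "even_smooth f" and z: "z \<in> strip"
  shows "(Seeley_extension a n f has_derivative
    (\<lambda>w. w $ 1 * Seeley_extension a n (D1 f) z + w $ 2 * (1 / 2 * Seeley_extension a (Suc n) (compressed_D2 f) z))) (at z)"
proof (rule has_derivative_across_axis[OF open_strip z])
  show "continuous_on strip (Seeley_extension a n f)" "continuous_on strip (Seeley_extension a n (D1 f))"
    by (intro continuous_on_Seeley_extension even_smooth_D1 f)+
  show "continuous_on strip (\<lambda>z. 1 / 2 * Seeley_extension a (Suc n) (compressed_D2 f) z)"
    by (intro continuous_on_mult_left continuous_on_Seeley_extension even_smooth_compressed_D2 f)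
  fix z :: "real^2" assume z: "z \<in> strip" and z2: "z $ 2 \<noteq> 0"
  show "(Seeley_extension a n f has_derivative
    (\<lambda>w. w $ 1 * Seeley_extension a n (D1 f) z + w $ 2 * (1 / 2 * Seeley_extension a (Suc n) (compressed_D2 f) z))) (at z)"
  proof (cases "z $ 2 < 0")
    case True
    have o: "open {x::real^2. x $ 2 < 0}" by (intro open_Collect_less continuous_intros)
    show ?thesis
    proof (rule has_derivative_transform_within_open[OF _ o])
      show "(Seeley_series a n f has_derivative
        (\<lambda>w. w $ 1 * Seeley_extension a n (D1 f) z + w $ 2 * (1 / 2 * Seeley_extension a (Suc n) (compressed_D2 f) z))) (at z)"
        using has_derivative_Seeley_series[OF f z True, of n] True by (simp add: Seeley_extension_def)
    qed (use True in \<open>simp_all add: Seeley_extension_def\<close>)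
  next
    case False
    then have pos: "1 * z $ 2 > 0" using z2 by simp
    have o: "open {x::real^2. x $ 2 > 0}" by (intro open_Collect_less continuous_intros)
    have "\<bar>z $ 1\<bar> < 1" using z by simp
    note d = has_derivative_compress[OF f this pos]
    show ?thesis
    proof (rule has_derivative_transform_within_open[OF _ o])
      show "((\<lambda>z. f (vector [z $ 1, compress (z $ 2)])) has_derivative
        (\<lambda>w. w $ 1 * Seeley_extension a n (D1 f) z + w $ 2 * (1 / 2 * Seeley_extension a (Suc n) (compressed_D2 f) z))) (at z)"
        using d pos by (simp add: Seeley_extension_def)
    qed (use pos in \<open>simp_all add: Seeley_extension_def\<close>)
  qed
qed

lemma smooth_on_Seeley_extension:
  assumes f: "even_smooth f"
  shows "smooth_on (Seeley_extension a 0 f) strip"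
proof -
  define I where "I = {i::nat \<times> (real^2 \<Rightarrow> real). even_smooth (snd i)}"
  let ?g = "\<lambda>i. Seeley_extension a (fst i) (snd i)"
  let ?D = "\<lambda>i z w::real^2. w $ 1 * ?g (fst i, D1 (snd i)) z + w $ 2 * (1 / 2 * ?g (Suc (fst i), compressed_D2 (snd i)) z)"
  have "smooth_on (?g (0, f)) strip"
  proof (rule smooth_onI_family[where I=I and g="?g" and D="?D", OF open_strip])
    show "\<exists>a j b k. j \<in> I \<and> k \<in> I \<and> (\<forall>z\<in>strip. ?D i z w = a *\<^sub>R ?g j z + b *\<^sub>R ?g k z)"
      if "i \<in> I" for i w
      using that
      by (intro exI[of _ "w $ 1"] exI[of _ "w $ 2 / 2"] exI[of _ "(fst i, D1 (snd i))"]
          exI[of _ "(Suc (fst i), compressed_D2 (snd i))"])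
        (simp add: I_def even_smooth_D1 even_smooth_compressed_D2)
    show "(0, f) \<in> I" using f by (simp add: I_def)
    show "continuous_on strip (?g i)" if "i \<in> I" for i
      using that continuous_on_Seeley_extension by (simp add: I_def)
    show "(?g i has_derivative ?D i z) (at z)" if "i \<in> I" "z \<in> strip" for i z
      using has_derivative_Seeley_extension[of "snd i" z "fst i"] that by (simp add: I_def)
  qed
  then show ?thesis by simp
qed

end

text \<open>Whitney's theorem on even functions: Seeley's extension is composed with \<open>t \<mapsto> t / (1 - t)\<close>, the
  inverse of \<open>s \<mapsto> s / (1 + s)\<close>, to undo the compression.\<close>

lemma even_function_of_square:
  assumes f: "even_smooth f"
  obtains g where "smooth_on g (open_square 1)"
    "\<And>z. z \<in> open_square 1 \<Longrightarrow> f z = g (vector [z $ 1, (z $ 2)\<^sup>2])"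
proof -
  obtain a :: "nat \<Rightarrow> real" where a: "\<And>n. summable (\<lambda>k. \<bar>a k * (- (2 ^ k)) ^ n\<bar>)"
    "\<And>n. (\<lambda>k. a k * (- (2 ^ k)) ^ n) sums 1"
    by (rule Seeley_coefficients, rule that)
  note E = smooth_on_Seeley_extension[OF a f]
  define g where "g = (\<lambda>z::real^2. Seeley_extension a 0 f (vector [z $ 1, z $ 2 / (1 - z $ 2)]))"
  have "smooth_on g (open_square 1)"
    unfolding g_def
  proof (rule smooth_on_compose[OF open_open_square E])
    show "smooth_on (\<lambda>z::real^2. vector [z $ 1, z $ 2 / (1 - z $ 2)] :: real^2) (open_square 1)"
      by (intro smooth_intros open_open_square) (auto simp: open_square_def)
  qed (simp add: open_square_def)
  moreover have "f z = g (vector [z $ 1, (z $ 2)\<^sup>2])" if z: "z \<in> open_square 1" for z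
  proof -
    have v: "(z $ 2)\<^sup>2 < 1" using z by (simp add: open_square_def abs_square_less_1)
    have z2: "z \<in> open_square 2" using z by (simp add: open_square_def)
    have c: "compress ((z $ 2)\<^sup>2 / (1 - (z $ 2)\<^sup>2)) = \<bar>z $ 2\<bar>"
    proof -
      have "x / (1 - x) / (1 + x / (1 - x)) = x" if "x < 1" for x :: real
      proof -
        have "1 + x / (1 - x) = 1 / (1 - x)" using that by (simp add: field_simps)
        then have "x / (1 - x) / (1 + x / (1 - x)) = x / (1 - x) / (1 / (1 - x))" by (simp only:)
        also have "\<dots> = x" using that by simp
        finally show ?thesis .
      qed
      from this[OF v] show ?thesis unfolding compress_def by (simp only: real_sqrt_abs)
    qed
    have "g (vector [z $ 1, (z $ 2)\<^sup>2]) = f (vector [z $ 1, \<bar>z $ 2\<bar>])"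
    proof (cases "z $ 2 = 0")
      case True
      then show ?thesis
        by (simp add: g_def Seeley_extension_def Seeley_series_axis[OF a])
    next
      case False
      then have "(z $ 2)\<^sup>2 / (1 - (z $ 2)\<^sup>2) > 0" using v by simp
      then show ?thesis using c by (simp add: g_def Seeley_extension_def)
    qed
    also have "\<dots> = f z"
    proof (cases "z $ 2 \<ge> 0")
      case True
      then have "vector [z $ 1, \<bar>z $ 2\<bar>] = z" by (simp add: vec_eq_iff forall_2)
      then show ?thesis by simp
    next
      case False
      then show ?thesis using even_smoothD(2)[OF f z2] by simp
    qed
    finally show ?thesis by simp
  qed
  ultimately show ?thesis by (rule that)
qed

lemma Whitney_decomposition_square_2:
  assumes f: "smooth_on f (open_square 2)"
  obtains A B :: "real^2 \<Rightarrow> real" where "smooth_on A (open_square 1)" "smooth_on B (open_square 1)"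
    "\<And>z. z \<in> open_square 1 \<Longrightarrow>
       f z = A (vector [z $ 1, (z $ 2)\<^sup>2]) + z $ 2 * B (vector [z $ 1, (z $ 2)\<^sup>2])"
proof -
  define fe where "fe = (\<lambda>z::real^2. (f z + f (vector [z $ 1, - z $ 2])) / 2)"
  define fo where "fo = (\<lambda>z::real^2. (f z - f (vector [z $ 1, - z $ 2])) / 2)"
  have fR: "smooth_on (\<lambda>z. f (vector [z $ 1, - z $ 2])) (open_square 2)"
    by (rule smooth_on_compose[OF open_open_square f]) (simp_all, intro smooth_intros open_open_square)
  have RR: "vector [(vector [z $ 1, - z $ 2] :: real^2) $ 1, - (vector [z $ 1, - z $ 2] :: real^2) $ 2] = z"
    for z :: "real^2"
    by (simp add: vec_eq_iff forall_2)
  have fe: "even_smooth fe"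
    unfolding even_smooth_def fe_def
    using RR by (auto intro!: smooth_on_divide smooth_on_add f fR smooth_on_const simp: add.commute)
  have so: "smooth_on fo (open_square 2)"
    unfolding fo_def by (intro smooth_on_divide smooth_on_diff f fR smooth_on_const open_open_square) simp
  have odd: "fo (vector [z $ 1, - z $ 2]) = (-1) * fo z" for z
    unfolding fo_def RR by (simp add: field_simps)
  note Q = odd_smooth_quotient[where f=fo, OF so odd]
  obtain A where A: "smooth_on A (open_square 1)"
      "\<And>z. z \<in> open_square 1 \<Longrightarrow> fe z = A (vector [z $ 1, (z $ 2)\<^sup>2])"
    by (rule even_function_of_square[OF fe], rule that)
  obtain B where B: "smooth_on B (open_square 1)"
      "\<And>z. z \<in> open_square 1 \<Longrightarrow> ray_integral 1 0 (D2 fo) z = B (vector [z $ 1, (z $ 2)\<^sup>2])"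
    by (rule even_function_of_square[OF Q(1)], rule that)
  have "f z = A (vector [z $ 1, (z $ 2)\<^sup>2]) + z $ 2 * B (vector [z $ 1, (z $ 2)\<^sup>2])"
    if z: "z \<in> open_square 1" for z
  proof -
    have "z \<in> open_square 2" using z by (simp add: open_square_def)
    then have "fo z = z $ 2 * B (vector [z $ 1, (z $ 2)\<^sup>2])" using Q(2) B(2)[OF z] by simp
    moreover have "f z = fe z + fo z" by (simp add: fe_def fo_def field_simps)
    ultimately show ?thesis using A(2)[OF z] by simp
  qed
  with A(1) B(1) show ?thesis by (rule that)
qed

lemma smooth_on_rescale:
  assumes F: "smooth_on F (open_square r)" and k: "\<bar>k\<bar> * s \<le> r" "\<bar>l\<bar> * s \<le> r" "k \<noteq> 0" "l \<noteq> 0"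
  shows "smooth_on (\<lambda>z. F (vector [k * z $ 1, l * z $ 2])) (open_square s)"
proof (rule smooth_on_compose[OF open_open_square F])
  show "smooth_on (\<lambda>z. vector [k * z $ 1, l * z $ 2] :: real^2) (open_square s)"
    by (intro smooth_intros open_open_square)
  fix z assume "z \<in> open_square s"
  then have "\<bar>k\<bar> * \<bar>z $ 1\<bar> < \<bar>k\<bar> * s" "\<bar>l\<bar> * \<bar>z $ 2\<bar> < \<bar>l\<bar> * s"
    using k by (auto simp: open_square_def)
  then have "\<bar>k\<bar> * \<bar>z $ 1\<bar> < r" "\<bar>l\<bar> * \<bar>z $ 2\<bar> < r" using k by linarith+
  then show "vector [k * z $ 1, l * z $ 2] \<in> open_square r"
    by (simp add: open_square_def abs_mult)
qed

text \<open>The even part of \<open>f\<close> and the quotient of its odd part by \<open>v\<close> are both even.  What matters later is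
  that \<open>A\<close> and \<open>B\<close> are smooth also where their second argument is negative: they enter the
  diffeomorphism of the target, whose domain is a full neighbourhood.\<close>

lemma Whitney_decomposition:
  assumes f: "smooth_on f (open_square R)" and R: "R > 0"
  obtains r and A B :: "real^2 \<Rightarrow> real" where "0 < r" "r \<le> R" "r \<le> 1"
    "smooth_on A (open_square r)" "smooth_on B (open_square r)"
    "\<And>z. z \<in> open_square r \<Longrightarrow>
       f z = A (vector [z $ 1, (z $ 2)\<^sup>2]) + z $ 2 * B (vector [z $ 1, (z $ 2)\<^sup>2])"
proof -
  define c where "c = 2 / R"
  have c: "c > 0" "(1 / c) * 2 = R" using R by (simp_all add: c_def)
  have sf: "smooth_on (\<lambda>z. f (vector [(1 / c) * z $ 1, (1 / c) * z $ 2])) (open_square 2)"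
    by (rule smooth_on_rescale[OF f]) (use c in simp_all)
  obtain A B where A: "smooth_on A (open_square 1)" and B: "smooth_on B (open_square 1)"
    and AB: "\<And>z. z \<in> open_square 1 \<Longrightarrow> f (vector [(1 / c) * z $ 1, (1 / c) * z $ 2]) =
       A (vector [z $ 1, (z $ 2)\<^sup>2]) + z $ 2 * B (vector [z $ 1, (z $ 2)\<^sup>2])"
    by (rule Whitney_decomposition_square_2[OF sf], rule that)
  define r where "r = min 1 (min R (min (1 / c) (1 / c\<^sup>2)))"
  have r: "0 < r" "r \<le> R" "r \<le> 1" using R c(1) by (simp_all add: r_def)
  have "r \<le> 1 / c" "r \<le> 1 / c\<^sup>2" by (simp_all add: r_def)
  then have cr: "c * r \<le> 1" "c\<^sup>2 * r \<le> 1" using c(1) by (simp_all add: field_simps)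
  let ?s = "\<lambda>F z::real^2. F (vector [c * z $ 1, c\<^sup>2 * z $ 2])"
  have "smooth_on (?s A) (open_square r)" "smooth_on (\<lambda>z. c * ?s B z) (open_square r)"
    by (intro smooth_on_mult smooth_on_const open_open_square smooth_on_rescale[OF A] smooth_on_rescale[OF B];
      use c(1) cr in simp)+
  moreover have "f z = ?s A (vector [z $ 1, (z $ 2)\<^sup>2]) + z $ 2 * (c * ?s B (vector [z $ 1, (z $ 2)\<^sup>2]))"
    if z: "z \<in> open_square r" for z
  proof -
    have "c * \<bar>z $ 1\<bar> < c * r" "c * \<bar>z $ 2\<bar> < c * r" using z c(1) by (simp_all add: open_square_def)
    then have "c * \<bar>z $ 1\<bar> < 1" "c * \<bar>z $ 2\<bar> < 1" using cr(1) by linarith+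
    then have "vector [c * z $ 1, c * z $ 2] \<in> open_square 1"
      using c(1) by (simp add: open_square_def abs_mult)
    moreover have "vector [z $ 1, z $ 2] = z" by (simp add: vec_eq_iff forall_2)
    ultimately show ?thesis
      using AB[of "vector [c * z $ 1, c * z $ 2]"] c(1) by (simp add: power_mult_distrib)
  qed
  ultimately show ?thesis using r by (intro that[of r "?s A" "\<lambda>z. c * ?s B z"])
qed

section \<open>A criterion for cuspidal edges\<close>

lemma open_preimage_nonzero:
  fixes f :: "'a::real_normed_vector \<Rightarrow> real"
  assumes "open S" "smooth_on f S"
  shows "open {z \<in> S. f z \<noteq> 0}"
proof -
  have "open (S \<inter> f -` (- {0}))"
    by (intro continuous_open_preimage smooth_on_continuous assms open_Compl closed_singleton)
  moreover have "S \<inter> f -` (- {0}) = {z \<in> S. f z \<noteq> 0}" by auto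
  ultimately show ?thesis by simp
qed

lemma open_preimage_pos:
  fixes f :: "'a::real_normed_vector \<Rightarrow> real"
  assumes "open S" "smooth_on f S"
  shows "open {z \<in> S. f z > 0}"
proof -
  have "open (S \<inter> f -` {0<..})"
    by (intro continuous_open_preimage smooth_on_continuous assms open_greaterThan)
  moreover have "S \<inter> f -` {0<..} = {z \<in> S. f z > 0}" by auto
  ultimately show ?thesis by simp
qed

lemma frechet_derivative_inner:
  assumes "smooth_on h S" "z \<in> S"
  shows "fderiv (\<lambda>z. (h z - b) \<bullet> a) z w = fderiv h z w \<bullet> a"
proof -
  have "((\<lambda>z. (h z - b) \<bullet> a) has_derivative (\<lambda>w. (fderiv h z w - 0) \<bullet> a)) (at z)"
    by (intro has_derivative_inner_left has_derivative_diff has_derivative_const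
        smooth_on_has_derivative[OF assms])
  from frechet_derivative_at[OF this] show ?thesis by (metis diff_zero)
qed

lemma D2_compose:
  fixes Q :: "real^2 \<Rightarrow> real^2"
  assumes "smooth_on F S" "smooth_on Q T" "y \<in> T" "Q y \<in> S"
  shows "D2 (\<lambda>y. F (Q y)) y = fderiv F (Q y) (D2 Q y)"
proof -
  have "((\<lambda>y. F (Q y)) has_derivative (\<lambda>w. fderiv F (Q y) (fderiv Q y w))) (at y)"
    using diff_chain_at[OF smooth_on_has_derivative[OF assms(2,3)] smooth_on_has_derivative[OF assms(1,4)]]
    by (simp add: o_def)
  from fun_cong[OF frechet_derivative_at[OF this], of "axis 2 1"]
  show ?thesis by (simp add: D2_def)
qed

text \<open>A fold: the pair \<open>(x, y)\<close> of functions has a Jacobian \<open>J\<close> with nonzero derivative in the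
  direction of the kernel, so \<open>(x, J)\<close> are coordinates.  In these coordinates \<open>y\<close> has
  \<open>J\<close>-derivative \<open>J \<omega>\<close> with \<open>\<omega> > 0\<close>, hence equals a function of \<open>x\<close> plus \<open>J\<^sup>2 \<alpha>\<close> with \<open>\<alpha> > 0\<close>, and \<open>J \<surd>\<alpha>\<close> is
  the second coordinate required.\<close>

lemma fold_coordinates:
  fixes x y :: "real^2 \<Rightarrow> real" and e \<eta> :: "real^2"
  assumes oS: "open S" and S0: "0 \<in> S" and x: "smooth_on x S" and y: "smooth_on y S"
    and x0: "x 0 = 0"
    and dx: "fderiv x 0 e = 1" "fderiv x 0 \<eta> = 0"
    and dy: "fderiv y 0 e = 0" "fderiv y 0 \<eta> = 0"
    and ddx: "fderiv (\<lambda>z. fderiv x z \<eta>) 0 \<eta> = 0"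
    and ddy: "fderiv (\<lambda>z. fderiv y z \<eta>) 0 \<eta> = 1"
  obtains r k :: real and \<Theta> V and Y :: "real^2 \<Rightarrow> real" where "r > 0"
    "diffeo_on \<Theta> (open_square r) V" "V \<subseteq> S" "\<Theta> 0 = 0" "D2 \<Theta> 0 = k *\<^sub>R \<eta>" "k \<noteq> 0"
    "smooth_on Y (open_square r)" "\<And>z. z \<in> open_square r \<Longrightarrow> x (\<Theta> z) = z $ 1"
    "\<And>z. z \<in> open_square r \<Longrightarrow> y (\<Theta> z) = Y (vector [z $ 1, 0]) + (z $ 2)\<^sup>2"
proof -
  let ?d = "\<lambda>f z w. fderiv f z w"
  define J where "J = (\<lambda>z. ?d x z e * ?d y z \<eta> - ?d x z \<eta> * ?d y z e)"
  define S' where "S' = {z \<in> S. ?d x z e \<noteq> 0}"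
  have oS': "open S'"
    unfolding S'_def by (rule open_preimage_nonzero[OF oS smooth_on_frechet[OF x]])
  have S'S: "S' \<subseteq> S" by (auto simp: S'_def)
  have S'0: "0 \<in> S'" using S0 dx by (simp add: S'_def)
  note x' = smooth_on_subset[OF x S'S] and y' = smooth_on_subset[OF y S'S]
  have sJ: "smooth_on J S'"
    unfolding J_def by (intro smooth_on_diff smooth_on_mult smooth_on_frechet x' y' oS')
  have J0: "J 0 = 0" using dx dy by (simp add: J_def)
  have dJ: "?d J 0 \<eta> = 1"
  proof -
    note hd = smooth_on_has_derivative[OF smooth_on_frechet S'0]
    have "(J has_derivative (\<lambda>w.
        (?d x 0 e * ?d (\<lambda>z. ?d y z \<eta>) 0 w + ?d (\<lambda>z. ?d x z e) 0 w * ?d y 0 \<eta>) -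
        (?d x 0 \<eta> * ?d (\<lambda>z. ?d y z e) 0 w + ?d (\<lambda>z. ?d x z \<eta>) 0 w * ?d y 0 e))) (at 0)"
      unfolding J_def by (intro has_derivative_diff has_derivative_mult hd[OF x'] hd[OF y'])
    from fun_cong[OF frechet_derivative_at[OF this], of \<eta>] show ?thesis
      using dx dy ddx ddy by simp
  qed
  define P where "P = (\<lambda>z. vector [x z, J z] :: real^2)"
  have sP: "smooth_on P S'" unfolding P_def by (intro smooth_on_vector2 oS' x' sJ)
  have dP: "?d P z w = vector [?d x z w, ?d J z w]" if "z \<in> S'" for z w
  proof -
    have "(P has_derivative (\<lambda>w. vector [?d x z w, ?d J z w])) (at z)"
      unfolding P_def by (intro has_derivative_vector2 smooth_on_has_derivative[OF x' that]
          smooth_on_has_derivative[OF sJ that])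
    from fun_cong[OF frechet_derivative_at[OF this], of w] show ?thesis by simp
  qed
  have linP: "linear (?d P 0)" by (rule has_derivative_linear[OF smooth_on_has_derivative[OF sP S'0]])
  have injP: "inj (?d P 0)"
  proof (rule linear_surjective_imp_injective[OF linP])
    have "\<exists>w. ?d P 0 w = q" for q :: "real^2"
    proof
      show "?d P 0 (q $ 1 *\<^sub>R e + (q $ 2 - q $ 1 * ?d J 0 e) *\<^sub>R \<eta>) = q"
        unfolding linear_add[OF linP] linear_cmul[OF linP]
        by (simp add: dP[OF S'0] dx dJ vec_eq_iff forall_2)
    qed
    then show "surj (?d P 0)" by (metis surj_def)
  qed simp
  obtain V0 W0 where P: "diffeo_on P V0 W0" "0 \<in> V0" "V0 \<subseteq> S'"
    by (rule smooth_on_local_inverse[OF oS' sP S'0 injP], rule that)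
  obtain Q where Q: "diffeo_on Q W0 V0" "\<And>z. z \<in> V0 \<Longrightarrow> Q (P z) = z" "\<And>z. z \<in> W0 \<Longrightarrow> P (Q z) = z"
    by (rule diffeo_on_inverse[OF P(1)], rule that)
  have v0: "vector [0, 0] = (0 :: real^2)" by (simp add: vec_eq_iff forall_2)
  have P0: "P 0 = 0" using x0 J0 v0 by (simp add: P_def)
  then have Q0: "Q 0 = 0" using Q(2)[OF P(2)] by simp
  have W00: "0 \<in> W0" using P(1,2) P0 by (auto simp: diffeo_on_def)
  have oW0: "open W0" and sQW: "smooth_on Q W0" and QV0: "\<And>z. z \<in> W0 \<Longrightarrow> Q z \<in> V0"
    using Q(1) by (auto simp: diffeo_on_def)
  obtain r0 where r0: "r0 > 0" "open_square r0 \<subseteq> W0"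
    by (rule open_contains_open_square[OF oW0 W00])
  let ?R = "open_square r0"
  have sQ: "smooth_on Q ?R" by (rule smooth_on_subset[OF sQW r0(2)])
  have QS': "Q z \<in> S'" if "z \<in> ?R" for z using QV0 P(3) r0(2) that by blast
  have PQ: "x (Q z) = z $ 1" "J (Q z) = z $ 2" if "z \<in> ?R" for z
    using arg_cong[OF Q(3)[of z], of "\<lambda>v. v $ 1"] arg_cong[OF Q(3)[of z], of "\<lambda>v. v $ 2"] r0(2) that
    by (auto simp: P_def)
  \<comment> \<open>The oriented areas spanned with \<open>e\<close> replace the \<open>\<eta>\<close>-components of vectors.\<close>
  define area where "area = (\<lambda>w::real^2. e $ 1 * w $ 2 - e $ 2 * w $ 1)"
  have J_area: "area \<eta> * (?d x z e * ?d y z w - ?d x z w * ?d y z e) = J z * area w" if "z \<in> S'" for z w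
  proof -
    note fx = frechet_derivative_D1_D2[OF x' that] and fy = frechet_derivative_D1_D2[OF y' that]
    show ?thesis unfolding J_def area_def fx fy by (simp add: algebra_simps)
  qed
  have area: "area \<eta> \<noteq> 0"
  proof
    assume 0: "area \<eta> = 0"
    have l: "linear (?d x 0)" by (rule has_derivative_linear[OF smooth_on_has_derivative[OF x' S'0]])
    have e0: "e \<noteq> 0" using dx(1) linear_0[OF l] by auto
    have "\<exists>c. \<eta> = c *\<^sub>R e"
    proof (cases "e $ 1 = 0")
      case True
      then have "e $ 2 \<noteq> 0" using e0 by (auto simp: vec_eq_iff forall_2)
      then show ?thesis using 0 True
        by (intro exI[of _ "\<eta> $ 2 / e $ 2"]) (auto simp: area_def vec_eq_iff forall_2)
    next
      case False
      then show ?thesis using 0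
        by (intro exI[of _ "\<eta> $ 1 / e $ 1"]) (auto simp: area_def vec_eq_iff forall_2 field_simps)
    qed
    then obtain c where c: "\<eta> = c *\<^sub>R e" by blast
    then have "c = 0" using dx linear_cmul[OF l] by simp
    then have "\<eta> = 0" using c by simp
    then show False using dJ linear_0[OF has_derivative_linear[OF smooth_on_has_derivative[OF sJ S'0]]] by simp
  qed
  define \<omega> where "\<omega> = (\<lambda>z. area (D2 Q z) / (area \<eta> * ?d x (Q z) e))"
  have s\<omega>: "smooth_on \<omega> ?R"
    unfolding \<omega>_def area_def
    by (intro smooth_on_divide smooth_on_diff smooth_on_mult smooth_on_nth smooth_on_const open_open_square
        smooth_on_D2 sQ smooth_on_compose[OF open_open_square smooth_on_frechet[OF x']] QS')
      (use area QS' in \<open>auto simp: area_def S'_def\<close>)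
  define F where "F = (\<lambda>z. y (Q z))"
  have sF: "smooth_on F ?R"
    unfolding F_def by (rule smooth_on_compose[OF open_open_square y' sQ]) (rule QS')
  have D2F: "D2 F z = (z $ 2) ^ 1 * \<omega> z" if z: "z \<in> ?R" for z
  proof -
    have "D2 (\<lambda>z. x (Q z)) z = 0"
    proof -
      have "((\<lambda>z::real^2. z $ 1) has_derivative (\<lambda>w. w $ 1 *\<^sub>R 1 + w $ 2 *\<^sub>R 0)) (at z)"
        using bounded_linear_imp_has_derivative[OF bounded_linear_vec_nth] by simp
      then have "((\<lambda>z. x (Q z)) has_derivative (\<lambda>w. w $ 1 *\<^sub>R 1 + w $ 2 *\<^sub>R 0)) (at z)"
        by (rule has_derivative_transform_within_open[OF _ open_open_square z]) (simp add: PQ)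
      from D1_D2_unique(2)[OF this] show ?thesis .
    qed
    then have "?d x (Q z) (D2 Q z) = 0"
      using D2_compose[OF x' sQ z QS'[OF z]] by simp
    then have "area \<eta> * (?d x (Q z) e * ?d y (Q z) (D2 Q z)) = z $ 2 * area (D2 Q z)"
      using J_area[OF QS'[OF z], of "D2 Q z"] PQ(2)[OF z] by simp
    moreover have "?d x (Q z) e \<noteq> 0" using QS'[OF z] by (simp add: S'_def)
    moreover have "D2 F z = ?d y (Q z) (D2 Q z)"
      unfolding F_def by (rule D2_compose[OF y' sQ z QS'[OF z]])
    ultimately show ?thesis using area by (simp add: \<omega>_def field_simps)
  qed
  have DQ0: "D2 Q 0 = \<eta>"
  proof -
    have z0: "0 \<in> ?R" using r0(1) by simp
    have "((\<lambda>z. z) has_derivative (\<lambda>w. w $ 1 *\<^sub>R axis 1 1 + w $ 2 *\<^sub>R axis 2 1)) (at (0::real^2))"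
      by (rule has_derivative_eq_rhs[OF has_derivative_ident]) (use vec2_expand in \<open>simp add: fun_eq_iff\<close>)
    then have "((\<lambda>z. P (Q z)) has_derivative (\<lambda>w. w $ 1 *\<^sub>R axis 1 1 + w $ 2 *\<^sub>R axis 2 1)) (at 0)"
      by (rule has_derivative_transform_within_open[OF _ open_open_square z0]) (use Q(3) r0(2) in auto)
    from D1_D2_unique(2)[OF this] have "?d P (Q 0) (D2 Q 0) = axis 2 1"
      using D2_compose[OF sP sQ z0 QS'[OF z0]] by simp
    moreover have "?d P 0 \<eta> = axis 2 1"
      unfolding dP[OF S'0] by (simp add: dx dJ vec_eq_iff forall_2 axis_def)
    ultimately show ?thesis using injP by (simp add: Q0 inj_def)
  qed
  define \<alpha> where "\<alpha> = ray_integral 1 1 \<omega>"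
  have s\<alpha>: "smooth_on \<alpha> ?R" unfolding \<alpha>_def by (rule smooth_on_ray_integral[OF s\<omega>])
  have \<alpha>0: "\<alpha> 0 = 1 / 2"
    using area dx(1) by (simp add: \<alpha>_def ray_integral_axis \<omega>_def DQ0 Q0)
  have F\<alpha>: "F z = F (vector [z $ 1, 0]) + (z $ 2)\<^sup>2 * \<alpha> z" if "z \<in> ?R" for z
    using Hadamard_division[OF sF smooth_on_continuous[OF s\<omega>] D2F that]
    by (simp add: \<alpha>_def power2_eq_square)
  have "open {z \<in> ?R. \<alpha> z > 0}"
    by (rule open_preimage_pos[OF open_open_square s\<alpha>])
  moreover have "0 \<in> {z \<in> ?R. \<alpha> z > 0}" using \<alpha>0 r0(1) by simp
  ultimately obtain r1 where r1: "r1 > 0" "open_square r1 \<subseteq> {z \<in> ?R. \<alpha> z > 0}"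
    by (rule open_contains_open_square)
  let ?R1 = "open_square r1"
  have R1R: "?R1 \<subseteq> ?R" and \<alpha>pos: "\<And>z. z \<in> ?R1 \<Longrightarrow> \<alpha> z > 0" using r1(2) by auto
  have z1: "0 \<in> ?R1" using r1(1) by simp
  define K where "K = (\<lambda>z. vector [z $ 1, z $ 2 * sqrt (\<alpha> z)] :: real^2)"
  have s\<alpha>1: "smooth_on (\<lambda>z. sqrt (\<alpha> z)) ?R1"
    by (rule smooth_on_sqrt[OF open_open_square smooth_on_subset[OF s\<alpha> R1R] \<alpha>pos])
  have sK: "smooth_on K ?R1"
    unfolding K_def by (intro smooth_on_vector2 smooth_on_mult smooth_on_nth smooth_on_id s\<alpha>1 open_open_square)
  have dK: "?d K 0 w = vector [w $ 1, w $ 2 * sqrt (1 / 2)]" for w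
  proof -
    have "(K has_derivative (\<lambda>w. vector [w $ 1, (0::real^2) $ 2 * ?d (\<lambda>z. sqrt (\<alpha> z)) 0 w + w $ 2 * sqrt (\<alpha> 0)])) (at 0)"
      unfolding K_def
      by (intro has_derivative_vector2 has_derivative_mult bounded_linear_imp_has_derivative
          bounded_linear_vec_nth smooth_on_has_derivative[OF s\<alpha>1 z1])
    from fun_cong[OF frechet_derivative_at[OF this], of w] show ?thesis by (simp add: \<alpha>0)
  qed
  have injK: "inj (?d K 0)"
    unfolding inj_def dK by (simp add: vec_eq_iff forall_2)
  obtain V1 W1 where K: "diffeo_on K V1 W1" "0 \<in> V1" "V1 \<subseteq> ?R1"
    by (rule smooth_on_local_inverse[OF open_open_square sK z1 injK], rule that)
  obtain L where L: "diffeo_on L W1 V1" "\<And>z. z \<in> V1 \<Longrightarrow> L (K z) = z" "\<And>z. z \<in> W1 \<Longrightarrow> K (L z) = z"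
    by (rule diffeo_on_inverse[OF K(1)], rule that)
  have K0: "K 0 = 0" using v0 by (simp add: K_def)
  then have L0: "L 0 = 0" using L(2)[OF K(2)] by simp
  have W10: "0 \<in> W1" using K(1,2) K0 by (auto simp: diffeo_on_def)
  have oW1: "open W1" and sL: "smooth_on L W1" and LV1: "\<And>z. z \<in> W1 \<Longrightarrow> L z \<in> V1" and oV1: "open V1"
    using L(1) by (auto simp: diffeo_on_def)
  obtain r2 where r2: "r2 > 0" "open_square r2 \<subseteq> W1"
    by (rule open_contains_open_square[OF oW1 W10])
  define r where "r = min r2 r0"
  have r: "r > 0" "open_square r \<subseteq> W1" "open_square r \<subseteq> ?R"
    using r2 r0(1) by (auto simp: r_def open_square_def)
  define \<Theta> where "\<Theta> = (\<lambda>z. Q (L z))"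
  have V1W0: "V1 \<subseteq> W0" using K(3) R1R r0(2) by blast
  have dL: "diffeo_on L (open_square r) (L ` open_square r)"
    by (rule diffeo_on_restrict[OF L(1) open_open_square r(2)])
  then have oL: "open (L ` open_square r)" by (simp add: diffeo_on_def)
  have LW0: "L ` open_square r \<subseteq> W0" using LV1 r(2) V1W0 by blast
  have d\<Theta>: "diffeo_on \<Theta> (open_square r) (Q ` L ` open_square r)"
    unfolding \<Theta>_def by (rule diffeo_on_compose[OF dL diffeo_on_restrict[OF Q(1) oL LW0]])
  have "Q ` L ` open_square r \<subseteq> S"
    using LW0 QV0 P(3) S'S by blast
  have z2: "0 \<in> open_square r" using r(1) by simp
  have "D2 L 0 = sqrt 2 *\<^sub>R axis 2 1"
  proof -
    have "((\<lambda>z. z) has_derivative (\<lambda>w. w $ 1 *\<^sub>R axis 1 1 + w $ 2 *\<^sub>R axis 2 1)) (at (0::real^2))"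
      by (rule has_derivative_eq_rhs[OF has_derivative_ident]) (use vec2_expand in \<open>simp add: fun_eq_iff\<close>)
    then have "((\<lambda>z. K (L z)) has_derivative (\<lambda>w. w $ 1 *\<^sub>R axis 1 1 + w $ 2 *\<^sub>R axis 2 1)) (at 0)"
      by (rule has_derivative_transform_within_open[OF _ oW1 W10]) (simp add: L(3))
    from D1_D2_unique(2)[OF this] have "?d K (L 0) (D2 L 0) = axis 2 1"
      using D2_compose[OF sK sL W10] z1 L0 by simp
    then show ?thesis
      unfolding L0 dK by (simp add: vec_eq_iff forall_2 axis_def real_sqrt_divide field_simps)
  qed
  then have "D2 \<Theta> 0 = sqrt 2 *\<^sub>R \<eta>"
    unfolding \<Theta>_def
    using D2_compose[OF sQ sL W10] r0(1) L0 DQ0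
      linear_cmul[OF has_derivative_linear[OF smooth_on_has_derivative[OF sQ]], of 0 "sqrt 2"]
    by (simp add: D2_def)
  moreover have "x (\<Theta> z) = z $ 1 \<and> y (\<Theta> z) = F (vector [z $ 1, 0]) + (z $ 2)\<^sup>2" if z: "z \<in> open_square r" for z
  proof -
    have LR: "L z \<in> ?R1" using LV1 K(3) r(2) z by blast
    then have LR0: "L z \<in> ?R" using R1R by blast
    have KL: "K (L z) = z" using L(3) r(2) z by blast
    have 1: "L z $ 1 = z $ 1" using arg_cong[OF KL, of "\<lambda>v. v $ 1"] by (simp add: K_def)
    have "L z $ 2 * sqrt (\<alpha> (L z)) = z $ 2" using arg_cong[OF KL, of "\<lambda>v. v $ 2"] by (simp add: K_def)
    then have "(L z $ 2)\<^sup>2 * (sqrt (\<alpha> (L z)))\<^sup>2 = (z $ 2)\<^sup>2" by (metis power_mult_distrib)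
    then have "(L z $ 2)\<^sup>2 * \<alpha> (L z) = (z $ 2)\<^sup>2" using \<alpha>pos[OF LR] by simp
    then show ?thesis
      using F\<alpha>[OF LR0] PQ(1)[OF LR0] 1 by (simp add: \<Theta>_def F_def)
  qed
  ultimately show ?thesis
    using r(1) d\<Theta> \<open>Q ` L ` open_square r \<subseteq> S\<close> smooth_on_subset[OF sF r(3)] Q0 L0
    by (intro that[of r \<Theta> "Q ` L ` open_square r" "sqrt 2" F]) (simp_all add: \<Theta>_def)
qed

lemma basis_with_cross3:
  fixes w1 w2 :: "real^3"
  assumes "cross3 w1 w2 \<noteq> 0"
  obtains a1 a2 a3 where
    "w1 \<bullet> a1 = 1" "w1 \<bullet> a2 = 0" "w1 \<bullet> a3 = 0"
    "w2 \<bullet> a1 = 0" "w2 \<bullet> a2 = 1" "w2 \<bullet> a3 = 0"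
    "cross3 w1 w2 \<bullet> a1 = 0" "cross3 w1 w2 \<bullet> a2 = 0" "cross3 w1 w2 \<bullet> a3 = 1"
    "\<And>q. q = (q \<bullet> a1) *\<^sub>R w1 + (q \<bullet> a2) *\<^sub>R w2 + (q \<bullet> a3) *\<^sub>R cross3 w1 w2"
proof -
  define w3 where "w3 = cross3 w1 w2"
  define d where "d = w3 \<bullet> w3"
  have d: "d > 0" using assms by (simp add: d_def w3_def)
  define a1 where "a1 = cross3 w2 w3 /\<^sub>R d"
  define a2 where "a2 = cross3 w3 w1 /\<^sub>R d"
  define a3 where "a3 = w3 /\<^sub>R d"
  have t: "w1 \<bullet> cross3 w2 w3 = d" "w2 \<bullet> cross3 w3 w1 = d"
    unfolding d_def w3_def by (simp_all add: cross3_def inner_vec_def sum_3 algebra_simps)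
  have z: "w1 \<bullet> w3 = 0" "w2 \<bullet> w3 = 0" "w1 \<bullet> cross3 w3 w1 = 0" "w2 \<bullet> cross3 w2 w3 = 0"
      "w3 \<bullet> cross3 w2 w3 = 0" "w3 \<bullet> cross3 w3 w1 = 0"
    unfolding w3_def by (simp_all add: cross3_def inner_vec_def sum_3 algebra_simps)
  have "d *\<^sub>R q = (q \<bullet> cross3 w2 w3) *\<^sub>R w1 + (q \<bullet> cross3 w3 w1) *\<^sub>R w2 + (q \<bullet> w3) *\<^sub>R w3" for q
    unfolding t(1)[symmetric] unfolding w3_def
    by (simp add: vec_eq_iff forall_3 cross3_def inner_vec_def sum_3) algebra
  then have "q = inverse d *\<^sub>R ((q \<bullet> cross3 w2 w3) *\<^sub>R w1 + (q \<bullet> cross3 w3 w1) *\<^sub>R w2 + (q \<bullet> w3) *\<^sub>R w3)" for q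
    using d by (metis inverse_eq_divide less_numeral_extra(3) scaleR_scaleR left_inverse scaleR_one)
  then have "q = (q \<bullet> a1) *\<^sub>R w1 + (q \<bullet> a2) *\<^sub>R w2 + (q \<bullet> a3) *\<^sub>R w3" for q
    by (simp add: a1_def a2_def a3_def scaleR_add_right)
  then show ?thesis
    using d z t
    by (intro that[of a1 a2 a3]) (simp_all add: a1_def a2_def a3_def d_def w3_def[symmetric])
qed

text \<open>The target coordinates are found by Whitney's theorem: if \<open>\<zeta>\<^sub>v = v \<beta>\<close> and
  \<open>\<beta> = A(u, v\<^sup>2) + v B(u, v\<^sup>2)\<close>, then integration in \<open>v\<close> gives
  \<open>\<zeta> = \<zeta>(u, 0) + v\<^sup>2 A'(u, v\<^sup>2) + v\<^sup>3 B'(u, v\<^sup>2)\<close> with \<open>B'(0) = \<beta>\<^sub>v(0) / 3\<close>, so that \<open>v\<^sup>3\<close> is a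
  smooth function of \<open>u\<close>, \<open>v\<^sup>2\<close> and \<open>\<zeta>\<close>.\<close>

lemma cuspidal_edge_normal_form:
  fixes H :: "real^2 \<Rightarrow> real^3"
  assumes r: "r > 0" and sm: "smooth_on \<zeta> (open_square r)" "smooth_on \<beta> (open_square r)"
      "smooth_on Y (open_square r)"
    and \<zeta>: "\<And>z. z \<in> open_square r \<Longrightarrow> D2 \<zeta> z = z $ 2 * \<beta> z" and \<beta>: "D2 \<beta> 0 \<noteq> 0"
    and w: "cross3 w1 w2 \<noteq> 0"
    and H: "\<And>z. z \<in> open_square r \<Longrightarrow>
      H z = b + z $ 1 *\<^sub>R w1 + (Y (vector [z $ 1, 0]) + (z $ 2)\<^sup>2) *\<^sub>R w2 + \<zeta> z *\<^sub>R cross3 w1 w2"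
  shows "cuspidal_edge_at H 0"
proof -
  obtain a1 a2 a3 where
    a: "w1 \<bullet> a1 = 1" "w1 \<bullet> a2 = 0" "w1 \<bullet> a3 = 0"
    "w2 \<bullet> a1 = 0" "w2 \<bullet> a2 = 1" "w2 \<bullet> a3 = 0"
    "cross3 w1 w2 \<bullet> a1 = 0" "cross3 w1 w2 \<bullet> a2 = 0" "cross3 w1 w2 \<bullet> a3 = 1"
    and exp: "\<And>q. q = (q \<bullet> a1) *\<^sub>R w1 + (q \<bullet> a2) *\<^sub>R w2 + (q \<bullet> a3) *\<^sub>R cross3 w1 w2"
    by (rule basis_with_cross3[OF w], rule that)
  obtain s and A B :: "real^2 \<Rightarrow> real" where s: "0 < s" "s \<le> r" "s \<le> 1"
    and sA: "smooth_on A (open_square s)" and sB: "smooth_on B (open_square s)"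
    and AB: "\<And>z. z \<in> open_square s \<Longrightarrow>
       \<beta> z = A (vector [z $ 1, (z $ 2)\<^sup>2]) + z $ 2 * B (vector [z $ 1, (z $ 2)\<^sup>2])"
    by (rule Whitney_decomposition[OF sm(2) r], rule that)
  have sq_sub: "open_square s' \<subseteq> open_square s''" if "s' \<le> s''" for s' s''
    using that by (auto simp: open_square_def)
  have sq: "vector [z $ 1, (z $ 2)\<^sup>2] \<in> open_square t" if "z \<in> open_square t" "t \<le> 1" for z :: "real^2" and t
  proof -
    have "\<bar>z $ 2\<bar> * \<bar>z $ 2\<bar> \<le> 1 * \<bar>z $ 2\<bar>"
      by (rule mult_right_mono) (use that in \<open>simp_all add: open_square_def\<close>)
    then show ?thesis using that(1) by (simp add: open_square_def power2_eq_square abs_mult)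
  qed
  define A' where "A' = ray_integral 2 1 A"
  define B' where "B' = ray_integral 2 2 B"
  have sA': "smooth_on A' (open_square s)" and sB': "smooth_on B' (open_square s)"
    unfolding A'_def B'_def by (intro smooth_on_ray_integral sA sB)+
  \<comment> \<open>The derivative of \<open>A(u, v\<^sup>2)\<close> in \<open>v\<close> vanishes for \<open>v = 0\<close>.\<close>
  have B0: "B 0 = D2 \<beta> 0"
  proof -
    have 0: "0 \<in> open_square s" using s by simp
    let ?q = "\<lambda>z::real^2. vector [z $ 1, (z $ 2)\<^sup>2] :: real^2"
    have v0: "vector [0, 0] = (0 :: real^2)" by (simp add: vec_eq_iff forall_2)
    then have q0: "?q 0 = 0" by simp
    have q: "(?q has_derivative (\<lambda>h. vector [h $ 1, 0])) (at 0)"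
      by (intro has_derivative_vector2 bounded_linear_imp_has_derivative bounded_linear_vec_nth)
        (rule has_derivative_eq_rhs[OF has_derivative_power[OF bounded_linear_imp_has_derivative[OF bounded_linear_vec_nth]]], simp)
    have dA: "((\<lambda>z. A (?q z)) has_derivative (\<lambda>h. h $ 1 *\<^sub>R D1 A 0)) (at 0)"
      using has_derivative_compose_D1_D2[OF sA _ q] 0 by (simp add: v0)
    have dB: "((\<lambda>z. B (?q z)) has_derivative (\<lambda>h. h $ 1 *\<^sub>R D1 B 0)) (at 0)"
      using has_derivative_compose_D1_D2[OF sB _ q] 0 by (simp add: v0)
    have "((\<lambda>z. A (?q z) + z $ 2 * B (?q z)) has_derivative
        (\<lambda>h. h $ 1 *\<^sub>R D1 A 0 + ((0::real^2) $ 2 * (h $ 1 *\<^sub>R D1 B 0) + h $ 2 * B (?q 0)))) (at 0)"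
      by (intro has_derivative_add dA has_derivative_mult dB bounded_linear_imp_has_derivative bounded_linear_vec_nth)
    then have "((\<lambda>z. A (?q z) + z $ 2 * B (?q z)) has_derivative (\<lambda>h. h $ 1 *\<^sub>R D1 A 0 + h $ 2 *\<^sub>R B 0)) (at 0)"
      by (simp add: v0)
    then have "(\<beta> has_derivative (\<lambda>h. h $ 1 *\<^sub>R D1 A 0 + h $ 2 *\<^sub>R B 0)) (at 0)"
      by (rule has_derivative_transform_within_open[OF _ open_open_square 0]) (simp add: AB)
    from D1_D2_unique(2)[OF this] show ?thesis by simp
  qed
  have "B' 0 \<noteq> 0" using B0 \<beta> by (simp add: B'_def ray_integral_axis)
  have "open {z \<in> open_square s. B' z \<noteq> 0}"
    by (rule open_preimage_nonzero[OF open_open_square sB'])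
  moreover have "0 \<in> {z \<in> open_square s. B' z \<noteq> 0}" using \<open>B' 0 \<noteq> 0\<close> s by simp
  ultimately obtain t0 where t0: "t0 > 0" "open_square t0 \<subseteq> {z \<in> open_square s. B' z \<noteq> 0}"
    by (rule open_contains_open_square)
  define t where "t = min t0 s"
  have t: "t > 0" "t \<le> s" "t \<le> r" "t \<le> 1" using t0(1) s by (auto simp: t_def)
  have B'_nz: "B' z \<noteq> 0" if "z \<in> open_square t" for z
    using t0(2) sq_sub[of t t0] that by (auto simp: t_def)
  have \<zeta>_eq: "\<zeta> z = \<zeta> (vector [z $ 1, 0]) + (z $ 2)\<^sup>2 * A' (vector [z $ 1, (z $ 2)\<^sup>2])
      + (z $ 2) ^ 3 * B' (vector [z $ 1, (z $ 2)\<^sup>2])" if z: "z \<in> open_square t" for z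
  proof -
    have zr: "z \<in> open_square r" and zs: "z \<in> open_square s" using z sq_sub t(2,3) by blast+
    have 1: "\<zeta> z = \<zeta> (vector [z $ 1, 0]) + (z $ 2) ^ (1 + 1) * ray_integral 1 1 \<beta> z"
      by (rule Hadamard_division[OF sm(1) smooth_on_continuous[OF sm(2)] _ zr]) (simp add: \<zeta>)
    have int: "(\<lambda>x. x ^ k * F (vector [z $ 1, x ^ 2 * (z $ 2)\<^sup>2])) integrable_on {0..1}"
      if "smooth_on F (open_square s)" for F :: "real^2 \<Rightarrow> real" and k
    proof (rule integrable_continuous_interval, rule continuous_on_mult)
      show "continuous_on {0..1} (\<lambda>x. F (vector [z $ 1, x ^ 2 * (z $ 2)\<^sup>2]))"
      proof (rule continuous_on_compose2[OF smooth_on_continuous[OF that]])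
        show "(\<lambda>x. vector [z $ 1, x ^ 2 * (z $ 2)\<^sup>2]) ` {0..1} \<subseteq> open_square s"
          using open_square_shrink[OF sq[OF zs s(3)]] by (auto simp: power_le_one)
      qed (intro continuous_intros)
    qed (intro continuous_intros)
    have "ray_integral 1 1 \<beta> z = integral {0..1} (\<lambda>x. x ^ 1 * A (vector [z $ 1, x ^ 2 * (z $ 2)\<^sup>2])
        + z $ 2 * (x ^ 2 * B (vector [z $ 1, x ^ 2 * (z $ 2)\<^sup>2])))"
      unfolding ray_integral_def
    proof (rule integral_cong)
      fix x :: real assume "x \<in> {0..1}"
      then have "vector [z $ 1, x * z $ 2] \<in> open_square s" using open_square_shrink[OF zs] by simp
      from AB[OF this] show "x ^ 1 * \<beta> (vector [z $ 1, x ^ 1 * z $ 2]) =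
          x ^ 1 * A (vector [z $ 1, x ^ 2 * (z $ 2)\<^sup>2]) + z $ 2 * (x ^ 2 * B (vector [z $ 1, x ^ 2 * (z $ 2)\<^sup>2]))"
        by (simp add: power_mult_distrib algebra_simps power2_eq_square)
    qed
    also have "\<dots> = A' (vector [z $ 1, (z $ 2)\<^sup>2]) + z $ 2 * B' (vector [z $ 1, (z $ 2)\<^sup>2])"
      by (subst integral_add[OF int[OF sA] integrable_on_mult_right[OF int[OF sB]]])
        (simp add: A'_def B'_def ray_integral_def)
    finally show ?thesis using 1 by (simp add: algebra_simps power2_eq_square power3_eq_cube)
  qed
  \<comment> \<open>The change of coordinates in the target, and its inverse.\<close>
  define X3 where "X3 = (\<lambda>q::real^3. (q - b) \<bullet> a1)"
  define Y3 where "Y3 = (\<lambda>q::real^3. (q - b) \<bullet> a2 - Y (vector [X3 q, 0]))"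
  define Z3 where "Z3 = (\<lambda>q::real^3. (q - b) \<bullet> a3)"
  define P where "P = (\<lambda>q. vector [X3 q, Y3 q] :: real^2)"
  define \<Phi> where "\<Phi> = (\<lambda>q. vector [X3 q, Y3 q,
      (Z3 q - \<zeta> (vector [X3 q, 0]) - Y3 q * A' (P q)) / B' (P q)] :: real^3)"
  define \<Psi> where "\<Psi> = (\<lambda>q::real^3. b + q $ 1 *\<^sub>R w1 + (q $ 2 + Y (vector [q $ 1, 0])) *\<^sub>R w2
      + (q $ 3 * B' (vector [q $ 1, q $ 2]) + \<zeta> (vector [q $ 1, 0])
         + q $ 2 * A' (vector [q $ 1, q $ 2])) *\<^sub>R cross3 w1 w2)"
  define G where "G = {q. \<bar>X3 q\<bar> < t}"
  define U where "U = {q \<in> G. \<bar>Y3 q\<bar> < t}"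
  define W where "W = {q::real^3. \<bar>q $ 1\<bar> < t \<and> \<bar>q $ 2\<bar> < t}"
  have axis: "vector [x, 0] \<in> open_square r" if "\<bar>x\<bar> < t" for x
    using that t r by (simp add: open_square_def)
  have oG: "open G" unfolding G_def X3_def by (intro open_Collect_less continuous_intros)
  have sX: "smooth_on X3 S" and sZ: "smooth_on Z3 S" if "open S" for S
    unfolding X3_def Z3_def by (intro smooth_intros that)+
  have sYG: "smooth_on Y3 G"
    unfolding Y3_def
    by (intro smooth_on_diff smooth_on_inner smooth_on_const smooth_on_id oG smooth_on_compose[OF oG sm(3)]
        smooth_on_vector2 sX axis) (simp_all add: G_def)
  have "open (G \<inter> Y3 -` {-t<..<t})"
    by (rule continuous_open_preimage[OF smooth_on_continuous[OF sYG] oG]) simp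
  moreover have "G \<inter> Y3 -` {-t<..<t} = U" by (auto simp: U_def)
  ultimately have oU: "open U" by simp
  have sY: "smooth_on Y3 U" by (rule smooth_on_subset[OF sYG]) (auto simp: U_def)
  have PU: "P q \<in> open_square t" if "q \<in> U" for q
    using that by (simp add: P_def U_def G_def open_square_def)
  have sP: "smooth_on P U" unfolding P_def by (intro smooth_on_vector2 oU sX sY)
  have s\<zeta>: "smooth_on (\<lambda>q. \<zeta> (vector [X3 q, 0])) U"
  proof (rule smooth_on_compose[OF oU sm(1)])
    show "smooth_on (\<lambda>q. vector [X3 q, 0] :: real^2) U"
      by (intro smooth_on_vector2 oU sX smooth_on_const)
  qed (simp add: axis U_def G_def)
  have sFP: "smooth_on (\<lambda>q. F (P q)) U" if "smooth_on F (open_square s)" for F :: "real^2 \<Rightarrow> real"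
    by (rule smooth_on_compose[OF oU that sP]) (use PU sq_sub[OF t(2)] in blast)
  have s\<Phi>: "smooth_on \<Phi> U"
    unfolding \<Phi>_def
    by (intro smooth_on_vector3 smooth_on_divide smooth_on_diff smooth_on_mult oU sX sY sZ s\<zeta> sFP sA' sB')
      (use PU B'_nz in blast)
  have oW: "open W" unfolding W_def by (intro open_Collect_conj open_Collect_less continuous_intros)
  have sW: "smooth_on (\<lambda>q. F (vector [q $ 1, q $ 2])) W" if "smooth_on F (open_square s)" for F :: "real^2 \<Rightarrow> real"
  proof (rule smooth_on_compose[OF oW that])
    show "smooth_on (\<lambda>q::real^3. vector [q $ 1, q $ 2] :: real^2) W"
      by (intro smooth_on_vector2 smooth_on_nth smooth_on_id oW)
  qed (use t(2) in \<open>simp add: W_def open_square_def\<close>)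
  have sWx: "smooth_on (\<lambda>q. F (vector [q $ 1, 0])) W" if "smooth_on F (open_square r)" for F :: "real^2 \<Rightarrow> real"
  proof (rule smooth_on_compose[OF oW that])
    show "smooth_on (\<lambda>q::real^3. vector [q $ 1, 0] :: real^2) W"
      by (intro smooth_on_vector2 smooth_on_nth smooth_on_id smooth_on_const oW)
  qed (simp add: axis W_def)
  have s\<Psi>: "smooth_on \<Psi> W"
    unfolding \<Psi>_def
    by (intro smooth_on_add smooth_on_scaleR smooth_on_mult smooth_on_nth smooth_on_id smooth_on_const oW
        sW sWx sm sA' sB')
  have coords: "X3 (\<Psi> q) = q $ 1" "Y3 (\<Psi> q) = q $ 2"
      "Z3 (\<Psi> q) = q $ 3 * B' (vector [q $ 1, q $ 2]) + \<zeta> (vector [q $ 1, 0]) + q $ 2 * A' (vector [q $ 1, q $ 2])"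
    for q
  proof -
    show X: "X3 (\<Psi> q) = q $ 1" by (simp add: X3_def \<Psi>_def inner_add_left inner_diff_left a)
    show "Z3 (\<Psi> q) = q $ 3 * B' (vector [q $ 1, q $ 2]) + \<zeta> (vector [q $ 1, 0]) + q $ 2 * A' (vector [q $ 1, q $ 2])"
      by (simp add: Z3_def \<Psi>_def inner_add_left inner_diff_left a)
    show "Y3 (\<Psi> q) = q $ 2"
      unfolding Y3_def X by (simp add: \<Psi>_def inner_add_left inner_diff_left a)
  qed
  have \<Psi>U: "\<Psi> q \<in> U" if "q \<in> W" for q
    using that coords[of q] by (simp add: U_def G_def W_def)
  have \<Phi>W: "\<Phi> q \<in> W" if "q \<in> U" for q
    using that by (simp add: U_def G_def W_def \<Phi>_def)
  have \<Psi>\<Phi>: "\<Psi> (\<Phi> q) = q" if q: "q \<in> U" for q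
  proof -
    have nz: "B' (P q) \<noteq> 0" using PU[OF q] B'_nz by blast
    have Pq: "vector [X3 q, Y3 q] = P q" by (simp add: P_def)
    have Yq: "Y3 q + Y (vector [X3 q, 0]) = (q - b) \<bullet> a2" by (simp add: Y3_def)
    have "\<Psi> (\<Phi> q) = b + X3 q *\<^sub>R w1 + ((q - b) \<bullet> a2) *\<^sub>R w2 + Z3 q *\<^sub>R cross3 w1 w2"
      using nz unfolding \<Psi>_def \<Phi>_def by (simp add: Yq Pq)
    also have "\<dots> = b + (q - b)"
      by (subst (3) exp) (simp add: X3_def Z3_def algebra_simps)
    finally show ?thesis by simp
  qed
  have \<Phi>\<Psi>: "\<Phi> (\<Psi> q) = q" if q: "q \<in> W" for q
  proof -
    have "vector [q $ 1, q $ 2] \<in> open_square t" using q by (simp add: W_def open_square_def)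
    then have "B' (vector [q $ 1, q $ 2]) \<noteq> 0" by (rule B'_nz)
    then show ?thesis
      unfolding \<Phi>_def P_def coords by (simp add: vec_eq_iff forall_3)
  qed
  have dPhi: "diffeo_on \<Phi> U W"
    unfolding diffeo_on_def
  proof (intro conjI exI[of _ \<Psi>] ballI)
    show "\<Phi> ` U = W"
    proof
      show "W \<subseteq> \<Phi> ` U"
      proof
        fix q assume q: "q \<in> W"
        show "q \<in> \<Phi> ` U" using imageI[OF \<Psi>U[OF q], of \<Phi>] \<Phi>\<Psi>[OF q] by simp
      qed
    qed (use \<Phi>W in blast)
  qed (simp_all add: oU oW s\<Phi> s\<Psi> \<Psi>\<Phi> \<Phi>\<Psi>)
  have HPsi: "H z = \<Psi> (vector [z $ 1, (z $ 2)\<^sup>2, (z $ 2) ^ 3])" if z: "z \<in> open_square t" for z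
  proof -
    have "z \<in> open_square r" using z sq_sub[OF t(3)] by blast
    then show ?thesis
      using \<zeta>_eq[OF z] by (simp add: H \<Psi>_def algebra_simps)
  qed
  have zW: "vector [z $ 1, (z $ 2)\<^sup>2, (z $ 2) ^ 3] \<in> W" if z: "z \<in> open_square t" for z :: "real^2"
    using sq[OF z t(4)] by (simp add: W_def open_square_def)
  have id: "diffeo_on (\<lambda>z. z) (open_square t) (open_square t)"
    unfolding diffeo_on_def by (auto intro!: smooth_on_id exI[of _ "\<lambda>z. z"])
  have 0: "0 \<in> open_square t" using t by simp
  have v0: "vector [0, 0, 0] = (0 :: real^3)" by (simp add: vec_eq_iff forall_3)
  show ?thesis
    unfolding cuspidal_edge_at_def
  proof (intro exI conjI)
    show "diffeo_on (\<lambda>z::real^2. z) (open_square t) (open_square t)" by (rule id)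
    show "diffeo_on \<Phi> U W" by (rule dPhi)
    show "H 0 \<in> U" using HPsi[OF 0] \<Psi>U[OF zW[OF 0]] by simp
    show "\<Phi> (H 0) = 0" using HPsi[OF 0] \<Phi>\<Psi>[OF zW[OF 0]] v0 by simp
    show "H ` open_square t \<subseteq> U" using HPsi \<Psi>U zW by auto
    show "\<forall>z\<in>open_square t. \<Phi> (H z) = vector [z $ 1, (z $ 2)\<^sup>2, (z $ 2) ^ 3]"
      using HPsi \<Phi>\<Psi> zW by auto
  qed (use 0 in simp_all)
qed

lemma second_derivative_inner:
  assumes "open S" "smooth_on h S" "z0 \<in> S"
  shows "fderiv (\<lambda>z. fderiv (\<lambda>z. (h z - b) \<bullet> a) z v) z0 w =
    fderiv (\<lambda>z. fderiv h z v) z0 w \<bullet> a"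
proof -
  have "((\<lambda>z. fderiv h z v \<bullet> a) has_derivative
      (\<lambda>w. fderiv (\<lambda>z. fderiv h z v) z0 w \<bullet> a)) (at z0)"
    by (intro has_derivative_inner_left smooth_on_has_derivative[OF smooth_on_frechet[OF assms(2)] assms(3)])
  then have "((\<lambda>z. fderiv (\<lambda>z. (h z - b) \<bullet> a) z v) has_derivative
      (\<lambda>w. fderiv (\<lambda>z. fderiv h z v) z0 w \<bullet> a)) (at z0)"
    by (rule has_derivative_transform_within_open[OF _ assms(1,3)])
      (simp add: frechet_derivative_inner[OF assms(2)])
  from fun_cong[OF frechet_derivative_at[OF this]] show ?thesis by simp
qed

text \<open>The components of \<open>h\<close> along \<open>h\<^sub>e\<close> and \<open>h\<^sub>\<eta>\<^sub>\<eta>\<close> form a fold.  In the coordinates of that fold the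
  remaining component \<open>\<zeta>\<close> is tied to them by the normal \<open>N\<close>: orthogonality of \<open>h\<^sub>v\<close> and \<open>N\<close> reads
  \<open>\<zeta>\<^sub>v = v \<beta>\<close> with \<open>\<beta>\<close> a multiple of the quotient of two components of \<open>N\<close>, and \<open>\<beta>\<^sub>v(0) \<noteq> 0\<close> because \<open>N\<close> turns
  along the null direction.\<close>

lemma cuspidal_edge_criterion:
  fixes h N :: "real^2 \<Rightarrow> real^3" and e \<eta> :: "real^2"
  defines "w1 \<equiv> fderiv h 0 e"
    and "w2 \<equiv> fderiv (\<lambda>z. fderiv h z \<eta>) 0 \<eta>"
  assumes oS: "open S" and S0: "0 \<in> S" and h: "smooth_on h S" and N: "smooth_on N S"
    and normal: "\<And>z w. z \<in> S \<Longrightarrow> fderiv h z w \<bullet> N z = 0" and N0: "N 0 \<noteq> 0"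
    and null: "fderiv h 0 \<eta> = 0"
    and indep: "cross3 w1 w2 \<noteq> 0"
    and turn: "fderiv N 0 \<eta> \<bullet> w2 \<noteq> 0"
  shows "cuspidal_edge_at h 0"
proof -
  let ?w3 = "cross3 w1 w2"
  obtain a1 a2 a3 where
    a: "w1 \<bullet> a1 = 1" "w1 \<bullet> a2 = 0" "w1 \<bullet> a3 = 0"
    "w2 \<bullet> a1 = 0" "w2 \<bullet> a2 = 1" "w2 \<bullet> a3 = 0"
    "?w3 \<bullet> a1 = 0" "?w3 \<bullet> a2 = 0" "?w3 \<bullet> a3 = 1"
    and exp: "\<And>q. q = (q \<bullet> a1) *\<^sub>R w1 + (q \<bullet> a2) *\<^sub>R w2 + (q \<bullet> a3) *\<^sub>R ?w3"
    by (rule basis_with_cross3[OF indep], rule that)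
  have N1: "w1 \<bullet> N 0 = 0" using normal[OF S0] by (simp add: w1_def)
  have N2: "w2 \<bullet> N 0 = 0"
  proof -
    have "((\<lambda>z. fderiv h z \<eta> \<bullet> N z) has_derivative
        (\<lambda>w. fderiv h 0 \<eta> \<bullet> fderiv N 0 w
           + fderiv (\<lambda>z. fderiv h z \<eta>) 0 w \<bullet> N 0)) (at 0)"
      by (intro has_derivative_inner smooth_on_has_derivative[OF N S0]
          smooth_on_has_derivative[OF smooth_on_frechet[OF h] S0])
    then have "((\<lambda>z. 0) has_derivative
        (\<lambda>w. fderiv h 0 \<eta> \<bullet> fderiv N 0 w
           + fderiv (\<lambda>z. fderiv h z \<eta>) 0 w \<bullet> N 0)) (at (0::real^2))"
      by (rule has_derivative_transform_within_open[OF _ oS S0]) (simp add: normal)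
    from fun_cong[OF frechet_derivative_at[OF this], of \<eta>] show ?thesis
      by (simp add: null w2_def)
  qed
  have N3: "?w3 \<bullet> N 0 \<noteq> 0"
  proof
    assume "?w3 \<bullet> N 0 = 0"
    then have "((N 0 \<bullet> a1) *\<^sub>R w1 + (N 0 \<bullet> a2) *\<^sub>R w2 + (N 0 \<bullet> a3) *\<^sub>R ?w3) \<bullet> N 0 = 0"
      using N1 N2 by (simp add: inner_add_left)
    then have "N 0 \<bullet> N 0 = 0" unfolding exp[of "N 0", symmetric] .
    then show False using N0 by simp
  qed
  define S' where "S' = {z \<in> S. ?w3 \<bullet> N z \<noteq> 0}"
  have oS': "open S'"
    unfolding S'_def by (rule open_preimage_nonzero[OF oS smooth_on_inner[OF oS smooth_on_const[OF oS] N]])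
  have S'S: "S' \<subseteq> S" and S'0: "0 \<in> S'" using S0 N3 by (auto simp: S'_def)
  note h' = smooth_on_subset[OF h S'S] and N' = smooth_on_subset[OF N S'S]
  have sc: "smooth_on (\<lambda>z. (h z - h 0) \<bullet> a) S'" for a
    by (intro smooth_on_inner smooth_on_diff h' smooth_on_const oS')
  note fi = frechet_derivative_inner[OF h' S'0] second_derivative_inner[OF oS' h' S'0]
  obtain r k :: real and \<Theta> V and Y :: "real^2 \<Rightarrow> real" where r: "r > 0"
    and d\<Theta>: "diffeo_on \<Theta> (open_square r) V" and VS: "V \<subseteq> S'" and \<Theta>0: "\<Theta> 0 = 0"
    and D2\<Theta>: "D2 \<Theta> 0 = k *\<^sub>R \<eta>" and k: "k \<noteq> 0" and sY: "smooth_on Y (open_square r)"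
    and xy: "\<And>z. z \<in> open_square r \<Longrightarrow> (h (\<Theta> z) - h 0) \<bullet> a1 = z $ 1"
      "\<And>z. z \<in> open_square r \<Longrightarrow> (h (\<Theta> z) - h 0) \<bullet> a2 = Y (vector [z $ 1, 0]) + (z $ 2)\<^sup>2"
    by (rule fold_coordinates[OF oS' S'0 sc[of a1] sc[of a2], of e \<eta>])
      (simp_all add: fi null a w1_def[symmetric] w2_def[symmetric], rule that)
  let ?R = "open_square r"
  have 0: "0 \<in> ?R" using r by simp
  have s\<Theta>: "smooth_on \<Theta> ?R" and \<Theta>S: "\<And>z. z \<in> ?R \<Longrightarrow> \<Theta> z \<in> S'"
    using d\<Theta> VS by (auto simp: diffeo_on_def)
  define H where "H = (\<lambda>z. h (\<Theta> z))"
  have sH: "smooth_on H ?R"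
    unfolding H_def by (rule smooth_on_compose[OF open_open_square h' s\<Theta> \<Theta>S])
  have sN\<Theta>: "smooth_on (\<lambda>z. N (\<Theta> z)) ?R"
    by (rule smooth_on_compose[OF open_open_square N' s\<Theta> \<Theta>S])
  define \<zeta> where "\<zeta> = (\<lambda>z. (H z - h 0) \<bullet> a3)"
  define \<beta> where "\<beta> = (\<lambda>z. - 2 * (w2 \<bullet> N (\<Theta> z)) / (?w3 \<bullet> N (\<Theta> z)))"
  have s\<zeta>: "smooth_on \<zeta> ?R"
    unfolding \<zeta>_def by (intro smooth_on_inner smooth_on_diff sH smooth_on_const open_open_square)
  have nz: "?w3 \<bullet> N (\<Theta> z) \<noteq> 0" if "z \<in> ?R" for z using \<Theta>S[OF that] by (simp add: S'_def)
  have s\<beta>: "smooth_on \<beta> ?R"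
    unfolding \<beta>_def
    by (intro smooth_on_divide smooth_on_mult smooth_on_inner sN\<Theta> smooth_on_const open_open_square nz)
  have H_eq: "H z = h 0 + z $ 1 *\<^sub>R w1 + (Y (vector [z $ 1, 0]) + (z $ 2)\<^sup>2) *\<^sub>R w2 + \<zeta> z *\<^sub>R ?w3"
    if z: "z \<in> ?R" for z
    using exp[of "H z - h 0"] xy[OF z] by (simp add: H_def \<zeta>_def algebra_simps)
  have D2\<zeta>: "D2 \<zeta> z = z $ 2 * \<beta> z" if z: "z \<in> ?R" for z
  proof -
    have Dc: "D2 (\<lambda>z. (H z - h 0) \<bullet> a) z = D2 H z \<bullet> a" for a
      unfolding D2_def by (rule frechet_derivative_inner[OF sH z])
    have "D2 H z \<bullet> a1 = 0"
    proof -
      have "((\<lambda>z::real^2. z $ 1) has_derivative (\<lambda>w. w $ 1 *\<^sub>R 1 + w $ 2 *\<^sub>R 0)) (at z)"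
        using bounded_linear_imp_has_derivative[OF bounded_linear_vec_nth] by simp
      then have "((\<lambda>z. (H z - h 0) \<bullet> a1) has_derivative (\<lambda>w. w $ 1 *\<^sub>R 1 + w $ 2 *\<^sub>R 0)) (at z)"
        by (rule has_derivative_transform_within_open[OF _ open_open_square z]) (simp add: xy H_def)
      from D1_D2_unique(2)[OF this] show ?thesis unfolding Dc .
    qed
    moreover have "D2 H z \<bullet> a2 = 2 * z $ 2"
    proof -
      let ?p = "\<lambda>z::real^2. vector [z $ 1, 0] :: real^2"
      have p: "(?p has_derivative ?p) (at z)"
        by (intro has_derivative_vector2 bounded_linear_imp_has_derivative bounded_linear_vec_nth bounded_linear_zero)
      have pz: "?p z \<in> ?R" using z r by (simp add: open_square_def)
      have "((\<lambda>z. Y (?p z)) has_derivative (\<lambda>w. w $ 1 *\<^sub>R D1 Y (?p z) + 0 *\<^sub>R D2 Y (?p z))) (at z)"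
        using has_derivative_compose_D1_D2[OF sY pz p] by simp
      moreover have "((\<lambda>z::real^2. (z $ 2)\<^sup>2) has_derivative (\<lambda>w. 2 * (w $ 2 * z $ 2))) (at z)"
        by (rule has_derivative_eq_rhs[OF has_derivative_power[OF bounded_linear_imp_has_derivative[OF bounded_linear_vec_nth]]])
          (simp add: fun_eq_iff algebra_simps)
      ultimately have "((\<lambda>z. Y (?p z) + (z $ 2)\<^sup>2) has_derivative
          (\<lambda>w. (w $ 1 *\<^sub>R D1 Y (?p z) + 0 *\<^sub>R D2 Y (?p z)) + 2 * (w $ 2 * z $ 2))) (at z)"
        by (rule has_derivative_add)
      then have "((\<lambda>z. Y (?p z) + (z $ 2)\<^sup>2) has_derivative
          (\<lambda>w. w $ 1 *\<^sub>R D1 Y (?p z) + w $ 2 *\<^sub>R (2 * z $ 2))) (at z)"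
        by (rule has_derivative_eq_rhs) (simp add: fun_eq_iff)
      then have "((\<lambda>z. (H z - h 0) \<bullet> a2) has_derivative
          (\<lambda>w. w $ 1 *\<^sub>R D1 Y (?p z) + w $ 2 *\<^sub>R (2 * z $ 2))) (at z)"
        by (rule has_derivative_transform_within_open[OF _ open_open_square z]) (simp add: xy H_def)
      from D1_D2_unique(2)[OF this] show ?thesis unfolding Dc .
    qed
    moreover have "D2 H z \<bullet> a3 = D2 \<zeta> z" unfolding \<zeta>_def Dc ..
    ultimately have "D2 H z = (2 * z $ 2) *\<^sub>R w2 + D2 \<zeta> z *\<^sub>R ?w3"
      using exp[of "D2 H z"] by simp
    moreover have "D2 H z \<bullet> N (\<Theta> z) = 0"
      unfolding H_def D2_compose[OF h' s\<Theta> z \<Theta>S[OF z]]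
      by (rule normal) (use \<Theta>S[OF z] S'S in blast)
    ultimately have "2 * z $ 2 * (w2 \<bullet> N (\<Theta> z)) + D2 \<zeta> z * (?w3 \<bullet> N (\<Theta> z)) = 0"
      by (simp add: inner_add_left)
    then show ?thesis using nz[OF z] by (simp add: \<beta>_def field_simps)
  qed
  have D2\<beta>: "D2 \<beta> 0 \<noteq> 0"
  proof -
    let ?p = "\<lambda>z. - 2 * (w2 \<bullet> N (\<Theta> z))" and ?q = "\<lambda>z. ?w3 \<bullet> N (\<Theta> z)"
    have sp: "smooth_on ?p ?R" and sq: "smooth_on ?q ?R"
      by (intro smooth_on_mult smooth_on_inner sN\<Theta> smooth_on_const open_open_square)+
    have "(\<beta> has_derivative (\<lambda>w. - ?p 0 * (inverse (?q 0) * fderiv ?q 0 w * inverse (?q 0))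
        + fderiv ?p 0 w / ?q 0)) (at 0)"
      unfolding \<beta>_def
      by (rule has_derivative_divide[OF smooth_on_has_derivative[OF sp 0] smooth_on_has_derivative[OF sq 0] nz[OF 0]])
    from fun_cong[OF frechet_derivative_at[OF this], of "axis 2 1"]
    have "D2 \<beta> 0 = D2 ?p 0 / ?q 0"
      by (simp add: D2_def \<Theta>0 N2)
    moreover have "D2 ?p 0 = - 2 * (w2 \<bullet> (k *\<^sub>R fderiv N 0 \<eta>))"
    proof -
      have l: "linear (fderiv N 0)"
        by (rule has_derivative_linear[OF smooth_on_has_derivative[OF N S0]])
      have "(?p has_derivative (\<lambda>w. - 2 * (w2 \<bullet> fderiv (\<lambda>z. N (\<Theta> z)) 0 w))) (at 0)"
        by (intro has_derivative_mult_right has_derivative_inner_right smooth_on_has_derivative[OF sN\<Theta> 0])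
      from fun_cong[OF frechet_derivative_at[OF this], of "axis 2 1"]
      have "D2 ?p 0 = - 2 * (w2 \<bullet> D2 (\<lambda>z. N (\<Theta> z)) 0)" by (simp add: D2_def)
      also have "D2 (\<lambda>z. N (\<Theta> z)) 0 = k *\<^sub>R fderiv N 0 \<eta>"
        using D2_compose[OF N' s\<Theta> 0 \<Theta>S[OF 0]] by (simp add: \<Theta>0 D2\<Theta> linear_cmul[OF l])
      finally show ?thesis .
    qed
    ultimately show ?thesis using turn k nz[OF 0] by (simp add: inner_commute)
  qed
  have "cuspidal_edge_at H 0"
    by (rule cuspidal_edge_normal_form[OF r s\<zeta> s\<beta> sY D2\<zeta> D2\<beta> indep H_eq])
  then have "cuspidal_edge_at h (\<Theta> 0)"
    using cuspidal_edge_at_transfer[OF d\<Theta> 0, of h H] by (simp add: H_def)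
  then show ?thesis by (simp add: \<Theta>0)
qed

lemma frechet_compose_smooth:
  assumes "open U" "z \<in> U" "\<And>y. y \<in> U \<Longrightarrow> h y = F (m y)" "smooth_on F T" "smooth_on m U" "m z \<in> T"
  shows "fderiv h z w = fderiv F (m z) (fderiv m z w)"
proof -
  have "((\<lambda>y. F (m y)) has_derivative (\<lambda>w. fderiv F (m z) (fderiv m z w))) (at z)"
    using diff_chain_at[OF smooth_on_has_derivative[OF assms(5,2)] smooth_on_has_derivative[OF assms(4,6)]]
    by (simp add: o_def)
  then have "(h has_derivative (\<lambda>w. fderiv F (m z) (fderiv m z w))) (at z)"
    by (rule has_derivative_transform_within_open[OF _ assms(1,2)]) (simp add: assms(3))
  from fun_cong[OF frechet_derivative_at[OF this], of w] show ?thesis by simp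
qed

text \<open>The first derivative in the direction \<open>\<eta>\<close> vanishes at the point, so the second derivative
  of \<open>F\<close> does not enter.\<close>

lemma second_derivative_compose_null:
  fixes m :: "'a::real_normed_vector \<Rightarrow> 'b::euclidean_space"
  assumes U: "open U" "z \<in> U" and h: "\<And>y. y \<in> U \<Longrightarrow> h y = F (m y)" and F: "smooth_on F T"
    and m: "smooth_on m U" "\<And>y. y \<in> U \<Longrightarrow> m y \<in> T"
    and null: "fderiv m z \<eta> = 0"
  shows "fderiv (\<lambda>y. fderiv h y \<eta>) z w =
    fderiv F (m z) (fderiv (\<lambda>y. fderiv m y \<eta>) z w)"
proof -
  let ?M = "\<lambda>y. fderiv m y \<eta>"
  let ?G = "\<lambda>b y. fderiv F (m y) b"
  have sG: "smooth_on (?G b) U" for b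
    by (rule smooth_on_compose[OF U(1) smooth_on_frechet[OF F] m])
  have lin: "linear (fderiv F (m y))" if "y \<in> U" for y
    by (rule has_derivative_linear[OF smooth_on_has_derivative[OF F m(2)[OF that]]])
  have expand: "fderiv F (m y) q = (\<Sum>b\<in>Basis. (q \<bullet> b) *\<^sub>R ?G b y)" if "y \<in> U" for q y
    by (subst euclidean_representation[symmetric, of q])
      (simp add: linear_sum[OF lin[OF that]] linear_cmul[OF lin[OF that]])
  have "((\<lambda>y. \<Sum>b\<in>Basis. (?M y \<bullet> b) *\<^sub>R ?G b y) has_derivative
      (\<lambda>w. \<Sum>b\<in>Basis. (?M z \<bullet> b) *\<^sub>R fderiv (?G b) z w +
         (fderiv ?M z w \<bullet> b) *\<^sub>R ?G b z)) (at z)"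
    by (intro has_derivative_sum has_derivative_scaleR has_derivative_inner_left
        smooth_on_has_derivative[OF smooth_on_frechet[OF m(1)] U(2)] smooth_on_has_derivative[OF sG U(2)])
  then have "((\<lambda>y. \<Sum>b\<in>Basis. (?M y \<bullet> b) *\<^sub>R ?G b y) has_derivative
      (\<lambda>w. fderiv F (m z) (fderiv ?M z w))) (at z)"
    by (rule has_derivative_eq_rhs) (simp only: null expand[OF U(2), symmetric] inner_zero_left scaleR_zero_left add_0)
  then have "((\<lambda>y. fderiv h y \<eta>) has_derivative
      (\<lambda>w. fderiv F (m z) (fderiv ?M z w))) (at z)"
  proof (rule has_derivative_transform_within_open[OF _ U])
    fix y assume y: "y \<in> U"
    show "(\<Sum>b\<in>Basis. (?M y \<bullet> b) *\<^sub>R ?G b y) = fderiv h y \<eta>"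
      unfolding expand[OF y, symmetric]
      by (rule frechet_compose_smooth[where h=h and F=F and m=m and U=U and T=T, symmetric])
        (simp_all add: U(1) y h F m)
  qed
  from fun_cong[OF frechet_derivative_at[OF this], of w] show ?thesis by simp
qed

lemma diffeo_on_frechet_inverse:
  assumes d: "diffeo_on \<theta> W V" and \<phi>: "smooth_on \<phi> V" "\<And>z. z \<in> V \<Longrightarrow> \<theta> (\<phi> z) = z" "\<phi> ` V \<subseteq> W" and z: "z \<in> V"
  shows "fderiv \<theta> (\<phi> z) (fderiv \<phi> z w) = w"
proof -
  have o: "open V" "smooth_on \<theta> W" using d by (auto simp: diffeo_on_def)
  have "fderiv (\<lambda>z. z) z w = fderiv \<theta> (\<phi> z) (fderiv \<phi> z w)"
    by (rule frechet_compose_smooth[where h="\<lambda>z. z" and F=\<theta> and m=\<phi> and U=V and T=W])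
      (use o \<phi> z in \<open>simp_all add: image_subset_iff\<close>)
  then show ?thesis by simp
qed

text \<open>For \<open>(u, v\<^sup>2, v\<^sup>3)\<close> the null direction is \<open>\<partial>\<^sub>v\<close>, and the second derivative in this direction, \<open>(0, 2, 0)\<close>,
  is not a multiple of \<open>(1, 0, 0)\<close>, which spans the image of the first.  Coordinate changes \<open>\<theta>\<close> of the source
  alter it by a multiple of \<open>(1, 0, 0)\<close>, and those of the target transform it linearly.\<close>

lemma cuspidal_edge_imp_fold:
  fixes h :: "real^2 \<Rightarrow> real^3"
  assumes "cuspidal_edge_at h 0"
  obtains \<eta> where "fderiv h 0 \<eta> = 0"
    "fderiv (\<lambda>z. fderiv h z \<eta>) 0 \<eta> \<notin> range (fderiv h 0)"
proof -
  from assms obtain \<phi> :: "real^2 \<Rightarrow> real^2" and V W and \<Phi> :: "real^3 \<Rightarrow> real^3" and A B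
    where \<phi>: "diffeo_on \<phi> V W" "0 \<in> V" "\<phi> 0 = 0"
    and \<Phi>: "diffeo_on \<Phi> A B" "h 0 \<in> A" "\<Phi> (h 0) = 0" "h ` W \<subseteq> A"
    and eq: "\<forall>z\<in>V. \<Phi> (h (\<phi> z)) = vector [z $ 1, (z $ 2)\<^sup>2, (z $ 2) ^ 3]"
    unfolding cuspidal_edge_at_def by (elim exE conjE) (rule that)
  obtain \<theta> where \<theta>: "diffeo_on \<theta> W V" "\<And>z. z \<in> V \<Longrightarrow> \<theta> (\<phi> z) = z" "\<And>y. y \<in> W \<Longrightarrow> \<phi> (\<theta> y) = y"
    by (rule diffeo_on_inverse[OF \<phi>(1)], rule that)
  obtain \<Psi> where \<Psi>: "diffeo_on \<Psi> B A" "\<And>q. q \<in> A \<Longrightarrow> \<Psi> (\<Phi> q) = q" "\<And>q. q \<in> B \<Longrightarrow> \<Phi> (\<Psi> q) = q"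
    by (rule diffeo_on_inverse[OF \<Phi>(1)], rule that)
  have s: "open W" "smooth_on \<theta> W" "\<theta> ` W = V" "smooth_on \<phi> V" "\<phi> ` V = W" "smooth_on \<Psi> B" "smooth_on \<Phi> A" "\<Phi> ` A = B"
    using \<phi>(1) \<theta>(1) \<Psi>(1) \<Phi>(1) by (auto simp: diffeo_on_def)
  have W0: "0 \<in> W" using imageI[OF \<phi>(2), of \<phi>] s(5) \<phi>(3) by simp
  have \<theta>0: "\<theta> 0 = 0" using \<theta>(2)[OF \<phi>(2)] \<phi>(3) by simp
  define m where "m = (\<lambda>y. vector [\<theta> y $ 1, (\<theta> y $ 2)\<^sup>2, (\<theta> y $ 2) ^ 3] :: real^3)"
  have sm: "smooth_on m W"
    unfolding m_def by (intro smooth_on_vector3 smooth_on_power smooth_on_nth s)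
  have \<Phi>m: "\<Phi> (h y) = m y" if "y \<in> W" for y
  proof -
    have "\<theta> y \<in> V" using s(3) that by blast
    from bspec[OF eq this] show ?thesis by (simp add: m_def \<theta>(3)[OF that])
  qed
  have hA: "h y \<in> A" if "y \<in> W" for y using \<Phi>(4) that by blast
  have mB: "m y \<in> B" if "y \<in> W" for y
    using imageI[OF hA[OF that], of \<Phi>] \<Phi>m[OF that] s(8) by simp
  have hm: "h y = \<Psi> (m y)" if "y \<in> W" for y using \<Phi>m[OF that] \<Psi>(2)[OF hA[OF that]] by simp
  let ?d = "\<lambda>f z w. fderiv f z w"
  have dm: "?d m y w = (\<chi> i. if i = 1 then ?d \<theta> y w $ 1 else if i = 2 then 2 * (\<theta> y $ 2 * ?d \<theta> y w $ 2)
      else 3 * ((\<theta> y $ 2)\<^sup>2 * ?d \<theta> y w $ 2))" if y: "y \<in> W" for y w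
  proof -
    have n: "((\<lambda>y. \<theta> y $ i) has_derivative (\<lambda>w. ?d \<theta> y w $ i)) (at y)" for i
      by (rule bounded_linear.has_derivative[OF bounded_linear_vec_nth smooth_on_has_derivative[OF s(2) y]])
    have "(m has_derivative ?d m y) (at y)" by (rule smooth_on_has_derivative[OF sm y])
    then have mi: "((\<lambda>y. m y $ i) has_derivative (\<lambda>w. ?d m y w $ i)) (at y)" for i
      by (rule bounded_linear.has_derivative[OF bounded_linear_vec_nth])
    have p2: "((\<lambda>y. m y $ 2) has_derivative (\<lambda>w. 2 * (\<theta> y $ 2 * ?d \<theta> y w $ 2))) (at y)"
      unfolding m_def vector_3 by (rule has_derivative_eq_rhs[OF has_derivative_power[OF n]]) (simp add: fun_eq_iff)
    have p3: "((\<lambda>y. m y $ 3) has_derivative (\<lambda>w. 3 * ((\<theta> y $ 2)\<^sup>2 * ?d \<theta> y w $ 2))) (at y)"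
      unfolding m_def vector_3 by (rule has_derivative_eq_rhs[OF has_derivative_power[OF n]]) (simp add: fun_eq_iff)
    have p1: "((\<lambda>y. m y $ 1) has_derivative (\<lambda>w. ?d \<theta> y w $ 1)) (at y)"
      unfolding m_def vector_3 by (rule n)
    show ?thesis
      using fun_cong[OF has_derivative_unique[OF mi p1], of w] fun_cong[OF has_derivative_unique[OF mi p2], of w]
        fun_cong[OF has_derivative_unique[OF mi p3], of w]
      by (simp add: vec_eq_iff forall_3)
  qed
  define \<eta> where "\<eta> = ?d \<phi> 0 (axis 2 1)"
  have \<theta>\<eta>: "?d \<theta> 0 \<eta> = axis 2 1"
  proof -
    have "?d \<theta> (\<phi> 0) (?d \<phi> 0 (axis 2 1)) = axis 2 1"
      by (rule diffeo_on_frechet_inverse[where V=V and W=W]) (simp_all add: \<theta>(1,2) s(4,5) \<phi>(2))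
    then show ?thesis by (simp add: \<eta>_def \<phi>(3))
  qed
  have dm0: "?d m 0 w $ 2 = 0" "?d m 0 \<eta> = 0" for w
    unfolding dm[OF W0] by (simp_all add: \<theta>0 \<theta>\<eta> vec_eq_iff axis_def)
  have dh: "?d h 0 w = ?d \<Psi> (m 0) (?d m 0 w)" for w
    by (rule frechet_compose_smooth[where h=h and F=\<Psi> and m=m and U=W and T=B, OF s(1) W0 hm s(6) sm mB[OF W0]])
  have l\<Psi>: "linear (?d \<Psi> (m 0))"
    by (rule has_derivative_linear[OF smooth_on_has_derivative[OF s(6) mB[OF W0]]])
  have inj: "q = q'" if "?d \<Psi> (m 0) q = ?d \<Psi> (m 0) q'" for q q'
  proof -
    have "\<Psi> ` B \<subseteq> A" using \<Psi>(1) by (simp add: diffeo_on_def)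
    have i: "?d \<Phi> (\<Psi> (m 0)) (?d \<Psi> (m 0) q) = q" for q
      by (rule diffeo_on_frechet_inverse[where \<theta>=\<Phi> and \<phi>=\<Psi> and V=B and W=A,
            OF \<Phi>(1) s(6) \<Psi>(3) \<open>\<Psi> ` B \<subseteq> A\<close> mB[OF W0]])
    show ?thesis using arg_cong[OF that, of "?d \<Phi> (\<Psi> (m 0))"] unfolding i .
  qed
  let ?M = "\<lambda>y. ?d m y \<eta>"
  have M2: "?d ?M 0 \<eta> $ 2 = 2"
  proof -
    have a: "((\<lambda>y. \<theta> y $ 2) has_derivative (\<lambda>w. ?d \<theta> 0 w $ 2)) (at 0)"
      by (rule bounded_linear.has_derivative[OF bounded_linear_vec_nth smooth_on_has_derivative[OF s(2) W0]])
    have b: "((\<lambda>y. ?d \<theta> y \<eta> $ 2) has_derivative (\<lambda>w. ?d (\<lambda>y. ?d \<theta> y \<eta>) 0 w $ 2)) (at 0)"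
      by (rule bounded_linear.has_derivative[OF bounded_linear_vec_nth
            smooth_on_has_derivative[OF smooth_on_frechet[OF s(2)] W0]])
    have "((\<lambda>y. 2 * (\<theta> y $ 2 * ?d \<theta> y \<eta> $ 2)) has_derivative
        (\<lambda>w. 2 * (\<theta> 0 $ 2 * ?d (\<lambda>y. ?d \<theta> y \<eta>) 0 w $ 2 + ?d \<theta> 0 w $ 2 * ?d \<theta> 0 \<eta> $ 2))) (at 0)"
      by (intro has_derivative_mult_right has_derivative_mult a b)
    then have 1: "((\<lambda>y. ?M y $ 2) has_derivative
        (\<lambda>w. 2 * (\<theta> 0 $ 2 * ?d (\<lambda>y. ?d \<theta> y \<eta>) 0 w $ 2 + ?d \<theta> 0 w $ 2 * ?d \<theta> 0 \<eta> $ 2))) (at 0)"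
      by (rule has_derivative_transform_within_open[OF _ s(1) W0]) (simp add: dm)
    have 2: "((\<lambda>y. ?M y $ 2) has_derivative (\<lambda>w. ?d ?M 0 w $ 2)) (at 0)"
      by (rule bounded_linear.has_derivative[OF bounded_linear_vec_nth
            smooth_on_has_derivative[OF smooth_on_frechet[OF sm] W0]])
    show ?thesis
      using fun_cong[OF has_derivative_unique[OF 2 1], of \<eta>] by (simp add: \<theta>0 \<theta>\<eta> axis_def)
  qed
  have dd: "?d (\<lambda>z. ?d h z \<eta>) 0 \<eta> = ?d \<Psi> (m 0) (?d ?M 0 \<eta>)"
    by (rule second_derivative_compose_null[where h=h and F=\<Psi> and m=m and U=W and T=B,
          OF s(1) W0 hm s(6) sm mB dm0(2)])
  have "?d (\<lambda>z. ?d h z \<eta>) 0 \<eta> \<notin> range (?d h 0)"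
  proof
    assume "?d (\<lambda>z. ?d h z \<eta>) 0 \<eta> \<in> range (?d h 0)"
    then obtain w where "?d \<Psi> (m 0) (?d ?M 0 \<eta>) = ?d \<Psi> (m 0) (?d m 0 w)"
      unfolding dd dh by (elim rangeE) (rule that)
    from inj[OF this] show False using M2 dm0(1)[of w] by simp
  qed
  moreover have "?d h 0 \<eta> = 0" unfolding dh dm0(2) using linear_0[OF l\<Psi>] .
  ultimately show ?thesis by (intro that[of \<eta>])
qed

section \<open>Symmetry of second derivatives\<close>

text \<open>Integration by parts in \<open>\<integral>\<^sub>0\<^sup>1 G(u, tv) dt\<close>.\<close>

lemma ray_integral_parts:
  assumes G: "smooth_on G (open_square r)" and z: "z \<in> open_square r"
  shows "ray_integral 1 0 G z + z $ 2 * ray_integral 1 1 (D2 G) z = G z"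
proof -
  let ?p = "\<lambda>t. vector [z $ 1, t * z $ 2] :: real^2"
  have p: "?p t \<in> open_square r" if "t \<in> {0..1}" for t
    using open_square_shrink[OF z] that by auto
  have c: "continuous_on {0..1} (\<lambda>t. F (?p t))" if "smooth_on F (open_square r)" for F :: "real^2 \<Rightarrow> real"
    by (rule continuous_on_compose2[OF smooth_on_continuous[OF that]]) (use p in \<open>auto intro!: continuous_intros\<close>)
  have i1: "(\<lambda>t. t ^ 0 * G (?p t)) integrable_on {0..1}"
    and i2: "(\<lambda>t. t ^ 1 * D2 G (?p t)) integrable_on {0..1}"
    by (intro integrable_continuous_interval continuous_on_mult c G smooth_on_D2 continuous_intros)+
  have "((\<lambda>t. t ^ 0 * G (?p t) + z $ 2 * (t ^ 1 * D2 G (?p t))) has_integral 1 * G (?p 1) - 0 * G (?p 0)) {0..1}"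
  proof (rule fundamental_theorem_of_calculus)
    fix t :: real assume t: "t \<in> {0..1}"
    have "((\<lambda>t. G (?p t)) has_derivative
        (\<lambda>h. (vector [0, h * z $ 2]::real^2) $ 1 *\<^sub>R D1 G (?p t) + (vector [0, h * z $ 2]::real^2) $ 2 *\<^sub>R D2 G (?p t))) (at t)"
      by (rule has_derivative_compose_D1_D2[OF G], rule p[OF t]) (auto intro!: derivative_eq_intros)
    then have "((\<lambda>t. G (?p t)) has_derivative (\<lambda>h. h * (z $ 2 * D2 G (?p t)))) (at t)"
      by (rule has_derivative_eq_rhs) (simp add: fun_eq_iff)
    from has_derivative_mult[OF has_derivative_ident this]
    have "((\<lambda>t. t * G (?p t)) has_derivative (\<lambda>h. h *\<^sub>R (t ^ 0 * G (?p t) + z $ 2 * (t ^ 1 * D2 G (?p t))))) (at t)"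
      by (rule has_derivative_eq_rhs) (simp add: fun_eq_iff algebra_simps)
    then show "((\<lambda>t. t * G (?p t)) has_vector_derivative t ^ 0 * G (?p t) + z $ 2 * (t ^ 1 * D2 G (?p t))) (at t within {0..1})"
      unfolding has_vector_derivative_def by (rule has_derivative_at_withinI)
  qed simp
  then have "integral {0..1} (\<lambda>t. t ^ 0 * G (?p t) + z $ 2 * (t ^ 1 * D2 G (?p t))) = G (?p 1)"
    by (simp add: integral_unique)
  moreover have "integral {0..1} (\<lambda>t. t ^ 0 * G (?p t) + z $ 2 * (t ^ 1 * D2 G (?p t))) =
      ray_integral 1 0 G z + z $ 2 * ray_integral 1 1 (D2 G) z"
    by (subst integral_add[OF i1 integrable_on_mult_right[OF i2]]) (simp add: ray_integral_def)
  moreover have "?p 1 = z" by (simp add: vec_eq_iff forall_2)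
  ultimately show ?thesis by simp
qed

text \<open>Both mixed derivatives can be read off \<open>F = F(u, 0) + v \<integral>\<^sub>0\<^sup>1 F\<^sub>v(u, tv) dt\<close>, where they differ by the
  integration by parts above.\<close>

lemma mixed_partials_real:
  fixes F :: "real^2 \<Rightarrow> real"
  assumes F: "smooth_on F (open_square r)" and z: "z \<in> open_square r"
  shows "D2 (D1 F) z = D1 (D2 F) z"
proof -
  let ?S = "open_square r"
  let ?p = "\<lambda>z::real^2. vector [z $ 1, 0] :: real^2"
  let ?G = "D1 (D2 F)"
  have pS: "?p x \<in> ?S" if "x \<in> ?S" for x
    using open_square_shrink[OF that, of 0] by simp
  have p: "(?p has_derivative ?p) (at x)" for x
    by (intro has_derivative_vector2 bounded_linear_imp_has_derivative bounded_linear_vec_nth bounded_linear_zero)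
  have sG: "smooth_on ?G ?S" by (intro smooth_on_D1 smooth_on_D2 F)
  have nth: "((\<lambda>x::real^2. x $ 2) has_derivative (\<lambda>w. w $ 2)) (at x)" for x
    by (rule bounded_linear_imp_has_derivative[OF bounded_linear_vec_nth])
  have eq: "F x = F (?p x) + x $ 2 * ray_integral 1 0 (D2 F) x" if "x \<in> ?S" for x
    using Hadamard_division[OF F smooth_on_continuous[OF smooth_on_D2[OF F]], of 0 x] that by simp
  have D1F: "D1 F x = D1 F (?p x) + x $ 2 * ray_integral 1 0 ?G x" if x: "x \<in> ?S" for x
  proof -
    have "((\<lambda>x. F (?p x) + x $ 2 * ray_integral 1 0 (D2 F) x) has_derivative
        (\<lambda>w. (?p w $ 1 *\<^sub>R D1 F (?p x) + ?p w $ 2 *\<^sub>R D2 F (?p x)) +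
          (x $ 2 * (w $ 1 *\<^sub>R ray_integral 1 0 ?G x + w $ 2 *\<^sub>R ray_integral 1 (0 + 1) (D2 (D2 F)) x)
           + w $ 2 * ray_integral 1 0 (D2 F) x))) (at x)"
      by (intro has_derivative_add has_derivative_mult nth has_derivative_compose_D1_D2[OF F] pS[OF x] p
          has_derivative_ray_integral[OF smooth_on_D2[OF F] x])
    then have "((\<lambda>x. F (?p x) + x $ 2 * ray_integral 1 0 (D2 F) x) has_derivative
        (\<lambda>w. w $ 1 *\<^sub>R (D1 F (?p x) + x $ 2 * ray_integral 1 0 ?G x) + w $ 2 *\<^sub>R
        (x $ 2 * ray_integral 1 1 (D2 (D2 F)) x + ray_integral 1 0 (D2 F) x))) (at x)"
      by (rule has_derivative_eq_rhs) (simp add: fun_eq_iff algebra_simps)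
    then have "(F has_derivative (\<lambda>w. w $ 1 *\<^sub>R (D1 F (?p x) + x $ 2 * ray_integral 1 0 ?G x) + w $ 2 *\<^sub>R
        (x $ 2 * ray_integral 1 1 (D2 (D2 F)) x + ray_integral 1 0 (D2 F) x))) (at x)"
      by (rule has_derivative_transform_within_open[OF _ open_open_square x]) (rule eq[symmetric])
    from D1_D2_unique(1)[OF this] show ?thesis .
  qed
  have "((\<lambda>x. D1 F (?p x) + x $ 2 * ray_integral 1 0 ?G x) has_derivative
      (\<lambda>w. (?p w $ 1 *\<^sub>R D1 (D1 F) (?p z) + ?p w $ 2 *\<^sub>R D2 (D1 F) (?p z)) +
        (z $ 2 * (w $ 1 *\<^sub>R ray_integral 1 0 (D1 ?G) z + w $ 2 *\<^sub>R ray_integral 1 (0 + 1) (D2 ?G) z)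
         + w $ 2 * ray_integral 1 0 ?G z))) (at z)"
    by (intro has_derivative_add has_derivative_mult nth has_derivative_compose_D1_D2[OF smooth_on_D1[OF F]]
        pS[OF z] p has_derivative_ray_integral[OF sG z])
  then have "((\<lambda>x. D1 F (?p x) + x $ 2 * ray_integral 1 0 ?G x) has_derivative
      (\<lambda>w. w $ 1 *\<^sub>R (D1 (D1 F) (?p z) + z $ 2 * ray_integral 1 0 (D1 ?G) z) + w $ 2 *\<^sub>R
      (ray_integral 1 0 ?G z + z $ 2 * ray_integral 1 1 (D2 ?G) z))) (at z)"
    by (rule has_derivative_eq_rhs) (simp add: fun_eq_iff algebra_simps)
  then have "(D1 F has_derivative (\<lambda>w. w $ 1 *\<^sub>R (D1 (D1 F) (?p z) + z $ 2 * ray_integral 1 0 (D1 ?G) z) + w $ 2 *\<^sub>R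
      (ray_integral 1 0 ?G z + z $ 2 * ray_integral 1 1 (D2 ?G) z))) (at z)"
    by (rule has_derivative_transform_within_open[OF _ open_open_square z]) (rule D1F[symmetric])
  from D1_D2_unique(2)[OF this] show ?thesis using ray_integral_parts[OF sG z] by simp
qed

lemma mixed_partials:
  fixes h :: "real^2 \<Rightarrow> 'a::euclidean_space"
  assumes h: "smooth_on h (open_square r)" and z: "z \<in> open_square r"
  shows "D2 (D1 h) z = D1 (D2 h) z"
proof (rule euclidean_eqI)
  fix b :: 'a
  let ?S = "open_square r"
  have dot: "D1 (\<lambda>z. F z \<bullet> b) x = D1 F x \<bullet> b \<and> D2 (\<lambda>z. F z \<bullet> b) x = D2 F x \<bullet> b"
    if "smooth_on F ?S" "x \<in> ?S" for F :: "real^2 \<Rightarrow> 'a" and x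
    using D1_D2_unique[of "\<lambda>z. F z \<bullet> b" "D1 F x \<bullet> b" "D2 F x \<bullet> b" x]
      has_derivative_inner_left[OF has_derivative_D1_D2[OF that], of b]
    by (simp add: inner_add_left)
  have cong: "D1 F z = D1 F' z \<and> D2 F z = D2 F' z" if "smooth_on F ?S" "\<And>x. x \<in> ?S \<Longrightarrow> F x = F' x"
    for F F' :: "real^2 \<Rightarrow> real"
    using D1_D2_unique[OF has_derivative_transform_within_open[OF has_derivative_D1_D2[OF that(1) z] open_open_square z that(2)]]
    by simp
  have s: "smooth_on (\<lambda>z. F z \<bullet> b) ?S" if "smooth_on F ?S" for F :: "real^2 \<Rightarrow> 'a"
    by (intro smooth_on_inner that smooth_on_const open_open_square)
  have "D2 (D1 h) z \<bullet> b = D2 (\<lambda>x. D1 h x \<bullet> b) z" using dot[OF smooth_on_D1[OF h] z] by simp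
  also have "\<dots> = D2 (D1 (\<lambda>x. h x \<bullet> b)) z"
    using cong[OF s[OF smooth_on_D1[OF h]], of "D1 (\<lambda>x. h x \<bullet> b)"] dot[OF h] by simp
  also have "\<dots> = D1 (D2 (\<lambda>x. h x \<bullet> b)) z" by (rule mixed_partials_real[OF s[OF h] z])
  also have "\<dots> = D1 (\<lambda>x. D2 h x \<bullet> b) z"
    using cong[OF s[OF smooth_on_D2[OF h]], of "D2 (\<lambda>x. h x \<bullet> b)"] dot[OF h] by simp
  also have "\<dots> = D1 (D2 h) z \<bullet> b" using dot[OF smooth_on_D2[OF h] z] by simp
  finally show "D2 (D1 h) z \<bullet> b = D1 (D2 h) z \<bullet> b" .
qed

section \<open>Fronts in adapted coordinates\<close>

lemma pd_eq: "pd_u = D1" "pd_v = D2"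
  by (simp_all add: fun_eq_iff pd_u_def pd_v_def D1_def D2_def)

text \<open>Up to a nonzero factor, the Jacobian of the Gauss map, and the numerator of \<open>\<kappa>\<^sub>2\<close> once the
  square root is moved to the denominator.\<close>

definition hatK :: "(real^2 \<Rightarrow> real^3) \<Rightarrow> (real^2 \<Rightarrow> real^3) \<Rightarrow> (real^2 \<Rightarrow> real^3) \<Rightarrow> real^2 \<Rightarrow> real" where
  "hatK g \<psi> n z = hatL g n z * hatN \<psi> n z - z $ 2 * (hatM \<psi> n z)\<^sup>2"

context
  fixes g n \<psi> :: "real^2 \<Rightarrow> real^3" and r :: real
  assumes r: "r > 0"
    and g: "smooth_on g (open_square r)" and n: "smooth_on n (open_square r)"
    and \<psi>: "smooth_on \<psi> (open_square r)"
    and unit: "\<And>z. z \<in> open_square r \<Longrightarrow> n z \<bullet> n z = 1"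
    and normal: "\<And>z w. z \<in> open_square r \<Longrightarrow> fderiv g z w \<bullet> n z = 0"
    and g_v: "\<And>z. z \<in> open_square r \<Longrightarrow> D2 g z = z $ 2 *\<^sub>R \<psi> z"
    and n_eq: "\<And>z. z \<in> open_square r \<Longrightarrow> n z = cross3 (D1 g z) (\<psi> z) /\<^sub>R norm (cross3 (D1 g z) (\<psi> z))"
    and N_pos: "hatN \<psi> n 0 > 0"
begin

lemma origin: "0 \<in> open_square r"
  using r by simp

lemma \<psi>_normal: "z \<in> open_square r \<Longrightarrow> \<psi> z \<bullet> n z = 0"
  by (subst n_eq) (simp_all add: dot_cross_self)

lemma g_u_normal: "z \<in> open_square r \<Longrightarrow> D1 g z \<bullet> n z = 0"
  unfolding D1_def by (rule normal)

lemma cross_nonzero: "z \<in> open_square r \<Longrightarrow> cross3 (D1 g z) (\<psi> z) \<noteq> 0"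
  using unit n_eq by fastforce

lemma frame_orthogonal_zero:
  assumes z: "z \<in> open_square r" and x: "x \<bullet> D1 g z = 0" "x \<bullet> \<psi> z = 0" "x \<bullet> n z = 0"
  shows "x = 0"
proof -
  let ?c = "cross3 (D1 g z) (\<psi> z)"
  obtain a1 a2 a3 where exp: "\<And>q. q = (q \<bullet> a1) *\<^sub>R D1 g z + (q \<bullet> a2) *\<^sub>R \<psi> z + (q \<bullet> a3) *\<^sub>R ?c"
    by (rule basis_with_cross3[OF cross_nonzero[OF z]], rule that)
  have "x \<bullet> ?c = 0" using x(3) cross_nonzero[OF z] unfolding n_eq[OF z] by simp
  then have "x \<bullet> ((x \<bullet> a1) *\<^sub>R D1 g z + (x \<bullet> a2) *\<^sub>R \<psi> z + (x \<bullet> a3) *\<^sub>R ?c) = 0"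
    using x by (simp add: inner_add_right)
  then have "x \<bullet> x = 0" unfolding exp[of x, symmetric] .
  then show ?thesis by simp
qed

lemma dn_tangent:
  assumes z: "z \<in> open_square r"
  shows "fderiv n z w \<bullet> n z = 0"
proof -
  note d = smooth_on_has_derivative[OF n z]
  have "((\<lambda>x. n x \<bullet> n x) has_derivative
      (\<lambda>w. n z \<bullet> fderiv n z w + fderiv n z w \<bullet> n z)) (at z)"
    by (rule has_derivative_inner[OF d d])
  then have "((\<lambda>x. 1) has_derivative
      (\<lambda>w. n z \<bullet> fderiv n z w + fderiv n z w \<bullet> n z)) (at z)"
    by (rule has_derivative_transform_within_open[OF _ open_open_square z]) (rule unit)
  from fun_cong[OF has_derivative_unique[OF this has_derivative_const], of w]
  show ?thesis by (simp add: inner_commute)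
qed

text \<open>The symmetry \<open>\<langle>g\<^sub>u, n\<^sub>v\<rangle> = \<langle>g\<^sub>v, n\<^sub>u\<rangle>\<close> of the second fundamental form, combined with \<open>g\<^sub>v = v \<psi>\<close>.\<close>

lemma g_u_dot_n_v:
  assumes z: "z \<in> open_square r"
  shows "D1 g z \<bullet> D2 n z = - (z $ 2 * hatM \<psi> n z)"
proof -
  note dn = has_derivative_D1_D2[OF n z]
  have "((\<lambda>x. D1 g x \<bullet> n x) has_derivative (\<lambda>w. D1 g z \<bullet> (w $ 1 *\<^sub>R D1 n z + w $ 2 *\<^sub>R D2 n z)
      + (w $ 1 *\<^sub>R D1 (D1 g) z + w $ 2 *\<^sub>R D2 (D1 g) z) \<bullet> n z)) (at z)"
    by (rule has_derivative_inner[OF has_derivative_D1_D2[OF smooth_on_D1[OF g] z] dn])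
  then have "((\<lambda>x. 0) has_derivative (\<lambda>w. D1 g z \<bullet> (w $ 1 *\<^sub>R D1 n z + w $ 2 *\<^sub>R D2 n z)
      + (w $ 1 *\<^sub>R D1 (D1 g) z + w $ 2 *\<^sub>R D2 (D1 g) z) \<bullet> n z)) (at z)"
    by (rule has_derivative_transform_within_open[OF _ open_open_square z]) (rule g_u_normal)
  from fun_cong[OF has_derivative_unique[OF this has_derivative_const], of "axis 2 1"]
  have 1: "D1 g z \<bullet> D2 n z + D2 (D1 g) z \<bullet> n z = 0" by (simp add: axis_def)
  have "((\<lambda>x. D2 g x \<bullet> n x) has_derivative (\<lambda>w. D2 g z \<bullet> (w $ 1 *\<^sub>R D1 n z + w $ 2 *\<^sub>R D2 n z)
      + (w $ 1 *\<^sub>R D1 (D2 g) z + w $ 2 *\<^sub>R D2 (D2 g) z) \<bullet> n z)) (at z)"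
    by (rule has_derivative_inner[OF has_derivative_D1_D2[OF smooth_on_D2[OF g] z] dn])
  then have "((\<lambda>x. 0) has_derivative (\<lambda>w. D2 g z \<bullet> (w $ 1 *\<^sub>R D1 n z + w $ 2 *\<^sub>R D2 n z)
      + (w $ 1 *\<^sub>R D1 (D2 g) z + w $ 2 *\<^sub>R D2 (D2 g) z) \<bullet> n z)) (at z)"
    by (rule has_derivative_transform_within_open[OF _ open_open_square z]) (unfold D2_def, rule normal)
  from fun_cong[OF has_derivative_unique[OF this has_derivative_const], of "axis 1 1"]
  have 2: "D2 g z \<bullet> D1 n z + D1 (D2 g) z \<bullet> n z = 0" by (simp add: axis_def)
  have "D1 g z \<bullet> D2 n z = D2 g z \<bullet> D1 n z"
    using 1 2 mixed_partials[OF g z] by simp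
  then show ?thesis by (simp add: g_v[OF z] hatM_def pd_eq)
qed

lemma smooth_hat:
  shows "smooth_on (hatL g n) (open_square r)" "smooth_on (hatM \<psi> n) (open_square r)"
    "smooth_on (hatN \<psi> n) (open_square r)" "smooth_on (hatK g \<psi> n) (open_square r)"
    "smooth_on (hatE g) (open_square r)" "smooth_on (hatF g \<psi>) (open_square r)" "smooth_on (hatG \<psi>) (open_square r)"
proof -
  show L: "smooth_on (hatL g n) (open_square r)" and M: "smooth_on (hatM \<psi> n) (open_square r)"
    and N: "smooth_on (hatN \<psi> n) (open_square r)"
    unfolding hatL_def hatM_def hatN_def pd_eq
    by (intro smooth_on_minus smooth_on_inner smooth_on_D1 smooth_on_D2 g n \<psi> open_open_square)+
  show "smooth_on (hatK g \<psi> n) (open_square r)"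
    unfolding hatK_def
    by (intro smooth_on_diff smooth_on_mult smooth_on_power smooth_on_nth smooth_on_id L M N open_open_square)
  show "smooth_on (hatE g) (open_square r)" "smooth_on (hatF g \<psi>) (open_square r)" "smooth_on (hatG \<psi>) (open_square r)"
    unfolding hatE_def hatF_def hatG_def pd_eq
    by (intro smooth_on_inner smooth_on_D1 g \<psi> open_open_square)+
qed

text \<open>The differential of the Gauss map against the frame \<open>g\<^sub>u\<close>, \<open>\<psi>\<close> of the tangent planes; the determinant
  of this matrix is \<open>hatK\<close>.\<close>

lemma dn_components:
  assumes z: "z \<in> open_square r"
  shows "fderiv n z w \<bullet> D1 g z = - (w $ 1 * hatL g n z + w $ 2 * (z $ 2 * hatM \<psi> n z))"
    "fderiv n z w \<bullet> \<psi> z = - (w $ 1 * hatM \<psi> n z + w $ 2 * hatN \<psi> n z)"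
proof -
  note e = frechet_derivative_D1_D2[OF n z, of w]
  show "fderiv n z w \<bullet> D1 g z = - (w $ 1 * hatL g n z + w $ 2 * (z $ 2 * hatM \<psi> n z))"
    using g_u_dot_n_v[OF z] by (simp add: e inner_add_left inner_add_right hatL_def pd_eq inner_commute)
  show "fderiv n z w \<bullet> \<psi> z = - (w $ 1 * hatM \<psi> n z + w $ 2 * hatN \<psi> n z)"
    by (simp add: e inner_add_left inner_add_right hatM_def hatN_def pd_eq inner_commute)
qed

text \<open>Along a null direction \<open>\<eta>\<close> of the Gauss map at a parabolic point, the second derivative of the
  Gauss map leaves the image of its first derivative, which is orthogonal to \<open>g\<^sub>u\<close>, exactly when the
  Jacobian has nonzero derivative along \<open>\<eta>\<close>.\<close>

lemma second_derivative_dot_g_u: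
  assumes null: "fderiv n 0 \<eta> = 0" and L0: "hatL g n 0 = 0"
  shows "hatN \<psi> n 0 * (fderiv (\<lambda>z. fderiv n z \<eta>) 0 \<eta> \<bullet> D1 g 0) =
    - (\<eta> $ 1 * fderiv (hatK g \<psi> n) 0 \<eta>)"
proof -
  let ?R = "open_square r"
  let ?d = "\<lambda>f w. fderiv f (0::real^2) w"
  let ?W = "?d (\<lambda>z. fderiv n z \<eta>)"
  let ?L = "hatL g n" and ?M = "hatM \<psi> n" and ?N = "hatN \<psi> n"
  note hd = smooth_on_has_derivative[OF _ origin]
  note nth = bounded_linear_imp_has_derivative[OF bounded_linear_vec_nth, of 2 "at (0::real^2)"]
  have "((\<lambda>z. fderiv n z \<eta> \<bullet> D1 g z) has_derivative
      (\<lambda>w. fderiv n 0 \<eta> \<bullet> ?d (D1 g) w + ?W w \<bullet> D1 g 0)) (at 0)"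
    by (intro has_derivative_inner hd[OF smooth_on_frechet[OF n]] hd[OF smooth_on_D1[OF g]])
  moreover have "((\<lambda>z. fderiv n z \<eta> \<bullet> D1 g z) has_derivative
      (\<lambda>w. - (\<eta> $ 1 * ?d ?L w + \<eta> $ 2 * ((0::real^2) $ 2 * ?d ?M w + w $ 2 * ?M 0)))) (at 0)"
  proof (rule has_derivative_transform_within_open[OF _ open_open_square origin])
    show "((\<lambda>z. - (\<eta> $ 1 * ?L z + \<eta> $ 2 * (z $ 2 * ?M z))) has_derivative
      (\<lambda>w. - (\<eta> $ 1 * ?d ?L w + \<eta> $ 2 * ((0::real^2) $ 2 * ?d ?M w + w $ 2 * ?M 0)))) (at 0)"
      by (intro has_derivative_minus has_derivative_add has_derivative_mult_right
          has_derivative_mult[OF nth] hd[OF smooth_hat(1)] hd[OF smooth_hat(2)])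
  qed (rule dn_components(1)[symmetric])
  ultimately have "(\<lambda>w. fderiv n 0 \<eta> \<bullet> ?d (D1 g) w + ?W w \<bullet> D1 g 0) =
      (\<lambda>w. - (\<eta> $ 1 * ?d ?L w + \<eta> $ 2 * ((0::real^2) $ 2 * ?d ?M w + w $ 2 * ?M 0)))"
    by (rule has_derivative_unique)
  from fun_cong[OF this, of \<eta>]
  have W: "?W \<eta> \<bullet> D1 g 0 = - (\<eta> $ 1 * ?d ?L \<eta> + \<eta> $ 2 * (\<eta> $ 2 * ?M 0))"
    by (simp add: null)
  have "(hatK g \<psi> n has_derivative (\<lambda>w. (?L 0 * ?d ?N w + ?d ?L w * ?N 0) -
      ((0::real^2) $ 2 * ?d (\<lambda>z. (?M z)\<^sup>2) w + w $ 2 * (?M 0)\<^sup>2))) (at 0)"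
    unfolding hatK_def
    by (intro has_derivative_diff has_derivative_mult nth hd[OF smooth_hat(1)] hd[OF smooth_hat(3)]
        hd[OF smooth_on_power[OF open_open_square smooth_hat(2)]])
  from fun_cong[OF frechet_derivative_at[OF this], of \<eta>]
  have K: "?d (hatK g \<psi> n) \<eta> = ?d ?L \<eta> * ?N 0 - \<eta> $ 2 * (?M 0)\<^sup>2" by (simp add: L0)
  have "\<eta> $ 1 * ?M 0 + \<eta> $ 2 * ?N 0 = 0"
    using dn_components(2)[OF origin, of \<eta>] by (simp add: null)
  then have "\<eta> $ 2 * ?N 0 = - (\<eta> $ 1 * ?M 0)" by simp
  from arg_cong[OF this, of "\<lambda>x. \<eta> $ 2 * ?M 0 * x"]
  have "\<eta> $ 2 * (\<eta> $ 2 * ?M 0) * ?N 0 = - (\<eta> $ 1 * (\<eta> $ 2 * (?M 0)\<^sup>2))"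
    by (simp add: power2_eq_square algebra_simps)
  then show ?thesis unfolding W K by (simp add: algebra_simps)
qed

text \<open>Off the axis \<open>(A - B)(A + B) = 4 v (E G - F\<^sup>2) K\<close>, so that \<open>\<kappa>\<^sub>2 = 2 K / (A + B)\<close>, and this
  formula makes sense on the axis, where \<open>A = B = E N > 0\<close>.\<close>

lemma kappa2_near_origin:
  obtains S D where "open S" "0 \<in> S" "smooth_on D S" "D 0 > 0"
    "\<And>z. z \<in> S \<Longrightarrow> kappa2 g \<psi> n z = hatK g \<psi> n z / D z" "S \<subseteq> open_square r"
proof -
  let ?R = "open_square r"
  let ?A = "hatA g \<psi> n" and ?K = "hatK g \<psi> n"
  define W where "W = (\<lambda>z. hatE g z * hatG \<psi> z - (hatF g \<psi> z)\<^sup>2)"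
  define Q where "Q = (\<lambda>z. (?A z)\<^sup>2 - 4 * z $ 2 * W z * ?K z)"
  have B: "hatB g \<psi> n z = sqrt (Q z)" for z by (simp add: hatB_def Q_def W_def hatK_def)
  have sA: "smooth_on ?A ?R"
    unfolding hatA_def
    by (intro smooth_on_add smooth_on_diff smooth_on_mult smooth_on_nth smooth_on_id smooth_on_const
        smooth_hat open_open_square)
  have sQ: "smooth_on Q ?R"
    unfolding Q_def W_def
    by (intro smooth_on_diff smooth_on_mult smooth_on_power smooth_on_nth smooth_on_id smooth_on_const
        sA smooth_hat open_open_square)
  have Wpos: "W z > 0" if "z \<in> ?R" for z
  proof -
    have "W z = cross3 (D1 g z) (\<psi> z) \<bullet> cross3 (D1 g z) (\<psi> z)"
      by (simp add: W_def hatE_def hatG_def hatF_def pd_eq dot_cross inner_commute power2_eq_square)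
    then show ?thesis using cross_nonzero[OF that] by simp
  qed
  have A0: "?A 0 > 0"
  proof -
    have "D1 g 0 \<noteq> 0" using cross_nonzero[OF origin] by auto
    then have "hatE g 0 > 0" by (simp add: hatE_def pd_eq)
    then show ?thesis using N_pos by (simp add: hatA_def)
  qed
  have Q0: "Q 0 = (?A 0)\<^sup>2" by (simp add: Q_def)
  define S where "S = {z \<in> ?R. ?A z > 0} \<inter> {z \<in> ?R. Q z > 0}"
  have oS: "open S" unfolding S_def by (intro open_Int open_preimage_pos sA sQ open_open_square)
  have S0: "0 \<in> S" using A0 Q0 origin by (simp add: S_def)
  have SR: "S \<subseteq> ?R" by (auto simp: S_def)
  define D where "D = (\<lambda>z. (?A z + sqrt (Q z)) / 2)"
  have sD: "smooth_on D S"
    unfolding D_def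
    by (intro smooth_on_divide smooth_on_add smooth_on_sqrt smooth_on_const oS
        smooth_on_subset[OF sA SR] smooth_on_subset[OF sQ SR]) (simp_all add: S_def)
  have Dpos: "D z > 0" if "z \<in> S" for z using that by (simp add: D_def S_def add_pos_pos)
  have off: "kappa2_off g \<psi> n z = ?K z / D z" if z: "z \<in> S" "z $ 2 \<noteq> 0" for z
  proof -
    have "(?A z - sqrt (Q z)) * (?A z + sqrt (Q z)) = (?A z)\<^sup>2 - Q z"
      using z(1) by (simp add: S_def algebra_simps power2_eq_square)
    moreover have "(?A z)\<^sup>2 - Q z = 4 * z $ 2 * W z * ?K z" by (simp add: Q_def)
    moreover have "2 * D z = ?A z + sqrt (Q z)" by (simp add: D_def)
    ultimately have "(?A z - sqrt (Q z)) * (2 * D z) = 4 * z $ 2 * W z * ?K z"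
      by (simp only:)
    moreover have "z $ 2 * W z \<noteq> 0" using Wpos[of z] z SR by force
    ultimately have "(?A z - sqrt (Q z)) / (2 * z $ 2 * W z) = ?K z / D z"
      using Dpos[OF z(1)] by (simp add: divide_simps) (simp add: algebra_simps)
    then show ?thesis by (simp add: kappa2_off_def B W_def)
  qed
  have "continuous_on S (\<lambda>z. ?K z / D z)"
    by (intro smooth_on_continuous smooth_on_divide oS smooth_on_subset[OF smooth_hat(4) SR] sD)
      (use Dpos in force)
  then have cont: "isCont (\<lambda>z. ?K z / D z) z" if "z \<in> S" for z
    using that oS continuous_on_eq_continuous_at by blast
  have "kappa2 g \<psi> n z = ?K z / D z" if z: "z \<in> S" for z
  proof (cases "z $ 2 = 0")
    case False
    then show ?thesis using off[OF z] by (simp add: kappa2_def)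
  next
    case True
    let ?F = "at z within {w::real^2. w $ 2 \<noteq> 0}"
    have "z islimpt {w. w $ 2 \<noteq> 0}"
      unfolding islimpt_approachable
    proof (intro allI impI)
      fix e :: real assume e: "e > 0"
      have "(z + (e / 2) *\<^sub>R axis 2 1) $ 2 \<noteq> 0" using e True by (simp add: axis_def)
      moreover have "dist (z + (e / 2) *\<^sub>R axis 2 1) z < e" using e by (simp add: dist_norm)
      ultimately show "\<exists>x'\<in>{w. w $ 2 \<noteq> 0}. x' \<noteq> z \<and> dist x' z < e"
        using True by (intro bexI[of _ "z + (e / 2) *\<^sub>R axis 2 1"]) auto
    qed
    then have nt: "?F \<noteq> bot" by (simp add: trivial_limit_within)
    have "eventually (\<lambda>w. w \<in> S) (at z within {w. w $ 2 \<noteq> 0})"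
      using oS z by (meson UNIV_I eventually_at_topological)
    moreover have "eventually (\<lambda>w. w $ 2 \<noteq> 0) ?F"
      by (simp add: eventually_at_filter)
    ultimately have ev: "eventually (\<lambda>w. ?K w / D w = kappa2_off g \<psi> n w) ?F"
      by eventually_elim (simp add: off)
    have "((\<lambda>w. ?K w / D w) \<longlongrightarrow> ?K z / D z) ?F"
      using cont[OF z] by (simp add: isCont_def tendsto_within_subset[OF _ subset_UNIV])
    then have "(kappa2_off g \<psi> n \<longlongrightarrow> ?K z / D z) ?F"
      by (rule Lim_transform_eventually[OF _ ev])
    then show ?thesis using True tendsto_Lim[OF nt] by (simp add: kappa2_def)
  qed
  then show ?thesis using that[OF oS S0 sD Dpos[OF S0] _ SR] by blast
qed

lemma kappa2_zero_iff: "kappa2 g \<psi> n 0 = 0 \<longleftrightarrow> hatL g n 0 = 0"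
proof -
  obtain S D where "open S" "0 \<in> S" "smooth_on D S" "D 0 > 0"
    "\<And>z. z \<in> S \<Longrightarrow> kappa2 g \<psi> n z = hatK g \<psi> n z / D z" "S \<subseteq> open_square r"
    by (rule kappa2_near_origin, rule that)
  then show ?thesis using N_pos by (simp add: hatK_def)
qed

text \<open>Where \<open>K = 0\<close>, the derivative of \<open>\<kappa>\<^sub>2 = K / D\<close> is that of \<open>K\<close> divided by \<open>D\<close>.\<close>

lemma ridge_point_iff:
  assumes L0: "hatL g n 0 = 0"
  shows "ridge_point g \<psi> n 0 \<longleftrightarrow>
    fderiv (hatK g \<psi> n) 0 (vector [hatN \<psi> n 0, - hatM \<psi> n 0]) = 0"
proof -
  obtain S D where S: "open S" "0 \<in> S" and D: "smooth_on D S" "D 0 > 0"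
    and \<kappa>: "\<And>z. z \<in> S \<Longrightarrow> kappa2 g \<psi> n z = hatK g \<psi> n z / D z" and SR: "S \<subseteq> open_square r"
    by (rule kappa2_near_origin, rule that)
  let ?K = "hatK g \<psi> n"
  have K0: "?K 0 = 0" by (simp add: hatK_def L0)
  have "((\<lambda>z. ?K z / D z) has_derivative (\<lambda>w. - ?K 0 * (inverse (D 0) * fderiv D 0 w * inverse (D 0))
        + fderiv ?K 0 w / D 0)) (at 0)"
    by (rule has_derivative_divide[OF smooth_on_has_derivative[OF smooth_hat(4) origin]
          smooth_on_has_derivative[OF D(1) S(2)]]) (use D(2) in simp)
  then have "(kappa2 g \<psi> n has_derivative (\<lambda>w. - ?K 0 * (inverse (D 0) * fderiv D 0 w * inverse (D 0))
        + fderiv ?K 0 w / D 0)) (at 0)"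
    by (rule has_derivative_transform_within_open[OF _ S]) (simp add: \<kappa>)
  from fun_cong[OF frechet_derivative_at[OF this]]
  have "fderiv (kappa2 g \<psi> n) 0 w = fderiv ?K 0 w / D 0" for w
    by (simp add: K0)
  moreover have "kappa2 g \<psi> n 0 = 0" using kappa2_zero_iff L0 by simp
  then have "principal_direction g \<psi> n 0 = vector [hatN \<psi> n 0, - hatM \<psi> n 0]"
    by (simp add: principal_direction_def)
  ultimately show ?thesis using D(2) by (simp add: ridge_point_def)
qed

end

section \<open>The dual surface\<close>

text \<open>The derivative of \<open>\<rho> n\<close> with \<open>\<rho> = \<langle>g + c, n\<rangle>\<close> is that of \<open>n\<close> followed by this linear map
  with \<open>b = g + c\<close>, because \<open>\<langle>dg, n\<rangle> = 0\<close>.\<close>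

definition dual_map :: "real^3 \<Rightarrow> real^3 \<Rightarrow> real^3 \<Rightarrow> real^3" where
  "dual_map b m w = (b \<bullet> w) *\<^sub>R m + (b \<bullet> m) *\<^sub>R w"

lemma linear_dual_map: "linear (dual_map b m)"
  by (rule linearI) (simp_all add: dual_map_def inner_add_right algebra_simps)

lemma dual_map_eq_0:
  assumes "b \<bullet> m \<noteq> 0" and 0: "dual_map b m w = 0"
  shows "w = 0"
proof -
  have "b \<bullet> dual_map b m w = 2 * (b \<bullet> m) * (b \<bullet> w)"
    by (simp add: dual_map_def inner_add_right algebra_simps)
  then have "b \<bullet> w = 0" using assms by simp
  then show ?thesis using assms by (simp add: dual_map_def)
qed

lemma dual_map_inj:
  assumes "b \<bullet> m \<noteq> 0" "dual_map b m w = dual_map b m w'"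
  shows "w = w'"
  using dual_map_eq_0[OF assms(1), of "w - w'"] assms(2) linear_diff[OF linear_dual_map] by simp

text \<open>With \<open>\<eta>\<^sub>0 = (N, -M)\<close>, which spans the kernel of \<open>dn\<close> if \<open>L = 0\<close>, both sides of the equivalence say that
  \<open>L = 0\<close> and that the derivative of \<open>K\<close> along \<open>\<eta>\<^sub>0\<close> does not vanish.\<close>

lemma dual_cuspidal_edge_adapted:
  fixes g n \<psi> :: "real^2 \<Rightarrow> real^3" and r :: real and c :: "real^3"
  defines "h \<equiv> \<lambda>z. ((g z + c) \<bullet> n z) *\<^sub>R n z"
  assumes r: "r > 0"
    and g: "smooth_on g (open_square r)" and n: "smooth_on n (open_square r)"
    and \<psi>: "smooth_on \<psi> (open_square r)"
    and unit: "\<And>z. z \<in> open_square r \<Longrightarrow> n z \<bullet> n z = 1"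
    and normal: "\<And>z w. z \<in> open_square r \<Longrightarrow> fderiv g z w \<bullet> n z = 0"
    and g_v: "\<And>z. z \<in> open_square r \<Longrightarrow> D2 g z = z $ 2 *\<^sub>R \<psi> z"
    and n_eq: "\<And>z. z \<in> open_square r \<Longrightarrow> n z = cross3 (D1 g z) (\<psi> z) /\<^sub>R norm (cross3 (D1 g z) (\<psi> z))"
    and N_pos: "hatN \<psi> n 0 > 0"
    and \<rho>: "(g 0 + c) \<bullet> n 0 \<noteq> 0"
  shows "cuspidal_edge_at h 0 \<longleftrightarrow> kappa2 g \<psi> n 0 = 0 \<and> \<not> ridge_point g \<psi> n 0"
proof -
  note ctx = r g n \<psi> unit normal g_v n_eq N_pos
  let ?R = "open_square r"
  let ?d = "\<lambda>f w. fderiv f (0::real^2) w"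
  let ?L = "hatL g n" and ?M = "hatM \<psi> n" and ?N = "hatN \<psi> n" and ?K = "hatK g \<psi> n"
  have 0: "0 \<in> ?R" using r by simp
  define T where "T = dual_map (g 0 + c) (n 0)"
  have linT: "linear T" unfolding T_def by (rule linear_dual_map)
  have injT: "w = w'" if "T w = T w'" for w w'
    using dual_map_inj[OF \<rho>] that unfolding T_def by blast
  have T0: "w = 0" if "T w = 0" for w using dual_map_eq_0[OF \<rho>] that unfolding T_def by blast
  have sgc: "smooth_on (\<lambda>z. g z + c) ?R" by (intro smooth_on_add g smooth_on_const open_open_square)
  have sh: "smooth_on h ?R"
    unfolding h_def by (intro smooth_on_scaleR smooth_on_inner sgc n open_open_square)
  have dgc: "((\<lambda>z. g z + c) has_derivative fderiv g z) (at z)" if "z \<in> ?R" for z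
    using has_derivative_add[OF smooth_on_has_derivative[OF g that] has_derivative_const] by simp
  have dh: "fderiv h z w = dual_map (g z + c) (n z) (fderiv n z w)"
    if z: "z \<in> ?R" for z w
  proof -
    note dn = smooth_on_has_derivative[OF n z]
    have "(h has_derivative (\<lambda>w. ((g z + c) \<bullet> n z) *\<^sub>R fderiv n z w +
        ((g z + c) \<bullet> fderiv n z w + fderiv g z w \<bullet> n z) *\<^sub>R n z)) (at z)"
      unfolding h_def by (intro has_derivative_scaleR has_derivative_inner dgc z dn)
    from fun_cong[OF frechet_derivative_at[OF this], of w] show ?thesis
      by (simp add: dual_map_def normal[OF z] add.commute)
  qed
  have dh0: "?d h w = T (?d n w)" for w using dh[OF 0] by (simp add: T_def)
  have ddh: "?d (\<lambda>z. fderiv h z \<eta>) w = T (?d (\<lambda>z. fderiv n z \<eta>) w)"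
    if null: "?d n \<eta> = 0" for \<eta> w
  proof -
    let ?m = "\<lambda>z. fderiv n z \<eta>"
    note dn = smooth_on_has_derivative[OF n 0] and dm = smooth_on_has_derivative[OF smooth_on_frechet[OF n] 0]
    have "((\<lambda>z. ((g z + c) \<bullet> ?m z) *\<^sub>R n z + ((g z + c) \<bullet> n z) *\<^sub>R ?m z) has_derivative
      (\<lambda>w. (((g 0 + c) \<bullet> ?m 0) *\<^sub>R ?d n w + ((g 0 + c) \<bullet> ?d ?m w + ?d g w \<bullet> ?m 0) *\<^sub>R n 0) +
        (((g 0 + c) \<bullet> n 0) *\<^sub>R ?d ?m w + ((g 0 + c) \<bullet> ?d n w + ?d g w \<bullet> n 0) *\<^sub>R ?m 0))) (at 0)"
      by (intro has_derivative_add has_derivative_scaleR has_derivative_inner dgc 0 dn dm)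
    then have "((\<lambda>z. ((g z + c) \<bullet> ?m z) *\<^sub>R n z + ((g z + c) \<bullet> n z) *\<^sub>R ?m z) has_derivative (\<lambda>w. T (?d ?m w))) (at 0)"
      by (rule has_derivative_eq_rhs) (simp add: null T_def dual_map_def)
    then have "((\<lambda>z. fderiv h z \<eta>) has_derivative (\<lambda>w. T (?d ?m w))) (at 0)"
      by (rule has_derivative_transform_within_open[OF _ open_open_square 0]) (simp add: dh dual_map_def)
    from fun_cong[OF frechet_derivative_at[OF this], of w] show ?thesis by simp
  qed
  have lin_n: "linear (?d n)" by (rule has_derivative_linear[OF smooth_on_has_derivative[OF n 0]])
  have lin_K: "linear (?d ?K)"
    by (rule has_derivative_linear[OF smooth_on_has_derivative[OF smooth_hat(4)[OF ctx] 0]])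
  note frame = frame_orthogonal_zero[OF ctx 0] and tangent = dn_tangent[OF ctx 0]
  note comp = dn_components[OF ctx 0, simplified]
  have W: "?N 0 * (?d (\<lambda>z. fderiv n z \<eta>) \<eta> \<bullet> D1 g 0) = - (\<eta> $ 1 * ?d ?K \<eta>)"
    if "?d n \<eta> = 0" "?L 0 = 0" for \<eta>
    by (rule second_derivative_dot_g_u[OF ctx]) (assumption | rule that)+
  define \<eta>0 where "\<eta>0 = (vector [?N 0, - ?M 0] :: real^2)"
  have "?thesis \<longleftrightarrow> (cuspidal_edge_at h 0 \<longleftrightarrow> ?L 0 = 0 \<and> ?d ?K \<eta>0 \<noteq> 0)"
    using kappa2_zero_iff[OF ctx] ridge_point_iff[OF ctx] by (auto simp: \<eta>0_def)
  moreover have "cuspidal_edge_at h 0 \<longleftrightarrow> ?L 0 = 0 \<and> ?d ?K \<eta>0 \<noteq> 0"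
  proof
    assume ce: "cuspidal_edge_at h 0"
    obtain \<eta> where \<eta>: "?d h \<eta> = 0" "?d (\<lambda>z. fderiv h z \<eta>) \<eta> \<notin> range (?d h)"
      by (rule cuspidal_edge_imp_fold[OF ce], rule that)
    let ?w = "?d (\<lambda>z. fderiv n z \<eta>) \<eta>"
    have null: "?d n \<eta> = 0" using \<eta>(1) T0 by (simp add: dh0)
    have out: "?w \<noteq> ?d n w" for w
      using \<eta>(2) ddh[OF null, of \<eta>] dh0 by (metis rangeI)
    have c1: "\<eta> $ 1 * ?L 0 = 0" and c2: "\<eta> $ 1 * ?M 0 + \<eta> $ 2 * ?N 0 = 0"
      using comp[of \<eta>] by (simp_all add: null)
    have e1: "\<eta> $ 1 \<noteq> 0"
    proof
      assume "\<eta> $ 1 = 0"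
      then have "\<eta> = 0" using c2 N_pos by (simp add: vec_eq_iff forall_2)
      have "((\<lambda>z. fderiv n z \<eta>) has_derivative ?d (\<lambda>z. fderiv n z \<eta>)) (at 0)"
        by (rule smooth_on_has_derivative[OF smooth_on_frechet[OF n] 0])
      then have "?w = 0" using linear_0[OF has_derivative_linear] \<open>\<eta> = 0\<close> by blast
      then show False using out[of 0] linear_0[OF lin_n] by simp
    qed
    then have L0: "?L 0 = 0" using c1 by simp
    have "\<eta> = (\<eta> $ 1 / ?N 0) *\<^sub>R \<eta>0"
      using c2 N_pos by (simp add: vec_eq_iff forall_2 \<eta>0_def field_simps)
    then have K\<eta>: "?d ?K \<eta> = (\<eta> $ 1 / ?N 0) * ?d ?K \<eta>0"
      using linear_cmul[OF lin_K, of "\<eta> $ 1 / ?N 0" \<eta>0] by simp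
    have "?d ?K \<eta>0 \<noteq> 0"
    proof
      assume "?d ?K \<eta>0 = 0"
      then have wg: "?w \<bullet> D1 g 0 = 0" using W[OF null L0] K\<eta> N_pos by simp
      have wn: "?w \<bullet> n 0 = 0"
      proof -
        have "((\<lambda>z. fderiv n z \<eta> \<bullet> n z) has_derivative
            (\<lambda>w. ?d n \<eta> \<bullet> ?d n w + ?d (\<lambda>z. fderiv n z \<eta>) w \<bullet> n 0)) (at 0)"
          by (intro has_derivative_inner smooth_on_has_derivative[OF n 0]
              smooth_on_has_derivative[OF smooth_on_frechet[OF n] 0])
        then have "((\<lambda>z. 0) has_derivative
            (\<lambda>w. ?d n \<eta> \<bullet> ?d n w + ?d (\<lambda>z. fderiv n z \<eta>) w \<bullet> n 0)) (at 0)"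
          by (rule has_derivative_transform_within_open[OF _ open_open_square 0]) (rule dn_tangent[OF ctx])
        from fun_cong[OF has_derivative_unique[OF this has_derivative_const], of \<eta>]
        show ?thesis by (simp add: null)
      qed
      \<comment> \<open>The image of \<open>dn\<close> is the tangent line orthogonal to \<open>g\<^sub>u\<close>, spanned by \<open>n\<^sub>v\<close>.\<close>
      let ?a = "- (?w \<bullet> \<psi> 0) / ?N 0"
      have "?w - ?d n (?a *\<^sub>R axis 2 1) = 0"
        by (rule frame) (use N_pos in \<open>simp_all add: inner_diff_left comp tangent wg wn axis_def\<close>)
      then show False using out by simp
    qed
    with L0 show "?L 0 = 0 \<and> ?d ?K \<eta>0 \<noteq> 0" by simp
  next
    assume *: "?L 0 = 0 \<and> ?d ?K \<eta>0 \<noteq> 0"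
    then have L0: "?L 0 = 0" by simp
    have null: "?d n \<eta>0 = 0"
      by (rule frame) (simp_all add: comp tangent L0 \<eta>0_def)
    let ?w = "?d (\<lambda>z. fderiv n z \<eta>0) \<eta>0"
    have wg: "?w \<bullet> D1 g 0 \<noteq> 0" using W[OF null L0] * N_pos by (auto simp: \<eta>0_def)
    let ?nv = "?d n (axis 2 1)"
    have nv: "?nv \<bullet> D1 g 0 = 0" "?nv \<noteq> 0"
      using comp[of "axis 2 1"] N_pos by (auto simp: L0 axis_def)
    have indep: "cross3 (?d h (axis 2 1)) (?d (\<lambda>z. fderiv h z \<eta>0) \<eta>0) \<noteq> 0"
    proof
      assume "cross3 (?d h (axis 2 1)) (?d (\<lambda>z. fderiv h z \<eta>0) \<eta>0) = 0"
      then have "collinear {0, T ?nv, T ?w}"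
        by (simp add: dh0 ddh[OF null] cross_eq_0)
      moreover have "T ?nv \<noteq> 0" using T0 nv(2) by blast
      moreover have "T ?w \<noteq> 0" using T0 wg by force
      ultimately obtain k where "T ?w = k *\<^sub>R T ?nv" unfolding collinear_lemma by blast
      then have "T ?w = T (k *\<^sub>R ?nv)" using linear_cmul[OF linT] by simp
      from injT[OF this] show False using wg nv(1) by simp
    qed
    \<comment> \<open>Write \<open>g + c = \<rho> n + \<tau>\<close> with \<open>\<tau>\<close> tangent.  As \<open>dh = \<langle>\<tau>, dn\<rangle> n + \<rho> dn\<close>, the vector \<open>\<rho> n - \<tau>\<close> is normal to \<open>h\<close>.\<close>
    define B where "B = (\<lambda>z. 2 *\<^sub>R h z - (g z + c))"
    have sB: "smooth_on B ?R"
      unfolding B_def by (intro smooth_on_diff smooth_on_scaleR smooth_on_const sh sgc open_open_square)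
    have dB: "?d B w = 2 *\<^sub>R ?d h w - ?d g w" for w
    proof -
      have "(B has_derivative (\<lambda>w. 2 *\<^sub>R ?d h w - ?d g w)) (at 0)"
        unfolding B_def
        by (intro has_derivative_diff has_derivative_scaleR_right smooth_on_has_derivative[OF sh 0] dgc 0)
      from fun_cong[OF frechet_derivative_at[OF this], of w] show ?thesis by simp
    qed
    have Bn: "B z \<bullet> n z = (g z + c) \<bullet> n z" if "z \<in> ?R" for z
      using unit[OF that] by (simp add: B_def h_def inner_diff_left)
    show "cuspidal_edge_at h 0"
    proof (rule cuspidal_edge_criterion[OF open_open_square 0 sh sB _ _ _ indep])
      fix z w assume z: "z \<in> ?R"
      have t: "fderiv n z w \<bullet> n z = 0" by (rule dn_tangent[OF ctx z])
      have 1: "fderiv n z w \<bullet> B z = - ((g z + c) \<bullet> fderiv n z w)"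
        by (simp add: B_def h_def inner_diff_right t inner_commute[of "g z + c"])
      have 2: "n z \<bullet> B z = (g z + c) \<bullet> n z" using Bn[OF z] by (simp only: inner_commute)
      have "fderiv h z w \<bullet> B z = ((g z + c) \<bullet> fderiv n z w) * (n z \<bullet> B z)
          + ((g z + c) \<bullet> n z) * (fderiv n z w \<bullet> B z)"
        by (simp add: dh[OF z] dual_map_def inner_add_left)
      then show "fderiv h z w \<bullet> B z = 0" unfolding 1 2 by simp
    next
      show "B 0 \<noteq> 0" using Bn[OF 0] \<rho> by force
      show "?d h \<eta>0 = 0" using linear_0[OF linT] by (simp add: dh0 null)
      have "?d g \<eta>0 = ?N 0 *\<^sub>R D1 g 0"
        using frechet_derivative_D1_D2[OF g 0, of \<eta>0] g_v[OF 0] by (simp add: \<eta>0_def)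
      moreover have "D1 g 0 \<bullet> T ?w = ((g 0 + c) \<bullet> n 0) * (?w \<bullet> D1 g 0)"
        using g_u_normal[OF ctx 0] by (simp add: T_def dual_map_def inner_add_right inner_commute)
      ultimately show "?d B \<eta>0 \<bullet> ?d (\<lambda>z. fderiv h z \<eta>0) \<eta>0 \<noteq> 0"
        using N_pos \<rho> wg linear_0[OF linT] by (simp add: dB dh0 null ddh[OF null] inner_diff_left)
    qed
  qed
  ultimately show ?thesis by blast
qed

theorem proposition4p2:
  fixes f \<nu> :: "real^2 \<Rightarrow> real^3" and U :: "(real^2) set" and p :: "real^2" and c :: "real^3"
    and \<phi> :: "real^2 \<Rightarrow> real^2" and V :: "(real^2) set" and \<psi> :: "real^2 \<Rightarrow> real^3"
  assumes front: "front_with f \<nu> U"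
    and sing: "p \<in> singular_set f U"
    and edge: "cuspidal_edge_at f p"
    and c_nonzero: "c \<noteq> 0"
    and c_transverse: "\<nu> p \<bullet> c \<noteq> 0"
    and rho_nonzero: "(f p + c) \<bullet> \<nu> p \<noteq> 0"
    and adapted: "adapted_coords f \<nu> U p \<phi> V \<psi>"
    and hatN_pos: "\<forall>z\<in>V. z $ 2 = 0 \<longrightarrow> hatN \<psi> (\<nu> \<circ> \<phi>) z > 0"
  shows "cuspidal_edge_at (dual_surface f \<nu> c) p \<longleftrightarrow>
           kappa2 (f \<circ> \<phi>) \<psi> (\<nu> \<circ> \<phi>) 0 = 0 \<and> \<not> ridge_point (f \<circ> \<phi>) \<psi> (\<nu> \<circ> \<phi>) 0"
proof -
  let ?g = "f \<circ> \<phi>" and ?n = "\<nu> \<circ> \<phi>" and ?h = "\<lambda>z. dual_surface f \<nu> c (\<phi> z)"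
  have \<phi>: "diffeo_on \<phi> V (\<phi> ` V)" and \<phi>U: "\<phi> ` V \<subseteq> U" and V0: "0 \<in> V" and \<phi>0: "\<phi> 0 = p"
    and \<psi>: "smooth_on \<psi> V" and f_v: "\<And>z. z \<in> V \<Longrightarrow> pd_v ?g z = z $ 2 *\<^sub>R \<psi> z"
    and n_eq: "\<And>z. z \<in> V \<Longrightarrow> \<nu> (\<phi> z) = cross3 (pd_u ?g z) (\<psi> z) /\<^sub>R norm (cross3 (pd_u ?g z) (\<psi> z))"
    using adapted unfolding adapted_coords_def by simp_all
  have oV: "open V" and s\<phi>: "smooth_on \<phi> V" using \<phi> by (simp_all add: diffeo_on_def)
  have sf: "smooth_on f U" and s\<nu>: "smooth_on \<nu> U" and unit: "\<And>z. z \<in> U \<Longrightarrow> norm (\<nu> z) = 1"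
    and normal: "\<And>z X. z \<in> U \<Longrightarrow> fderiv f z X \<bullet> \<nu> z = 0"
    using front unfolding front_with_def by simp_all
  have \<phi>mem: "\<phi> z \<in> U" if "z \<in> V" for z using \<phi>U that by blast
  have sg: "smooth_on ?g V" unfolding o_def by (rule smooth_on_compose[OF oV sf s\<phi> \<phi>mem])
  have sn: "smooth_on ?n V" unfolding o_def by (rule smooth_on_compose[OF oV s\<nu> s\<phi> \<phi>mem])
  obtain r where r: "r > 0" "open_square r \<subseteq> V"
    by (rule open_contains_open_square[OF oV V0])
  have "cuspidal_edge_at (\<lambda>z. ((?g z + c) \<bullet> ?n z) *\<^sub>R ?n z) 0 \<longleftrightarrow>
      kappa2 ?g \<psi> ?n 0 = 0 \<and> \<not> ridge_point ?g \<psi> ?n 0"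
  proof (rule dual_cuspidal_edge_adapted[OF r(1)])
    show "smooth_on ?g (open_square r)" by (rule smooth_on_subset[OF sg r(2)])
    show "smooth_on ?n (open_square r)" by (rule smooth_on_subset[OF sn r(2)])
    show "smooth_on \<psi> (open_square r)" by (rule smooth_on_subset[OF \<psi> r(2)])
    show "(?g 0 + c) \<bullet> ?n 0 \<noteq> 0" using rho_nonzero by (simp add: \<phi>0)
    show "hatN \<psi> ?n 0 > 0" using hatN_pos V0 by simp
    fix z assume "z \<in> open_square r"
    then have z: "z \<in> V" using r(2) by blast
    show "?n z \<bullet> ?n z = 1" using unit[OF \<phi>mem[OF z]] by (simp add: norm_eq_1)
    show "D2 ?g z = z $ 2 *\<^sub>R \<psi> z" using f_v[OF z] by (simp add: pd_eq)
    show "?n z = cross3 (D1 ?g z) (\<psi> z) /\<^sub>R norm (cross3 (D1 ?g z) (\<psi> z))"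
      using n_eq[OF z] by (simp add: pd_eq)
    show "fderiv ?g z w \<bullet> ?n z = 0" for w
    proof -
      have "fderiv ?g z w = fderiv f (\<phi> z) (fderiv \<phi> z w)"
        by (rule frechet_compose_smooth[where h="?g" and F=f and m=\<phi> and U=V and T=U, OF oV z _ sf s\<phi> \<phi>mem[OF z]])
          simp
      then show ?thesis using normal[OF \<phi>mem[OF z]] by simp
    qed
  qed
  moreover have "(\<lambda>z. ((?g z + c) \<bullet> ?n z) *\<^sub>R ?n z) = ?h"
    by (simp add: fun_eq_iff dual_surface_def)
  moreover have "cuspidal_edge_at (dual_surface f \<nu> c) p \<longleftrightarrow> cuspidal_edge_at ?h 0"
  proof
    obtain \<theta> where \<theta>: "diffeo_on \<theta> (\<phi> ` V) V" "\<And>z. z \<in> V \<Longrightarrow> \<theta> (\<phi> z) = z"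
        "\<And>y. y \<in> \<phi> ` V \<Longrightarrow> \<phi> (\<theta> y) = y"
      by (rule diffeo_on_inverse[OF \<phi>], rule that)
    have "p \<in> \<phi> ` V" using V0 \<phi>0 by blast
    moreover assume "cuspidal_edge_at (dual_surface f \<nu> c) p"
    ultimately have "cuspidal_edge_at ?h (\<theta> p)"
      using cuspidal_edge_at_transfer[OF \<theta>(1), of p ?h "dual_surface f \<nu> c"] \<theta>(3) by simp
    then show "cuspidal_edge_at ?h 0" using \<theta>(2)[OF V0] \<phi>0 by simp
  next
    assume "cuspidal_edge_at ?h 0"
    then show "cuspidal_edge_at (dual_surface f \<nu> c) p"
      using cuspidal_edge_at_transfer[OF \<phi> V0, of "dual_surface f \<nu> c" ?h] \<phi>0 by simp
  qed
  ultimately show ?thesis by simp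
qed

end
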